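(* Let $\mu$ be a Borel measure on $\mathbb{R}$ with $\int_{\mathbb{R}}(1+|t|)^{-1}d\mu(t)<\infty$, $A=M_t$ on $L^2(\mu)$, $\varphi\equiv\mathbf 1$, and for $\alpha\in\mathbb{R}$ let $A_\alpha=A+\alpha(\,\cdot\,,\varphi)\varphi$. Let $d\mu=w\,dt+d\mu_{\mathrm s}$ be the Lebesgue decomposition of the spectral measure $\mu=\mu^\varphi$ of $A$. Let $I$ be a bounded closed interval (of positive length) such that the distribution function $D_w(y)=|\{x\in I:\ w(x)<y\}|$ satisfies $$\int_0^\delta\frac{1}{D_w(y)}\,dy=\infty$$ for some $\delta>0$ (equivalently, its inverse $w^*$ satisfies $\int_0^\varepsilon x^{-2}w^*(x)\,dx=\infty$ for some $\varepsilon>0$). Then for all $\alpha\in\mathbb{R}\setminus\{0\}$ the operator $A_\alpha$ has empty singular spectrum on $I$.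
   Context: $|\cdot|$ is Lebesgue measure on $\mathbb{R}$ and $1/D_w(y)=+\infty$ where $D_w(y)=0$. The increasing rearrangement of $w|_I$ is the (generalized) inverse function $w^*=(D_w)^{-1}$, $w^*(x)=\inf\{y\ge0: D_w(y)>x\}$, $0<x<|I|$; $\varepsilon$ is taken in $(0,|I|)$. $A=M_t$ is multiplication by the independent variable in the complex space $L^2(\mu)$, with maximal domain. (Every self-adjoint $A$ with a cyclic vector $\varphi\in\mathcal H_{-1}(A)$ is unitarily equivalent to this model, with $\mu=\mu^\varphi$ the spectral measure corresponding to $\varphi$, $\int\frac{d\mu^\varphi(t)}{t-\lambda}=((A-\lambda)^{-1}\varphi,\varphi)$, and $\varphi$ represented by $\mathbf 1$.) The function $\mathbf 1$ need not lie in $L^2(\mu)$. For $\lambda\in\mathbb{C}\setminus\mathbb{R}$ put $F(\lambda)=\int\frac{d\mu(t)}{t-\lambda}$. $A_\alpha=A+\alpha(\cdot,\varphi)\varphi$ denotes the self-adjoint operator on $L^2(\mu)$ whose resolvent is $$(A_\alpha-\lambda)^{-1}f=(A-\lambda)^{-1}f-\frac{\alpha\,\int\frac{f(t)}{t-\lambda}d\mu(t)}{1+\alpha F(\lambda)}\cdot\frac{1}{t-\lambda},\qquad f\in L^2(\mu),\ \lambda\in\mathbb{C}\setminus\mathbb{R}$$ (the usual rank one perturbation if $\mathbf 1\in L^2(\mu)$). The formula is also used for $f=\varphi$, giving $(A_\alpha-\lambda)^{-1}\varphi=(1+\alpha F(\lambda))^{-1}(t-\lambda)^{-1}$; $\varphi$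 is cyclic for $A_\alpha$. $\mu_\alpha$ is the spectral measure of $A_\alpha$ corresponding to $\varphi$: the unique Borel measure with $\int\frac{d\mu_\alpha(s)}{s-\lambda}=((A_\alpha-\lambda)^{-1}\varphi,\varphi)$ for all $\lambda\in\mathbb{C}\setminus\mathbb{R}$. "$A_\alpha$ has empty singular spectrum on $I$" means that $\mu_\alpha$ has no singular part on $I$, i.e. $(\mu_\alpha)_{\mathrm s}(I)=0$, where $(\mu_\alpha)_{\mathrm s}$ is the part of $\mu_\alpha$ singular with respect to Lebesgue measure. *)

theory Defs
  imports "HOL-Analysis.Analysis"
begin

section \<open>The space \<open>L\<^sup>2(\<mu>)\<close> and unbounded operators\<close>

text \<open>
  Elements of \<open>L\<^sup>2(\<mu>)\<close> are represented by square integrable functions, so equality in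
  \<open>L\<^sup>2(\<mu>)\<close> is equality almost everywhere.  The inner product is linear in its first argument.
  An unbounded operator is represented by its graph, a set of pairs of such functions.
\<close>

definition L2 :: "real measure \<Rightarrow> (real \<Rightarrow> complex) set" where
  "L2 \<mu> = {f \<in> borel_measurable \<mu>. integrable \<mu> (\<lambda>t. (cmod (f t))\<^sup>2)}"

definition l2_inner :: "real measure \<Rightarrow> (real \<Rightarrow> complex) \<Rightarrow> (real \<Rightarrow> complex) \<Rightarrow> complex" where
  "l2_inner \<mu> f g = (\<integral>t. f t * cnj (g t) \<partial>\<mu>)"

type_synonym l2_op = "((real \<Rightarrow> complex) \<times> (real \<Rightarrow> complex)) set"

definition mult_op :: "real measure \<Rightarrow> l2_op" where
  "mult_op \<mu> = {(f, g). f \<in> L2 \<mu> \<and> g \<in> L2 \<mu> \<and> (AE t in \<mu>. g t = of_real t * f t)}"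

definition densely_defined :: "real measure \<Rightarrow> l2_op \<Rightarrow> bool" where
  "densely_defined \<mu> T \<longleftrightarrow>
     (\<forall>f \<in> L2 \<mu>. \<forall>e > 0. \<exists>u \<in> Domain T. sqrt (\<integral>t. (cmod (f t - u t))\<^sup>2 \<partial>\<mu>) < e)"

definition adjoint_op :: "real measure \<Rightarrow> l2_op \<Rightarrow> l2_op" where
  "adjoint_op \<mu> T = {(u, v). u \<in> L2 \<mu> \<and> v \<in> L2 \<mu> \<and>
                              (\<forall>(g, h) \<in> T. l2_inner \<mu> h u = l2_inner \<mu> g v)}"

text \<open>
  The equation \<open>T = T*\<close> already makes \<open>T\<close> a linear subspace of \<open>L\<^sup>2(\<mu>) \<times> L\<^sup>2(\<mu>)\<close>, closed under
  equality almost everywhere; density of the domain makes \<open>T = T*\<close> single-valued.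
\<close>

definition self_adjoint_op :: "real measure \<Rightarrow> l2_op \<Rightarrow> bool" where
  "self_adjoint_op \<mu> T \<longleftrightarrow> densely_defined \<mu> T \<and> adjoint_op \<mu> T = T"

text \<open>
  \<open>resolvent_at \<mu> T z f u\<close> says \<open>u = (T - z)\<^sup>-\<^sup>1 f\<close> for self-adjoint \<open>T\<close> and non-real \<open>z\<close>.  The
  equation \<open>(T - z) u = f\<close> is tested against the domain of \<open>T\<close>,
  i.e. \<open>(u, (T - cnj z) g) = (f, g)\<close>, so that it also makes sense for \<open>f\<close> in the larger space
  \<open>\<H>\<^sub>-\<^sub>1\<close>, such as \<open>f = 1\<close>.  For \<open>f\<close> in \<open>L\<^sup>2(\<mu>)\<close> it is the usual resolvent equation, see
  \<open>resolvent_at_L2\<close> below.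
\<close>

definition resolvent_at ::
    "real measure \<Rightarrow> l2_op \<Rightarrow> complex \<Rightarrow> (real \<Rightarrow> complex) \<Rightarrow> (real \<Rightarrow> complex) \<Rightarrow> bool" where
  "resolvent_at \<mu> T z f u \<longleftrightarrow> u \<in> L2 \<mu> \<and>
     (\<forall>(g, h) \<in> T. l2_inner \<mu> u (\<lambda>t. h t - cnj z * g t) = l2_inner \<mu> f g)"


section \<open>Rank one perturbations and spectral measures\<close>

definition borel_transform :: "real measure \<Rightarrow> complex \<Rightarrow> complex" where
  "borel_transform \<mu> z = (\<integral>t. 1 / (of_real t - z) \<partial>\<mu>)"

text \<open>
  \<open>rank_one_perturbation \<mu> \<alpha> T\<close>: with \<open>A = M\<^sub>t\<close> and \<open>\<phi> = 1\<close>, \<open>T\<close> is the self-adjoint operator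
  \<open>A\<^sub>\<alpha> = A + \<alpha> (\<cdot>, \<phi>) \<phi>\<close> on \<open>L\<^sup>2(\<mu>)\<close>, determined by its resolvent.
\<close>

definition rank_one_perturbation :: "real measure \<Rightarrow> real \<Rightarrow> l2_op \<Rightarrow> bool" where
  "rank_one_perturbation \<mu> \<alpha> T \<longleftrightarrow> self_adjoint_op \<mu> T \<and>
     (\<forall>z. z \<notin> \<real> \<longrightarrow> (\<forall>f \<in> insert (\<lambda>t. 1) (L2 \<mu>). \<forall>u. resolvent_at \<mu> T z f u \<longleftrightarrow>
        u \<in> L2 \<mu> \<and> (\<exists>a. resolvent_at \<mu> (mult_op \<mu>) z f a \<and>
          (AE t in \<mu>. u t = a t
             - of_real \<alpha> * (\<integral>s. f s / (of_real s - z) \<partial>\<mu>) / (1 + of_real \<alpha> * borel_transform \<mu> z)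
               * (1 / (of_real t - z))))))"

text \<open>
  The spectral measure \<open>\<nu>\<close> of \<open>T\<close> corresponding to \<open>\<phi>\<close>; integrability is stated explicitly since
  the integral of a non-integrable function is \<open>0\<close> by convention.
\<close>

definition is_spectral_measure ::
    "real measure \<Rightarrow> l2_op \<Rightarrow> (real \<Rightarrow> complex) \<Rightarrow> real measure \<Rightarrow> bool" where
  "is_spectral_measure \<mu> T \<phi> \<nu> \<longleftrightarrow> sets \<nu> = sets borel \<and>
     (\<forall>z. z \<notin> \<real> \<longrightarrow> integrable \<nu> (\<lambda>s. 1 / (of_real s - z)) \<and>
        (\<exists>u. resolvent_at \<mu> T z \<phi> u \<and> (\<integral>s. 1 / (of_real s - z) \<partial>\<nu>) = l2_inner \<mu> u \<phi>))"

definition lebesgue_decomposition ::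
    "real measure \<Rightarrow> (real \<Rightarrow> ennreal) \<Rightarrow> real measure \<Rightarrow> bool" where
  "lebesgue_decomposition \<nu> w \<nu>s \<longleftrightarrow>
     w \<in> borel_measurable borel \<and> sets \<nu>s = sets borel \<and>
     (\<exists>N \<in> sets borel. emeasure lborel N = 0 \<and> emeasure \<nu>s (- N) = 0) \<and>
     (\<forall>B \<in> sets borel. emeasure \<nu> B = emeasure (density lborel w) B + emeasure \<nu>s B)"

definition empty_singular_spectrum ::
    "real measure \<Rightarrow> l2_op \<Rightarrow> (real \<Rightarrow> complex) \<Rightarrow> real set \<Rightarrow> bool" where
  "empty_singular_spectrum \<mu> T \<phi> I \<longleftrightarrow>
     (\<forall>\<nu> v \<nu>s. is_spectral_measure \<mu> T \<phi> \<nu> \<longrightarrow> lebesgue_decomposition \<nu> v \<nu>s \<longrightarrow>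
        emeasure \<nu>s I = 0)"


section \<open>Distribution function and increasing rearrangement\<close>

text \<open>
  Both functions are meant for \<open>I\<close> of positive length: \<open>distr_fun\<close> is \<open>D\<^sub>w\<close>, with values in
  \<^typ>\<open>ennreal\<close>, where \<open>1 / 0 = \<infinity>\<close>; \<open>incr_rearr\<close> is its generalized inverse \<open>w*\<close>.  For \<open>w\<close>
  finite almost everywhere on \<open>I\<close> and \<open>0 < x < |I|\<close> the set in the infimum is nonempty.
\<close>

definition distr_fun :: "(real \<Rightarrow> ennreal) \<Rightarrow> real set \<Rightarrow> real \<Rightarrow> ennreal" where
  "distr_fun w I y = emeasure lborel {x \<in> I. w x < ennreal y}"

definition incr_rearr :: "(real \<Rightarrow> ennreal) \<Rightarrow> real set \<Rightarrow> real \<Rightarrow> real" where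
  "incr_rearr w I x = Inf {y. 0 \<le> y \<and> distr_fun w I y > ennreal x}"


section \<open>Sanity checks for \<open>resolvent_at\<close> and \<open>is_spectral_measure\<close>\<close>

lemma borel_measurable_cnj':
  assumes "f \<in> borel_measurable M"
  shows "(\<lambda>t. cnj (f t)) \<in> borel_measurable M"
proof -
  have "cnj \<in> borel_measurable borel"
    by (intro borel_measurable_continuous_onI continuous_on_cnj continuous_on_id)
  from measurable_compose[OF assms this] show ?thesis .
qed

lemma L2_mult_integrable:
  assumes "f \<in> L2 \<mu>" "g \<in> L2 \<mu>"
  shows "integrable \<mu> (\<lambda>t. f t * cnj (g t))"
proof (rule Bochner_Integration.integrable_bound)
  show "integrable \<mu> (\<lambda>t. (cmod (f t))\<^sup>2 + (cmod (g t))\<^sup>2)"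
    using assms by (auto simp: L2_def)
  show "(\<lambda>t. f t * cnj (g t)) \<in> borel_measurable \<mu>"
    using assms by (auto simp: L2_def intro!: borel_measurable_times borel_measurable_cnj')
  have "norm (f t * cnj (g t)) \<le> norm ((cmod (f t))\<^sup>2 + (cmod (g t))\<^sup>2)" for t
  proof -
    have "2 * (cmod (f t) * cmod (g t)) \<le> (cmod (f t))\<^sup>2 + (cmod (g t))\<^sup>2"
      using sum_squares_bound[of "cmod (f t)" "cmod (g t)"] by simp
    moreover have "0 \<le> cmod (f t) * cmod (g t)" by simp
    ultimately show ?thesis unfolding norm_mult complex_mod_cnj by (simp only: real_norm_def)
  qed
  then show "AE t in \<mu>. norm (f t * cnj (g t)) \<le> norm ((cmod (f t))\<^sup>2 + (cmod (g t))\<^sup>2)"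
    by simp
qed

lemma L2_diff:
  assumes "f \<in> L2 \<mu>" "g \<in> L2 \<mu>"
  shows "(\<lambda>t. f t - g t) \<in> L2 \<mu>"
proof -
  have "integrable \<mu> (\<lambda>t. (cmod (f t - g t))\<^sup>2)"
  proof (rule Bochner_Integration.integrable_bound)
    show "integrable \<mu> (\<lambda>t. 2 * (cmod (f t))\<^sup>2 + 2 * (cmod (g t))\<^sup>2)"
      using assms by (auto simp: L2_def)
    show "(\<lambda>t. (cmod (f t - g t))\<^sup>2) \<in> borel_measurable \<mu>"
      using assms by (auto simp: L2_def)
    have "(cmod (f t - g t))\<^sup>2 \<le> 2 * (cmod (f t))\<^sup>2 + 2 * (cmod (g t))\<^sup>2" for t
    proof -
      have "(cmod (f t - g t))\<^sup>2 \<le> (cmod (f t) + cmod (g t))\<^sup>2"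
        by (rule power_mono[OF norm_triangle_ineq4]) simp
      also have "\<dots> \<le> 2 * (cmod (f t))\<^sup>2 + 2 * (cmod (g t))\<^sup>2"
        using sum_squares_bound[of "cmod (f t)" "cmod (g t)"] by (simp add: power2_sum)
      finally show ?thesis .
    qed
    then show "AE t in \<mu>. norm ((cmod (f t - g t))\<^sup>2) \<le> norm (2 * (cmod (f t))\<^sup>2 + 2 * (cmod (g t))\<^sup>2)"
      by (intro AE_I2) (simp add: abs_of_nonneg)
  qed
  then show ?thesis using assms by (auto simp: L2_def)
qed

lemma L2_mult_bounded:
  assumes "f \<in> L2 \<mu>" "m \<in> borel_measurable \<mu>" "\<And>t. cmod (m t) \<le> K"
  shows "(\<lambda>t. m t * f t) \<in> L2 \<mu>"
proof -
  have "integrable \<mu> (\<lambda>t. (cmod (m t * f t))\<^sup>2)"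
  proof (rule Bochner_Integration.integrable_bound)
    show "integrable \<mu> (\<lambda>t. K\<^sup>2 * (cmod (f t))\<^sup>2)"
      using assms by (auto simp: L2_def)
    show "(\<lambda>t. (cmod (m t * f t))\<^sup>2) \<in> borel_measurable \<mu>"
      using assms by (auto simp: L2_def)
    have "(cmod (m t * f t))\<^sup>2 \<le> K\<^sup>2 * (cmod (f t))\<^sup>2" for t
      using power_mono[OF assms(3)[of t], of 2]
      by (simp add: norm_mult power_mult_distrib mult_right_mono)
    then show "AE t in \<mu>. norm ((cmod (m t * f t))\<^sup>2) \<le> norm (K\<^sup>2 * (cmod (f t))\<^sup>2)"
      by (intro AE_I2) simp
  qed
  then show ?thesis using assms by (auto simp: L2_def)
qed

lemma L2_scale: "f \<in> L2 \<mu> \<Longrightarrow> (\<lambda>t. c * f t) \<in> L2 \<mu>"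
  using L2_mult_bounded[of f \<mu> "\<lambda>_. c" "cmod c"] by simp

lemma L2_add:
  assumes "f \<in> L2 \<mu>" "g \<in> L2 \<mu>"
  shows "(\<lambda>t. f t + g t) \<in> L2 \<mu>"
  using L2_diff[OF assms(1) L2_scale[OF assms(2), of "-1"]] by simp

lemma l2_inner_cnj: "l2_inner \<mu> f g = cnj (l2_inner \<mu> g f)"
  using Bochner_Integration.integral_cnj[of \<mu> "\<lambda>t. g t * cnj (f t)"] by (simp add: l2_inner_def mult.commute)

lemma resolvent_at_L2:
  assumes T: "self_adjoint_op \<mu> T" and f: "f \<in> L2 \<mu>"
  shows "resolvent_at \<mu> T z f u \<longleftrightarrow> (u, \<lambda>t. f t + z * u t) \<in> T"
proof (cases "u \<in> L2 \<mu>")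
  case u: True
  have T': "T = adjoint_op \<mu> T" using T by (simp add: self_adjoint_op_def)
  have *: "l2_inner \<mu> u (\<lambda>t. h t - cnj z * g t) = l2_inner \<mu> f g \<longleftrightarrow>
           l2_inner \<mu> h u = l2_inner \<mu> g (\<lambda>t. f t + z * u t)" if "(g, h) \<in> T" for g h
  proof -
    have gh: "g \<in> L2 \<mu>" "h \<in> L2 \<mu>" using that by (subst (asm) T', simp add: adjoint_op_def)+
    have "l2_inner \<mu> u (\<lambda>t. h t - cnj z * g t) = (\<integral>t. u t * cnj (h t) - z * (u t * cnj (g t)) \<partial>\<mu>)"
      by (simp add: l2_inner_def algebra_simps)
    also have "\<dots> = l2_inner \<mu> u h - z * l2_inner \<mu> u g"
      using L2_mult_integrable[OF u gh(1)] L2_mult_integrable[OF u gh(2)] by (simp add: l2_inner_def)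
    finally have 1: "l2_inner \<mu> u (\<lambda>t. h t - cnj z * g t) = l2_inner \<mu> u h - z * l2_inner \<mu> u g" .
    have "l2_inner \<mu> (\<lambda>t. f t + z * u t) g = (\<integral>t. f t * cnj (g t) + z * (u t * cnj (g t)) \<partial>\<mu>)"
      by (simp add: l2_inner_def algebra_simps)
    also have "\<dots> = l2_inner \<mu> f g + z * l2_inner \<mu> u g"
      using L2_mult_integrable[OF u gh(1)] L2_mult_integrable[OF f gh(1)] by (simp add: l2_inner_def)
    finally have 2: "l2_inner \<mu> (\<lambda>t. f t + z * u t) g = l2_inner \<mu> f g + z * l2_inner \<mu> u g" .
    have "l2_inner \<mu> h u = l2_inner \<mu> g (\<lambda>t. f t + z * u t) \<longleftrightarrow>
          l2_inner \<mu> u h = l2_inner \<mu> (\<lambda>t. f t + z * u t) g"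
      by (metis l2_inner_cnj complex_cnj_cnj)
    then show ?thesis using 1 2 by (auto simp: algebra_simps)
  qed
  have "(u, \<lambda>t. f t + z * u t) \<in> T \<longleftrightarrow>
        (\<forall>(g, h) \<in> T. l2_inner \<mu> h u = l2_inner \<mu> g (\<lambda>t. f t + z * u t))"
    by (subst T') (simp add: adjoint_op_def u L2_add[OF f L2_scale[OF u]])
  then show ?thesis using * u by (auto simp: resolvent_at_def)
next
  case False
  have "T = adjoint_op \<mu> T" using T by (simp add: self_adjoint_op_def)
  then have "(u, v) \<notin> T" for v using False by (auto simp: adjoint_op_def)
  then show ?thesis using False by (auto simp: resolvent_at_def)
qed

lemma cmod_inverse_resolvent_le:
  assumes "z \<notin> \<real>"
  shows "cmod (1 / (of_real t - z)) \<le> 1 / \<bar>Im z\<bar>"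
    and "cmod (of_real t / (of_real t - z)) \<le> 1 + cmod z / \<bar>Im z\<bar>"
    and "(cmod (1 / (of_real t - z)))\<^sup>2 \<le> (1 + (1 + cmod z) / \<bar>Im z\<bar>) / \<bar>Im z\<bar> * (1 / (1 + \<bar>t\<bar>))"
    and "of_real t \<noteq> z"
    and "cmod (1 / (of_real t - z)) \<le> (1 + (1 + cmod z) / \<bar>Im z\<bar>) * (1 / (1 + \<bar>t\<bar>))"
proof -
  have i: "\<bar>Im z\<bar> > 0" using assms by (auto simp: complex_is_Real_iff)
  have d: "\<bar>Im z\<bar> \<le> cmod (of_real t - z)" using abs_Im_le_cmod[of "of_real t - z"] by simp
  show ne: "of_real t \<noteq> z" using assms by (metis Reals_of_real)
  show 1: "cmod (1 / (of_real t - z)) \<le> 1 / \<bar>Im z\<bar>"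
    using i d by (simp add: norm_divide divide_simps)
  have "of_real t / (of_real t - z) = 1 + z * (1 / (of_real t - z))"
    using ne by (simp add: field_simps)
  then have "cmod (of_real t / (of_real t - z)) \<le> 1 + cmod (z * (1 / (of_real t - z)))"
    by (metis norm_triangle_ineq norm_one)
  also have "\<dots> \<le> 1 + cmod z * (1 / \<bar>Im z\<bar>)"
    unfolding norm_mult by (intro add_left_mono mult_left_mono 1) simp
  finally show "cmod (of_real t / (of_real t - z)) \<le> 1 + cmod z / \<bar>Im z\<bar>" by simp
  define D where "D = cmod (of_real t - z)"
  have D: "D \<ge> \<bar>Im z\<bar>" "D > 0" using d i by (auto simp: D_def)
  have "\<bar>t\<bar> \<le> D + cmod z"
    using norm_triangle_ineq[of "of_real t - z" z] by (simp add: D_def)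
  then have "1 + \<bar>t\<bar> \<le> D + (1 + cmod z)" by simp
  also have "\<dots> \<le> D + (1 + cmod z) * (D / \<bar>Im z\<bar>)"
    proof (intro add_left_mono)
    have "1 \<le> D / \<bar>Im z\<bar>" using D i by simp
    then show "1 + cmod z \<le> (1 + cmod z) * (D / \<bar>Im z\<bar>)"
      using mult_left_mono[of 1 "D / \<bar>Im z\<bar>" "1 + cmod z"] by simp
  qed
  also have "\<dots> = D * (1 + (1 + cmod z) / \<bar>Im z\<bar>)" by (simp add: field_simps)
  finally have A: "1 + \<bar>t\<bar> \<le> D * (1 + (1 + cmod z) / \<bar>Im z\<bar>)" .
  have pos: "1 + \<bar>t\<bar> > 0" by simp
  from A have E: "1 / D \<le> (1 + (1 + cmod z) / \<bar>Im z\<bar>) * (1 / (1 + \<bar>t\<bar>))"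
    using D pos by (simp add: pos_divide_le_eq pos_le_divide_eq mult.commute)
  then show "cmod (1 / (of_real t - z)) \<le> (1 + (1 + cmod z) / \<bar>Im z\<bar>) * (1 / (1 + \<bar>t\<bar>))"
    by (simp add: norm_divide D_def)
  have "(1 / D) * (1 / D) \<le> (1 / \<bar>Im z\<bar>) * ((1 + (1 + cmod z) / \<bar>Im z\<bar>) * (1 / (1 + \<bar>t\<bar>)))"
  proof (rule mult_mono[OF _ E])
    show "1 / D \<le> 1 / \<bar>Im z\<bar>" using D(1) i by (intro divide_left_mono) auto
  qed (use D in auto)
  then show "(cmod (1 / (of_real t - z)))\<^sup>2 \<le> (1 + (1 + cmod z) / \<bar>Im z\<bar>) / \<bar>Im z\<bar> * (1 / (1 + \<bar>t\<bar>))"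
    by (simp add: norm_divide D_def power2_eq_square)
qed

lemma resolvent_at_mult_op:
  assumes \<mu>: "sets \<mu> = sets borel" "integrable \<mu> (\<lambda>t. 1 / (1 + \<bar>t\<bar>))"
    and z: "z \<notin> \<real>" and f: "f \<in> insert (\<lambda>t. 1) (L2 \<mu>)"
  shows "resolvent_at \<mu> (mult_op \<mu>) z f u \<longleftrightarrow>
           u \<in> L2 \<mu> \<and> (AE t in \<mu>. u t = f t / (of_real t - z))"
proof (cases "u \<in> L2 \<mu>")
  case u: True
  have meas: "g \<in> borel_measurable \<mu>" if "g \<in> borel_measurable borel" for g :: "real \<Rightarrow> complex"
    using that \<mu>(1) by (metis measurable_cong_sets)
  have mu: "u \<in> borel_measurable \<mu>" and mf: "f \<in> borel_measurable \<mu>"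
    using u f by (auto simp: L2_def)
  have z': "cnj z \<notin> \<real>" using z by (simp add: complex_is_Real_iff)
  have frac: "(\<lambda>t. 1 / (of_real t - x)) \<in> borel_measurable \<mu>"
      "(\<lambda>t. of_real t / (of_real t - x)) \<in> borel_measurable \<mu>" if "x \<notin> \<real>" for x :: complex
    using cmod_inverse_resolvent_le(4)[OF that]
    by (intro meas borel_measurable_continuous_onI continuous_intros; simp)+
  define v where "v = (\<lambda>t. f t / (of_real t - z))"
  have v: "v \<in> L2 \<mu>"
  proof (cases "f \<in> L2 \<mu>")
    case True
    then have "(\<lambda>t. (1 / (of_real t - z)) * f t) \<in> L2 \<mu>"
      by (rule L2_mult_bounded[OF _ frac(1)[OF z] cmod_inverse_resolvent_le(1)[OF z]])
    then show ?thesis by (simp add: v_def)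
  next
    case False
    then have f1: "f = (\<lambda>t. 1)" using f by auto
    have "integrable \<mu> (\<lambda>t. (cmod (1 / (of_real t - z)))\<^sup>2)"
    proof (rule Bochner_Integration.integrable_bound)
      show "integrable \<mu> (\<lambda>t. (1 + (1 + cmod z) / \<bar>Im z\<bar>) / \<bar>Im z\<bar> * (1 / (1 + \<bar>t\<bar>)))"
        using \<mu>(2) by (rule integrable_mult_right)
      show "AE t in \<mu>. norm ((cmod (1 / (of_real t - z)))\<^sup>2)
              \<le> norm ((1 + (1 + cmod z) / \<bar>Im z\<bar>) / \<bar>Im z\<bar> * (1 / (1 + \<bar>t\<bar>)))"
        using order_trans[OF cmod_inverse_resolvent_le(3)[OF z] abs_ge_self] by (intro AE_I2) simp
      show "(\<lambda>t. (cmod (1 / (of_real t - z)))\<^sup>2) \<in> borel_measurable \<mu>"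
        using frac(1)[OF z] by simp
    qed
    then show ?thesis using frac(1)[OF z] by (simp add: v_def f1 L2_def)
  qed
  have mv: "v \<in> borel_measurable \<mu>" using v by (simp add: L2_def)
  have v_eq: "v t * (of_real t - z) = f t" for t
    using cmod_inverse_resolvent_le(4)[OF z, of t] by (simp add: v_def)
  have inner_v: "l2_inner \<mu> v (\<lambda>t. h t - cnj z * g t) = l2_inner \<mu> f g" if "(g, h) \<in> mult_op \<mu>" for g h
  proof -
    have gh: "g \<in> L2 \<mu>" "h \<in> L2 \<mu>" "AE t in \<mu>. h t = of_real t * g t"
      using that by (auto simp: mult_op_def)
    have mgh: "g \<in> borel_measurable \<mu>" "h \<in> borel_measurable \<mu>" using gh by (auto simp: L2_def)
    have "AE t in \<mu>. v t * cnj (h t - cnj z * g t) = f t * cnj (g t)"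
      using gh(3) by eventually_elim (simp add: v_eq[symmetric] algebra_simps)
    then show ?thesis unfolding l2_inner_def
      by (rule integral_cong_AE[rotated 2])
        (intro borel_measurable_times borel_measurable_cnj' borel_measurable_diff borel_measurable_const
          mv mf mgh)+
  qed
  show ?thesis
  proof
    assume R: "resolvent_at \<mu> (mult_op \<mu>) z f u"
    define d where "d = (\<lambda>t. u t - v t)"
    have d: "d \<in> L2 \<mu>" unfolding d_def by (rule L2_diff[OF u v])
    define g where "g = (\<lambda>t. (1 / (of_real t - cnj z)) * d t)"
    define h where "h = (\<lambda>t. (of_real t / (of_real t - cnj z)) * d t)"
    have "g \<in> L2 \<mu>" unfolding g_def
      by (rule L2_mult_bounded[OF d frac(1)[OF z'] cmod_inverse_resolvent_le(1)[OF z']])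
    moreover have "h \<in> L2 \<mu>" unfolding h_def
      by (rule L2_mult_bounded[OF d frac(2)[OF z'] cmod_inverse_resolvent_le(2)[OF z']])
    ultimately have gh: "(g, h) \<in> mult_op \<mu>" by (auto simp: mult_op_def g_def h_def)
    have hd: "(\<lambda>t. h t - cnj z * g t) = d"
    proof
      fix t
      show "h t - cnj z * g t = d t" using cmod_inverse_resolvent_le(4)[OF z', of t]
        by (simp add: g_def h_def flip: diff_divide_distrib left_diff_distrib)
    qed
    have "l2_inner \<mu> u (\<lambda>t. h t - cnj z * g t) = l2_inner \<mu> f g"
      using R gh unfolding resolvent_at_def by blast
    then have "l2_inner \<mu> u d = l2_inner \<mu> v d"
      using inner_v[OF gh] by (simp only: hd)
    then have "l2_inner \<mu> d d = 0"
      using L2_mult_integrable[OF u d] L2_mult_integrable[OF v d]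
      by (simp add: l2_inner_def d_def left_diff_distrib)
    moreover have "l2_inner \<mu> d d = of_real (\<integral>t. (cmod (d t))\<^sup>2 \<partial>\<mu>)"
      unfolding l2_inner_def by (simp only: complex_norm_square[symmetric] integral_complex_of_real)
    ultimately have "(\<integral>t. (cmod (d t))\<^sup>2 \<partial>\<mu>) = 0" by simp
    then have "AE t in \<mu>. (cmod (d t))\<^sup>2 = 0"
      using d by (subst (asm) integral_nonneg_eq_0_iff_AE) (auto simp: L2_def)
    then have "AE t in \<mu>. u t = f t / (of_real t - z)"
      by eventually_elim (simp add: d_def v_def)
    then show "u \<in> L2 \<mu> \<and> (AE t in \<mu>. u t = f t / (of_real t - z))" using u by simp
  next
    assume "u \<in> L2 \<mu> \<and> (AE t in \<mu>. u t = f t / (of_real t - z))"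
    then have uv: "AE t in \<mu>. u t = v t" by (simp add: v_def)
    have "l2_inner \<mu> u k = l2_inner \<mu> v k" if "k \<in> borel_measurable \<mu>" for k
    proof -
      have "AE t in \<mu>. u t * cnj (k t) = v t * cnj (k t)" using uv by eventually_elim simp
      then show ?thesis unfolding l2_inner_def
        by (rule integral_cong_AE[rotated 2])
          (intro borel_measurable_times borel_measurable_cnj' mu mv that)+
    qed
    then show "resolvent_at \<mu> (mult_op \<mu>) z f u"
      using u inner_v unfolding resolvent_at_def by (auto simp: mult_op_def L2_def)
  qed
qed (simp add: resolvent_at_def)

lemma spectral_measure_mult_op:
  assumes \<mu>: "sets \<mu> = sets borel" "integrable \<mu> (\<lambda>t. 1 / (1 + \<bar>t\<bar>))"
  shows "is_spectral_measure \<mu> (mult_op \<mu>) (\<lambda>t. 1) \<mu>"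
  unfolding is_spectral_measure_def
proof (intro conjI allI impI \<mu>(1))
  fix z :: complex assume z: "z \<notin> \<real>"
  let ?u = "\<lambda>t. 1 / (complex_of_real t - z)"
  have "(\<lambda>t. 1 / (complex_of_real t - z)) \<in> borel_measurable borel"
    using cmod_inverse_resolvent_le(4)[OF z]
    by (intro borel_measurable_continuous_onI continuous_intros) auto
  then have m: "?u \<in> borel_measurable \<mu>"
    using \<mu>(1) by (metis measurable_cong_sets)
  show "integrable \<mu> ?u"
  proof (rule Bochner_Integration.integrable_bound[OF _ m])
    show "integrable \<mu> (\<lambda>t. (1 + (1 + cmod z) / \<bar>Im z\<bar>) * (1 / (1 + \<bar>t\<bar>)))"
      using \<mu>(2) by (rule integrable_mult_right)
    show "AE t in \<mu>. norm (?u t) \<le> norm ((1 + (1 + cmod z) / \<bar>Im z\<bar>) * (1 / (1 + \<bar>t\<bar>)))"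
      using order_trans[OF cmod_inverse_resolvent_le(5)[OF z] abs_ge_self] by (intro AE_I2) simp
  qed
  have "integrable \<mu> (\<lambda>t. (cmod (?u t))\<^sup>2)"
  proof (rule Bochner_Integration.integrable_bound)
    show "integrable \<mu> (\<lambda>t. (1 + (1 + cmod z) / \<bar>Im z\<bar>) / \<bar>Im z\<bar> * (1 / (1 + \<bar>t\<bar>)))"
      using \<mu>(2) by (rule integrable_mult_right)
    show "(\<lambda>t. (cmod (?u t))\<^sup>2) \<in> borel_measurable \<mu>" using m by simp
    show "AE t in \<mu>. norm ((cmod (?u t))\<^sup>2)
            \<le> norm ((1 + (1 + cmod z) / \<bar>Im z\<bar>) / \<bar>Im z\<bar> * (1 / (1 + \<bar>t\<bar>)))"
      using order_trans[OF cmod_inverse_resolvent_le(3)[OF z] abs_ge_self] by (intro AE_I2) simp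
  qed
  then have "?u \<in> L2 \<mu>" using m by (simp add: L2_def)
  then have "resolvent_at \<mu> (mult_op \<mu>) z (\<lambda>t. 1) ?u"
    using resolvent_at_mult_op[OF \<mu> z, of "\<lambda>t. 1" ?u] by simp
  then show "\<exists>u. resolvent_at \<mu> (mult_op \<mu>) z (\<lambda>t. 1) u \<and>
               (\<integral>s. ?u s \<partial>\<mu>) = l2_inner \<mu> u (\<lambda>t. 1)"
    by (intro exI[of _ ?u]) (simp add: l2_inner_def)
qed

end

theory Submission
  imports Defs "HOL-Complex_Analysis.Cauchy_Integral_Theorem"
begin

text \<open>
  Suppose that the spectral measure \<open>\<nu>\<close> of \<open>A\<^sub>\<alpha>\<close> has a singular part on \<open>I = [a, b]\<close>.  Then there is a
  compact Lebesgue null set \<open>K \<subseteq> I\<close> with \<open>M = \<nu>(K) > 0\<close>, and \<open>K\<close> may be taken inside one half of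
  \<open>I\<close>.  Let \<open>p\<close> be the Borel transform of the restriction of \<open>\<nu>\<close> to \<open>K\<close>.  At a point \<open>x\<close> off \<open>K\<close> it has
  the real boundary value \<open>G(x) = \<integral>\<^sub>K d\<nu>(s) / (s - x)\<close>.  The theorem follows from two bounds
  on \<open>G\<close> that cannot both hold.

  Upper bound.  Let \<open>q\<close> be the Borel transform of the rest of \<open>\<nu>\<close> and \<open>F\<close> that of \<open>\<mu>\<close>.  The resolvent
  formula says \<open>(p + q)(1 + \<alpha> F) = F\<close>.  The function \<open>Q = p + \<alpha> p\<^sup>2 (1 + \<alpha> F)\<close>, which is
  \<open>((A - z)\<^sup>-\<^sup>1 f, f)\<close> for the element \<open>f\<close> of \<open>L\<^sup>2(\<mu>)\<close> that corresponds to the indicator of \<open>K\<close> in the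
  spectral representation of \<open>A\<^sub>\<alpha>\<close>, maps the upper half-plane to its closure and is asymptotic to
  \<open>-M/z\<close>, as is \<open>p\<close>.  By Cauchy's theorem the imaginary parts of both have integral \<open>\<pi> M\<close> over every
  horizontal line.  An elementary computation gives \<open>\<alpha>\<^sup>2 |p|\<^sup>2 Im F \<le> 2 Im Q + 2 Im p\<close>
  (\<open>partial_perturbation_estimate\<close>), so that \<open>\<integral> |p|\<^sup>2 Im F \<le> 4 \<pi> M / \<alpha>\<^sup>2\<close> over every horizontal line
  (\<open>two_weight_estimate\<close>).  Since \<open>Im F(x + i e) dx / \<pi>\<close> is the Poisson extension of \<open>\<mu>\<close>, letting \<open>e\<close>
  tend to \<open>0\<close> yields \<open>\<integral> G\<^sup>2 d\<mu> < \<infinity>\<close> off \<open>K\<close> (\<open>G_square_integrable\<close>), and therefore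
  \<open>\<integral> G\<^sup>2 w dx < \<infinity>\<close>.

  Lower bound.  Cauchy's theorem for \<open>p / (p + i y)\<close> gives, in the limit at the real line,
  \<open>\<integral> G\<^sup>2 / (G\<^sup>2 + y\<^sup>2) dx = \<pi> M / y\<close>, a smooth form of Boole's identity \<open>|{|G| > y}| = 2 M / y\<close>
  (\<open>Boole_identity\<close>).  This is where \<open>K\<close> has to be a null set.  The complement of \<open>I\<close> contributes little
  more than half of this value, so for a set \<open>E\<close> of small measure and \<open>y\<close> comparable to \<open>M / |E|\<close>
  a fixed part is left on \<open>I - E\<close>: the integral of \<open>G\<^sup>2\<close> over \<open>I - E\<close> is at least
  \<open>c / |E|\<close> (\<open>G_square_lower_bound\<close>).  With \<open>E = {w < v}\<close> and the layer cake formula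
  \<open>\<integral> G\<^sup>2 w \<ge> c \<integral>\<^sub>0 dv / D\<^sub>w(v) = \<infinity>\<close>.

  The equivalence of the two divergence conditions is another layer cake computation:
  \<open>w*(x)\<close> is the measure of \<open>{y > 0. D\<^sub>w(y) \<le> x}\<close>, hence
  \<open>\<integral>\<^sub>0 w*(x) / x\<^sup>2 dx\<close> up to \<open>\<epsilon>\<close> is the integral of the positive part of \<open>1 / D\<^sub>w(y) - 1 / \<epsilon>\<close>.
\<close>

section \<open>Line integrals of holomorphic functions on the upper half-plane\<close>

text \<open>
  The point at infinity is approached only above the line of integration, where the kernels
  \<open>1 / (t - z)\<close> are bounded.
\<close>

abbreviation upper_at_infinity :: "real \<Rightarrow> complex filter" where
  "upper_at_infinity e \<equiv> inf at_infinity (principal {z. e \<le> Im z})"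

text \<open>
  Closing the segment by a large semicircle costs \<open>i \<pi> c\<close> in the limit, and the closed contour
  contributes nothing.  Every line integral below is computed in this way.
\<close>

lemma line_integral_residue_at_infinity:
  fixes f :: "complex \<Rightarrow> complex"
  assumes hol: "f holomorphic_on {z. 0 < Im z}" and e: "0 < e"
    and lim: "((\<lambda>z. z * f z) \<longlongrightarrow> c) (upper_at_infinity e)"
  shows "((\<lambda>R. integral {-R..R} (\<lambda>x. f (of_real x + \<i> * of_real e))) \<longlongrightarrow> - (\<i> * of_real pi * c)) at_top"
proof -
  define g where "g = (\<lambda>z. f (z + \<i> * of_real e))"
  have holg: "g holomorphic_on {z. - e < Im z}"
    unfolding g_def
    by (rule holomorphic_on_compose_gen[of "\<lambda>z. z + \<i> * of_real e" _ f "{z. 0 < Im z}", unfolded o_def])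
       (auto intro!: holomorphic_intros hol)
  have conv: "convex {z. - e < Im z}"
    by (rule convex_halfspace_Im_gt)
  have inv0: "((\<lambda>z::complex. inverse z) \<longlongrightarrow> 0) (upper_at_infinity e)"
    by (rule tendsto_mono[OF inf_le1 tendsto_inverse_0])
  have nz: "\<forall>\<^sub>F z in upper_at_infinity e. z \<noteq> (0::complex)"
    by (rule filter_leD[OF inf_le1 eventually_not_equal_at_infinity])
  have lim': "((\<lambda>z. z * f z - \<i> * of_real e * ((z * f z) * inverse z)) \<longlongrightarrow> c - \<i> * of_real e * (c * 0)) (upper_at_infinity e)"
    by (intro tendsto_intros lim inv0)
  have lim2: "((\<lambda>z. (z - \<i> * of_real e) * f z) \<longlongrightarrow> c) (upper_at_infinity e)"
    by (rule Lim_transform_eventually[OF lim'[simplified]])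
       (use nz in \<open>eventually_elim, simp add: field_simps\<close>)
  show ?thesis
  proof (rule tendstoI)
    fix d :: real assume d: "0 < d"
    \<comment> \<open>The semicircle has angular length \<open>\<pi>\<close>, so an error \<open>d'\<close> of the integrand gives \<open>d / 2\<close>.\<close>
    define d' where "d' = d / (2 * pi)"
    have d': "0 < d'" using d by (simp add: d'_def)
    have "\<forall>\<^sub>F z in upper_at_infinity e. dist ((z - \<i> * of_real e) * f z) c < d'"
      using lim2 d' by (rule tendstoD)
    then obtain B where B: "\<And>z. B \<le> cmod z \<Longrightarrow> e \<le> Im z \<Longrightarrow> dist ((z - \<i> * of_real e) * f z) c < d'"
      unfolding eventually_inf_principal eventually_at_infinity by auto
    have key: "dist (integral {-R..R} (\<lambda>x. f (of_real x + \<i> * of_real e))) (- (\<i> * of_real pi * c)) < d"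
      if R: "R > \<bar>B\<bar> + e" for R
    proof -
      have R0: "R > 0" using R e by linarith
      define A where "A = part_circlepath 0 R 0 pi"
      define L where "L = linepath (- of_real R) (complex_of_real R)"
      have im: "Im (of_real R * cis t) \<ge> 0" if "t \<in> {0..pi}" for t
        using that R0 by (auto intro!: mult_nonneg_nonneg sin_ge_zero)
      have pA: "path_image A \<subseteq> {z. - e < Im z}"
      proof
        fix z assume "z \<in> path_image A"
        then obtain t where "t \<in> {0..pi}" "z = of_real R * cis t"
          by (auto simp: A_def path_image_part_circlepath' closed_segment_eq_real_ivl)
        then show "z \<in> {z. - e < Im z}" using im[of t] e by auto
      qed
      have pL: "path_image L \<subseteq> {z. - e < Im z}"
        unfolding L_def path_image_linepath
        by (rule closed_segment_subset[OF _ _ conv]) (use e in auto)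
      have "(g has_contour_integral 0) (L +++ A)"
        by (rule Cauchy_theorem_convex_simple[OF holg conv])
           (use pA pL in \<open>auto simp: L_def A_def path_image_join exp_pi_i' mult.commute[of \<i>] \<close>)
      moreover have iL: "g contour_integrable_on L"
        unfolding L_def
        by (rule contour_integrable_continuous_linepath)
           (use holomorphic_on_imp_continuous_on[OF holg] pL continuous_on_subset in \<open>auto simp: L_def\<close>)
      moreover have iA: "g contour_integrable_on A"
        unfolding A_def
        by (rule contour_integrable_holomorphic_simple[OF holg open_halfspace_Im_gt])
           (use pA in \<open>auto simp: A_def\<close>)
      ultimately have sum0: "contour_integral L g + contour_integral A g = 0"
        by (metis contour_integral_join contour_integral_unique L_def A_def valid_path_linepath
            valid_path_part_circlepath pathfinish_linepath pathstart_part_circlepath has_contour_integral_join has_contour_integral_integral has_contour_integral_unique)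
      have Lint: "contour_integral L g = integral {-R..R} (\<lambda>x. f (of_real x + \<i> * of_real e))"
        using contour_integral_linepath_Reals_eq[of "- of_real R" "of_real R" g] R0
        by (simp add: L_def g_def)
      define h where "h = (\<lambda>t. g (of_real R * cis t) * of_real R * \<i> * cis t)"
      have hint: "(h has_integral contour_integral A g) {0..pi}"
        using has_contour_integral_integral[OF iA] unfolding A_def
        by (subst (asm) has_contour_integral_part_circlepath_iff) (auto simp: h_def)
      have cint: "((\<lambda>t. \<i> * c) has_integral (of_real pi * (\<i> * c))) {0..pi}"
        using has_integral_const_real[of "\<i> * c" 0 pi] by (simp add: scaleR_conv_of_real)
      have "norm (contour_integral A g - of_real pi * (\<i> * c)) \<le> d' * measure lborel (cbox 0 pi)"
      proof (rule has_integral_bound)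
        show "((\<lambda>t. h t - \<i> * c) has_integral (contour_integral A g - of_real pi * (\<i> * c))) (cbox 0 pi)"
          using has_integral_diff[OF hint cint] by simp
        fix t assume t: "t \<in> cbox 0 pi"
        define z where "z = of_real R * cis t + \<i> * of_real e"
        have "cmod z \<ge> cmod (of_real R * cis t) - cmod (\<i> * of_real e)"
          unfolding z_def by (metis norm_diff_ineq)
        then have "cmod z \<ge> B" using R R0 e by (simp add: norm_mult)
        moreover have "Im z \<ge> e" using im[of t] t by (simp add: z_def)
        ultimately have "dist ((z - \<i> * of_real e) * f z) c < d'" by (rule B)
        moreover have "h t - \<i> * c = \<i> * ((z - \<i> * of_real e) * f z - c)"
          by (simp add: h_def g_def z_def algebra_simps)
        ultimately show "norm (h t - \<i> * c) \<le> d'"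
          by (simp add: norm_mult dist_norm)
      qed (use d' in simp)
      then have "norm (contour_integral A g - of_real pi * (\<i> * c)) \<le> d / 2"
        by (simp add: d'_def)
      moreover have "contour_integral L g = - contour_integral A g"
        using sum0 by (simp add: eq_neg_iff_add_eq_0)
      ultimately have "norm (contour_integral L g + of_real pi * (\<i> * c)) \<le> d / 2"
        by (simp add: norm_minus_commute)
      then show ?thesis using d unfolding Lint[symmetric] by (simp add: dist_norm mult_ac)
    qed
    show "\<forall>\<^sub>F R in at_top. dist (integral {-R..R} (\<lambda>x. f (of_real x + \<i> * of_real e))) (- (\<i> * of_real pi * c)) < d"
      by (rule eventually_mono[OF eventually_gt_at_top[of "\<bar>B\<bar> + e"]]) (rule key)
  qed
qed

lemma holomorphic_upper_line_continuous:
  assumes "f holomorphic_on {z. 0 < Im z}" "0 < e"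
  shows "continuous_on UNIV (\<lambda>x. f (of_real x + \<i> * of_real e))"
  by (rule continuous_on_compose2[OF holomorphic_on_imp_continuous_on[OF assms(1)]])
     (use assms(2) in \<open>auto intro!: continuous_intros\<close>)

lemma nn_integral_eq_limit_of_integrals:
  fixes u :: "real \<Rightarrow> real"
  assumes u: "continuous_on UNIV u" and nonneg: "\<And>x. 0 \<le> u x"
    and lim: "((\<lambda>R. integral {-R..R} u) \<longlongrightarrow> L) at_top"
  shows "(\<integral>\<^sup>+x. ennreal (u x) \<partial>lborel) = ennreal L"
proof -
  have [measurable]: "u \<in> borel_measurable borel" using u by (rule borel_measurable_continuous_onI)
  define v where "v = (\<lambda>n x. ennreal (u x) * indicator {- real n..real n} x)"
  have v_int: "integral\<^sup>N lborel (v n) = ennreal (integral {- real n..real n} u)" for n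
  proof -
    let ?J = "{- real n..real n}"
    have "(u has_integral integral ?J u) ?J"
      by (intro integrable_integral integrable_continuous_real continuous_on_subset[OF u]) auto
    then have "((\<lambda>x. if x \<in> ?J then u x else 0) has_integral integral ?J u) UNIV"
      by (subst has_integral_restrict_UNIV)
    then have "(\<integral>\<^sup>+x. ennreal (if x \<in> ?J then u x else 0) \<partial>lborel) = integral ?J u"
      by (intro nn_integral_has_integral_lborel) (auto simp: nonneg)
    moreover have "v n = (\<lambda>x. ennreal (if x \<in> ?J then u x else 0))"
      by (simp add: v_def indicator_def fun_eq_iff)
    ultimately show ?thesis by (simp only:)
  qed
  have sup: "(SUP n. v n x) = ennreal (u x)" for x
  proof (rule antisym)
    show "(SUP n. v n x) \<le> ennreal (u x)"
      by (intro SUP_least) (simp add: v_def indicator_def)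
    obtain n where "\<bar>x\<bar> \<le> real n" using real_arch_simple by blast
    then have "v n x = ennreal (u x)" by (auto simp: v_def indicator_def)
    then show "ennreal (u x) \<le> (SUP n. v n x)" by (metis SUP_upper UNIV_I)
  qed
  have inc: "incseq v"
    unfolding v_def by (intro monoI le_funI mult_left_mono) (auto simp: indicator_def)
  have "(\<integral>\<^sup>+x. ennreal (u x) \<partial>lborel) = (\<integral>\<^sup>+x. (SUP n. v n x) \<partial>lborel)"
    by (simp add: sup)
  also have "\<dots> = (SUP n. integral\<^sup>N lborel (v n))"
    by (rule nn_integral_monotone_convergence_SUP[OF inc]) (simp add: v_def)
  finally have 1: "(\<integral>\<^sup>+x. ennreal (u x) \<partial>lborel) = (SUP n. integral\<^sup>N lborel (v n))" .
  have "incseq (\<lambda>n. integral\<^sup>N lborel (v n))"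
    using inc by (intro monoI nn_integral_mono) (auto simp: mono_def le_fun_def)
  then have "(\<lambda>n. integral\<^sup>N lborel (v n)) \<longlonglongrightarrow> (SUP n. integral\<^sup>N lborel (v n))"
    by (rule LIMSEQ_SUP)
  moreover have "(\<lambda>n. integral\<^sup>N lborel (v n)) \<longlonglongrightarrow> ennreal L"
    unfolding v_int
    by (intro tendsto_ennrealI filterlim_compose[OF lim filterlim_real_sequentially])
  ultimately show ?thesis unfolding 1 by (rule LIMSEQ_unique)
qed

text \<open>
  For \<open>f\<close> with values in the closed upper half-plane the principal value is an honest Lebesgue
  integral, by monotone convergence.
\<close>

lemma nn_integral_Im_upper_line:
  fixes f :: "complex \<Rightarrow> complex"
  assumes hol: "f holomorphic_on {z. 0 < Im z}" and e: "0 < e"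
    and lim: "((\<lambda>z. z * f z) \<longlongrightarrow> c) (upper_at_infinity e)"
    and nonneg: "\<And>z. 0 < Im z \<Longrightarrow> 0 \<le> Im (f z)"
  shows "(\<integral>\<^sup>+x. ennreal (Im (f (of_real x + \<i> * of_real e))) \<partial>lborel) = ennreal (- pi * Re c)"
proof (rule nn_integral_eq_limit_of_integrals)
  note cont = holomorphic_upper_line_continuous[OF hol e]
  show "continuous_on UNIV (\<lambda>x. Im (f (of_real x + \<i> * of_real e)))"
    by (intro continuous_intros cont)
  show "0 \<le> Im (f (of_real x + \<i> * of_real e))" for x
    using e by (intro nonneg) simp
  have "integral {-R..R} (\<lambda>x. Im (f (of_real x + \<i> * of_real e))) =
        Im (integral {-R..R} (\<lambda>x. f (of_real x + \<i> * of_real e)))" for R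
    using integral_linear[OF integrable_continuous_real[OF continuous_on_subset[OF cont subset_UNIV]] bounded_linear_Im, of "- R" R]
    by (simp add: o_def)
  moreover have "((\<lambda>R. Im (integral {-R..R} (\<lambda>x. f (of_real x + \<i> * of_real e)))) \<longlongrightarrow> Im (- (\<i> * of_real pi * c))) at_top"
    by (intro tendsto_Im line_integral_residue_at_infinity hol e lim)
  ultimately show "((\<lambda>R. integral {-R..R} (\<lambda>x. Im (f (of_real x + \<i> * of_real e)))) \<longlongrightarrow> - pi * Re c) at_top"
    by simp
qed

section \<open>Borel transforms\<close>

text \<open>
  The measures whose Borel transform converges absolutely off the real axis.
\<close>

definition transformable :: "real measure \<Rightarrow> bool" where
  "transformable \<kappa> \<longleftrightarrow> sets \<kappa> = sets borel \<and> integrable \<kappa> (\<lambda>t. 1 / (1 + \<bar>t\<bar>))"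

lemma transformable_sets: "transformable \<kappa> \<Longrightarrow> sets \<kappa> = sets borel"
  by (simp add: transformable_def)

lemma transformable_measurable:
  assumes "transformable \<kappa>" "f \<in> borel_measurable borel"
  shows "f \<in> borel_measurable \<kappa>"
  using assms measurable_cong_sets transformable_sets by blast

lemma Im_pos_imp_nonreal: "0 < Im z \<Longrightarrow> z \<notin> \<real>"
  by (auto simp: complex_is_Real_iff)

lemma resolvent_kernel_measurable: "(\<lambda>t. 1 / (complex_of_real t - z)) \<in> borel_measurable borel"
  by measurable

lemma integrable_resolvent_kernel:
  assumes \<kappa>: "transformable \<kappa>" and z: "0 < Im z"
  shows "integrable \<kappa> (\<lambda>t. 1 / (complex_of_real t - z))"
proof (rule Bochner_Integration.integrable_bound)
  let ?C = "1 + (1 + cmod z) / \<bar>Im z\<bar>"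
  show "integrable \<kappa> (\<lambda>t. ?C * (1 / (1 + \<bar>t\<bar>)))"
    using \<kappa> by (intro integrable_mult_right) (simp add: transformable_def)
  show "AE t in \<kappa>. norm (1 / (complex_of_real t - z)) \<le> norm (?C * (1 / (1 + \<bar>t\<bar>)))"
    using order_trans[OF cmod_inverse_resolvent_le(5)[OF Im_pos_imp_nonreal[OF z]] abs_ge_self]
    by (intro AE_I2) simp
qed (rule transformable_measurable[OF \<kappa> resolvent_kernel_measurable])

lemma transformable_if_integrable_resolvent_kernel:
  assumes "sets \<kappa> = sets borel" "integrable \<kappa> (\<lambda>t. 1 / (complex_of_real t - \<i>))"
  shows "transformable \<kappa>"
  unfolding transformable_def
proof (intro conjI assms(1))
  show "integrable \<kappa> (\<lambda>t. 1 / (1 + \<bar>t\<bar>))"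
  proof (rule Bochner_Integration.integrable_bound[OF assms(2)])
    have "(\<lambda>t::real. 1 / (1 + \<bar>t\<bar>)) \<in> borel_measurable borel"
      by measurable
    then show "(\<lambda>t::real. 1 / (1 + \<bar>t\<bar>)) \<in> borel_measurable \<kappa>"
      using assms(1) measurable_cong_sets by blast
    have "cmod (complex_of_real t - \<i>) \<le> 1 + \<bar>t\<bar>" for t
      using norm_triangle_ineq4[of "complex_of_real t" \<i>] by simp
    moreover have "complex_of_real t - \<i> \<noteq> 0" for t
      by (simp add: complex_eq_iff)
    ultimately show "AE t in \<kappa>. norm (1 / (1 + \<bar>t\<bar>)) \<le> norm (1 / (complex_of_real t - \<i>))"
      by (intro AE_I2) (simp add: norm_divide frac_le)
  qed
qed

lemma transformable_emeasure_bounded: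
  assumes \<kappa>: "transformable \<kappa>" and S: "S \<in> sets borel" "bounded S"
  shows "emeasure \<kappa> S < \<infinity>"
proof -
  obtain B where B: "\<And>x. x \<in> S \<Longrightarrow> \<bar>x\<bar> \<le> B" and B0: "B > 0"
    using S(2) bounded_pos by (metis real_norm_def)
  have "integrable \<kappa> (indicator S :: real \<Rightarrow> real)"
  proof (rule Bochner_Integration.integrable_bound)
    show "integrable \<kappa> (\<lambda>t. (1 + B) * (1 / (1 + \<bar>t\<bar>)))"
      using \<kappa> by (intro integrable_mult_right) (simp add: transformable_def)
    show "(indicator S :: real \<Rightarrow> real) \<in> borel_measurable \<kappa>"
      using S by (intro transformable_measurable[OF \<kappa>]) simp
    show "AE x in \<kappa>. norm (indicator S x :: real) \<le> norm ((1 + B) * (1 / (1 + \<bar>x\<bar>)))"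
    proof (intro AE_I2)
      fix x
      show "norm (indicator S x :: real) \<le> norm ((1 + B) * (1 / (1 + \<bar>x\<bar>)))"
      proof (cases "x \<in> S")
        case True
        then have "1 \<le> (1 + B) / (1 + \<bar>x\<bar>)" using B[of x] by simp
        then show ?thesis using True by simp
      qed simp
    qed
  qed
  then show ?thesis
    using S(1) transformable_sets[OF \<kappa>] sets_eq_imp_space_eq[OF transformable_sets[OF \<kappa>]]
    by (simp add: integrable_indicator_iff)
qed

lemma transformable_sigma_finite:
  assumes \<kappa>: "transformable \<kappa>"
  shows "sigma_finite_measure \<kappa>"
proof
  let ?A = "range (\<lambda>n::nat. {- real n..real n})"
  have "\<Union> ?A = UNIV"
  proof (rule set_eqI)
    fix x :: real
    obtain n where "\<bar>x\<bar> \<le> real n" using real_arch_simple by blast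
    then have "x \<in> {- real n..real n}" by auto
    then show "x \<in> \<Union> ?A \<longleftrightarrow> x \<in> UNIV" by blast
  qed
  moreover have "\<forall>a\<in>?A. emeasure \<kappa> a \<noteq> \<infinity>"
    using transformable_emeasure_bounded[OF \<kappa>] by (auto simp: less_top[symmetric])
  ultimately show "\<exists>A. countable A \<and> A \<subseteq> sets \<kappa> \<and> \<Union> A = space \<kappa> \<and> (\<forall>a\<in>A. emeasure \<kappa> a \<noteq> \<infinity>)"
    using transformable_sets[OF \<kappa>] sets_eq_imp_space_eq[OF transformable_sets[OF \<kappa>]]
    by (intro exI[of _ ?A]) auto
qed

text \<open>
  The remainder of the difference quotient is \<open>w - z\<close> times the integral of
  \<open>1 / ((t - w) (t - z)\<^sup>2)\<close>, which stays bounded as \<open>w\<close> approaches \<open>z\<close>.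
\<close>

lemma borel_transform_holomorphic:
  assumes \<kappa>: "transformable \<kappa>"
  shows "borel_transform \<kappa> holomorphic_on {z. 0 < Im z}"
proof (rule holomorphic_onI)
  fix z assume "z \<in> {z. 0 < Im z}"
  then have z: "0 < Im z" by simp
  define k where "k = (\<lambda>w t. 1 / (complex_of_real t - w))"
  have kI: "integrable \<kappa> (k w)" if "0 < Im w" for w
    using integrable_resolvent_kernel[OF \<kappa> that] by (simp add: k_def)
  have kb: "cmod (k w t) \<le> 1 / Im w" if "0 < Im w" for w t
    using cmod_inverse_resolvent_le(1)[OF Im_pos_imp_nonreal[OF that], of t] that by (simp add: k_def)
  have km[measurable]: "k w \<in> borel_measurable \<kappa>" for w
    unfolding k_def by (rule transformable_measurable[OF \<kappa> resolvent_kernel_measurable])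
  have k2I: "integrable \<kappa> (\<lambda>t. k w t * g t)"
    if "integrable \<kappa> g" "0 < Im w" for w and g :: "real \<Rightarrow> complex"
  proof (rule Bochner_Integration.integrable_bound)
    show "integrable \<kappa> (\<lambda>t. of_real (1 / Im w) * g t)"
      using that by (intro integrable_mult_right)
    have [measurable]: "g \<in> borel_measurable \<kappa>" using that by simp
    show "(\<lambda>t. k w t * g t) \<in> borel_measurable \<kappa>" by measurable
    show "AE t in \<kappa>. norm (k w t * g t) \<le> norm (of_real (1 / Im w) * g t)"
    proof (intro AE_I2)
      fix t
      have "cmod (k w t) * cmod (g t) \<le> 1 / Im w * cmod (g t)"
        by (intro mult_right_mono kb that) auto
      then show "norm (k w t * g t) \<le> norm (of_real (1 / Im w) * g t)"
        using that(2) by (simp add: norm_mult norm_divide)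
    qed
  qed
  define D where "D = (\<integral>t. k z t * k z t \<partial>\<kappa>)"
  define C where "C = (\<integral>t. cmod (k z t) \<partial>\<kappa>)"
  have C0: "0 \<le> C" unfolding C_def by simp
  have rem: "cmod ((borel_transform \<kappa> w - borel_transform \<kappa> z) / (w - z) - D) \<le> cmod (w - z) * (2 / Im z * (1 / Im z) * C)"
    if w: "w \<in> ball z (Im z / 2)" "w \<noteq> z" for w
  proof -
    have "\<bar>Im w - Im z\<bar> < Im z / 2"
      using w abs_Im_le_cmod[of "w - z"] by (simp add: dist_norm norm_minus_commute)
    then have w2: "Im w \<ge> Im z / 2" and w0: "0 < Im w" using z by (auto simp: abs_if split: if_splits)
    have I2: "integrable \<kappa> (\<lambda>t. k z t * k z t)" by (intro k2I kI z)
    have I3: "integrable \<kappa> (\<lambda>t. k w t * (k z t * k z t))" by (intro k2I kI z w0)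
    have "k w t - k z t = (w - z) * (k z t * k z t) + (w - z)\<^sup>2 * (k w t * (k z t * k z t))" for t
    proof -
      have "complex_of_real t - w \<noteq> 0" "complex_of_real t - z \<noteq> 0"
        using w0 z by (auto simp: complex_eq_iff)
      then show ?thesis unfolding k_def by (simp add: divide_simps) (simp add: power2_eq_square algebra_simps)
    qed
    note kk = this
    have "borel_transform \<kappa> w - borel_transform \<kappa> z
        = (\<integral>t. k w t - k z t \<partial>\<kappa>)"
      using Bochner_Integration.integral_diff[OF kI[OF w0] kI[OF z]]
      by (simp add: borel_transform_def k_def)
    also have "\<dots> = (\<integral>t. (w - z) * (k z t * k z t) + (w - z)\<^sup>2 * (k w t * (k z t * k z t)) \<partial>\<kappa>)"
      unfolding kk ..
    also have "\<dots> = (w - z) * D + (w - z)\<^sup>2 * (\<integral>t. k w t * (k z t * k z t) \<partial>\<kappa>)"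
      using I2 I3 unfolding D_def by (subst Bochner_Integration.integral_add) auto
    finally have quot: "(borel_transform \<kappa> w - borel_transform \<kappa> z) / (w - z) - D = (w - z) * (\<integral>t. k w t * (k z t * k z t) \<partial>\<kappa>)"
      using w(2) by (simp add: field_simps power2_eq_square)
    have bound: "cmod (\<integral>t. k w t * (k z t * k z t) \<partial>\<kappa>) \<le> 2 / Im z * (1 / Im z) * C"
    proof -
      have "cmod (\<integral>t. k w t * (k z t * k z t) \<partial>\<kappa>) \<le> (\<integral>t. 2 / Im z * (1 / Im z) * cmod (k z t) \<partial>\<kappa>)"
      proof (rule Bochner_Integration.integral_norm_bound_integral[OF I3])
        show "integrable \<kappa> (\<lambda>t. 2 / Im z * (1 / Im z) * cmod (k z t))"
          using kI[OF z] by (intro integrable_mult_right integrable_norm)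
        fix t
        have "1 / Im w \<le> 1 / (Im z / 2)" using w2 z by (intro frac_le) auto
        then have "cmod (k w t) \<le> 2 / Im z"
          using kb[OF w0, of t] by simp
        then have "cmod (k w t) * (cmod (k z t) * cmod (k z t)) \<le> 2 / Im z * (1 / Im z * cmod (k z t))"
          using kb[OF z, of t] z by (intro mult_mono mult_right_mono) auto
        then show "cmod (k w t * (k z t * k z t)) \<le> 2 / Im z * (1 / Im z) * cmod (k z t)"
          by (simp add: norm_mult)
      qed
      then show ?thesis by (simp add: C_def)
    qed
    show ?thesis unfolding quot norm_mult by (rule mult_left_mono[OF bound norm_ge_zero])
  qed
  have "((\<lambda>w. (borel_transform \<kappa> w - borel_transform \<kappa> z) / (w - z) - D) \<longlongrightarrow> 0) (at z)"
  proof (rule Lim_null_comparison)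
    show "\<forall>\<^sub>F w in at z. norm ((borel_transform \<kappa> w - borel_transform \<kappa> z) / (w - z) - D)
            \<le> cmod (w - z) * (2 / Im z * (1 / Im z) * C)"
      unfolding eventually_at_topological
      by (rule exI[of _ "ball z (Im z / 2)"]) (use z rem in auto)
    have "((\<lambda>w. cmod (w - z) * (2 / Im z * (1 / Im z) * C)) \<longlongrightarrow> cmod (z - z) * (2 / Im z * (1 / Im z) * C)) (at z)"
      by (intro tendsto_intros)
    then show "((\<lambda>w. cmod (w - z) * (2 / Im z * (1 / Im z) * C)) \<longlongrightarrow> 0) (at z)" by simp
  qed
  then have "(borel_transform \<kappa> has_field_derivative D) (at z)"
    unfolding has_field_derivative_iff using Lim_null by blast
  then show "borel_transform \<kappa> field_differentiable at z within {z. 0 < Im z}"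
    using field_differentiable_at_within field_differentiable_def by blast
qed

lemma Im_resolvent_kernel: "Im (1 / (complex_of_real t - z)) = Im z / (cmod (complex_of_real t - z))\<^sup>2"
  by (simp add: Im_divide cmod_power2)

lemma Im_borel_transform:
  assumes "transformable \<kappa>" "0 < Im z"
  shows "Im (borel_transform \<kappa> z) = (\<integral>t. Im z / (cmod (complex_of_real t - z))\<^sup>2 \<partial>\<kappa>)"
    and "integrable \<kappa> (\<lambda>t. Im z / (cmod (complex_of_real t - z))\<^sup>2)"
proof -
  note I = integrable_resolvent_kernel[OF assms]
  show "Im (borel_transform \<kappa> z) = (\<integral>t. Im z / (cmod (complex_of_real t - z))\<^sup>2 \<partial>\<kappa>)"
    unfolding borel_transform_def by (subst integral_Im[OF I, symmetric]) (simp only: Im_resolvent_kernel)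
  show "integrable \<kappa> (\<lambda>t. Im z / (cmod (complex_of_real t - z))\<^sup>2)"
    using integrable_Im[OF I] by (simp only: Im_resolvent_kernel)
qed

lemma Im_borel_transform_nonneg:
  assumes "transformable \<kappa>" "0 < Im z"
  shows "0 \<le> Im (borel_transform \<kappa> z)"
  unfolding Im_borel_transform(1)[OF assms] using assms(2) by (intro integral_nonneg_AE) auto

text \<open>
  A zero would make \<open>F(z)\<close> real, and the imaginary part of \<open>F(z)\<close> is the integral of a strictly
  positive function.  So \<open>\<kappa>\<close> would be the zero measure, for which \<open>F = 0\<close>.
\<close>

lemma one_plus_borel_transform_nonzero:
  assumes \<kappa>: "transformable \<kappa>" and z: "0 < Im z"
  shows "1 + of_real \<alpha> * borel_transform \<kappa> z \<noteq> 0"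
proof
  assume eq: "1 + of_real \<alpha> * borel_transform \<kappa> z = 0"
  then have "\<alpha> \<noteq> 0" "\<alpha> * Im (borel_transform \<kappa> z) = 0"
    by (auto simp: complex_eq_iff)
  then have "(\<integral>t. Im z / (cmod (complex_of_real t - z))\<^sup>2 \<partial>\<kappa>) = 0"
    using Im_borel_transform(1)[OF \<kappa> z] by simp
  then have "AE t in \<kappa>. Im z / (cmod (complex_of_real t - z))\<^sup>2 = 0"
    using Im_borel_transform(2)[OF \<kappa> z] z by (subst (asm) integral_nonneg_eq_0_iff_AE) auto
  moreover have "Im z / (cmod (complex_of_real t - z))\<^sup>2 \<noteq> 0" for t
    using z by (auto simp: complex_eq_iff)
  ultimately have "AE t in \<kappa>. False" by simp
  then have "borel_transform \<kappa> z = 0"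
    unfolding borel_transform_def by (intro integral_eq_zero_AE) auto
  then show False using eq by simp
qed

text \<open>
  This is dominated convergence: \<open>1 / (|t - z| |z|)\<close> tends to \<open>0\<close> for fixed \<open>t\<close> and is
  dominated by a multiple of \<open>1 / (1 + |t|)\<close>.  For infinite measures \<open>F\<close> itself need not tend to \<open>0\<close>,
  even need not be bounded, on a horizontal line.
\<close>

lemma borel_transform_over_z_tendsto_0:
  assumes \<kappa>: "transformable \<kappa>" and e: "0 < e"
  shows "((\<lambda>z. borel_transform \<kappa> z / z) \<longlongrightarrow> 0) (upper_at_infinity e)"
proof (rule tendstoI)
  fix d :: real assume d: "0 < d"
  define g where "g = (\<lambda>t::real. 1 / (1 + \<bar>t\<bar>))"
  have gI: "integrable \<kappa> g" using \<kappa> by (simp add: transformable_def g_def)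
  have gm[measurable]: "g \<in> borel_measurable borel" unfolding g_def by measurable
  have g0: "g t > 0" for t by (simp add: g_def add_pos_nonneg)
  define C where "C = 3 + 3 / e"
  have C: "C > 0" using e by (simp add: C_def add_pos_pos)
  have kC: "cmod (1 / (complex_of_real t - z) / z) \<le> C * g t" if "1 \<le> cmod z" "e \<le> Im z" for t z
  proof -
    have l1: "\<bar>t\<bar> - cmod z \<le> cmod (complex_of_real t - z)"
      using norm_triangle_ineq2[of "complex_of_real t" z] by simp
    have l2: "e \<le> cmod (complex_of_real t - z)"
      using abs_Im_le_cmod[of "complex_of_real t - z"] that by simp
    have "1 + \<bar>t\<bar> \<le> C * (cmod (complex_of_real t - z) * cmod z)"
    proof (cases "\<bar>t\<bar> \<le> 2 * cmod z")
      case True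
      have "1 + \<bar>t\<bar> \<le> 3 * cmod z" using True that by simp
      also have "\<dots> = 3 / e * (e * cmod z)" using e by simp
      also have "\<dots> \<le> C * (cmod (complex_of_real t - z) * cmod z)"
        using l2 e that by (intro mult_mono) (auto simp: C_def)
      finally show ?thesis .
    next
      case False
      then have "1 + \<bar>t\<bar> \<le> 3 * cmod (complex_of_real t - z) * 1" using l1 that by linarith
      also have "\<dots> \<le> 3 * cmod (complex_of_real t - z) * cmod z" using that by (intro mult_left_mono) auto
      also have "\<dots> \<le> C * (cmod (complex_of_real t - z) * cmod z)"
        using e by (simp add: C_def algebra_simps)
      finally show ?thesis .
    qed
    moreover have "0 < cmod (complex_of_real t - z) * cmod z"
      using l2 e that(1) by (intro mult_pos_pos) linarith+
    moreover have "0 < 1 + \<bar>t\<bar>" by simp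
    moreover have "1 / X \<le> C / T" if "T \<le> C * X" "0 < X" "0 < T" for X T :: real
      using that by (simp add: field_simps)
    ultimately have "1 / (cmod (complex_of_real t - z) * cmod z) \<le> C / (1 + \<bar>t\<bar>)" by blast
    then show ?thesis by (simp add: g_def norm_divide norm_mult)
  qed
  \<comment> \<open>Outside a large interval the uniform bound \<open>kC\<close> suffices; inside, the kernel is of order \<open>1 / |z|\<close>.\<close>
  have "(\<lambda>n. \<integral>t. indicator (- {- real n..real n}) t * g t \<partial>\<kappa>) \<longlonglongrightarrow> (\<integral>t. 0 \<partial>\<kappa>)"
  proof (rule integral_dominated_convergence[where w = g])
    show "(\<lambda>t. indicator (- {- real n..real n}) t * g t) \<in> borel_measurable \<kappa>" for n
      by (rule transformable_measurable[OF \<kappa>]) measurable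
    show "AE t in \<kappa>. (\<lambda>n. indicator (- {- real n..real n}) t * g t) \<longlonglongrightarrow> 0"
    proof (intro AE_I2)
      fix t
      have "\<forall>\<^sub>F n in sequentially. \<bar>t\<bar> \<le> real n"
        using eventually_ge_at_top[of "nat \<lceil>\<bar>t\<bar>\<rceil>"] by eventually_elim linarith
      then have "\<forall>\<^sub>F n in sequentially. indicator (- {- real n..real n}) t * g t = 0"
        by eventually_elim (auto simp: indicator_def)
      then show "(\<lambda>n. indicator (- {- real n..real n}) t * g t) \<longlonglongrightarrow> 0"
        by (rule tendsto_eventually)
    qed
    show "AE t in \<kappa>. norm (indicator (- {- real n..real n}) t * g t) \<le> g t" for n
      using g0 by (intro AE_I2) (auto simp: indicator_def less_imp_le)
  qed (auto simp: gI)
  then have "\<forall>\<^sub>F n in sequentially. (\<integral>t. indicator (- {- real n..real n}) t * g t \<partial>\<kappa>) < d / (2 * C)"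
    using d C by (intro order_tendstoD) auto
  then obtain n where n: "(\<integral>t. indicator (- {- real n..real n}) t * g t \<partial>\<kappa>) < d / (2 * C)"
    using eventually_happens' sequentially_bot by blast
  define N where "N = real n"
  define G where "G = (\<integral>t. g t \<partial>\<kappa>)"
  have G0: "0 \<le> G" unfolding G_def using g0 by (intro integral_nonneg_AE) (auto simp: less_imp_le)
  define R where "R = 1 + N + (1 + N) * G * (2 / d) + (1 + N)"
  have main: "dist (borel_transform \<kappa> z / z) 0 < d" if z: "R \<le> cmod z" "e \<le> Im z" for z
  proof -
    have N0: "0 \<le> N" by (simp add: N_def)
    have "0 \<le> (1 + N) * G * (2 / d)" using N0 G0 d by simp
    then have z1: "1 + N \<le> cmod z - N" "1 \<le> cmod z" using z N0 by (auto simp: R_def)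
    have zG: "(1 + N) * G * (2 / d) < cmod z" using z N0 by (simp add: R_def)
    have z0: "0 < Im z" using z e by simp
    have kI: "integrable \<kappa> (\<lambda>t. 1 / (complex_of_real t - z) / z)"
      using integrable_resolvent_kernel[OF \<kappa> z0] by (intro integrable_divide) auto
    have iI: "integrable \<kappa> (\<lambda>t. indicator (- {- N..N}) t * g t)"
    proof (rule Bochner_Integration.integrable_bound[OF gI])
      show "(\<lambda>t. indicator (- {- N..N}) t * g t) \<in> borel_measurable \<kappa>"
        by (rule transformable_measurable[OF \<kappa>]) measurable
      show "AE t in \<kappa>. norm (indicator (- {- N..N}) t * g t) \<le> norm (g t)"
        by (intro AE_I2) (simp add: indicator_def)
    qed
    have bd: "cmod (1 / (complex_of_real t - z) / z) \<le> (1 + N) / cmod z * g t + C * (indicator (- {- N..N}) t * g t)" for t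
    proof (cases "t \<in> {- N..N}")
      case True
      have "1 \<le> cmod z - \<bar>t\<bar>" using z1 True by auto
      also have "\<dots> \<le> cmod (complex_of_real t - z)"
        using norm_triangle_ineq2[of z "complex_of_real t"] by (simp add: norm_minus_commute)
      finally have c1: "1 \<le> cmod (complex_of_real t - z)" .
      have "cmod (1 / (complex_of_real t - z) / z) \<le> 1 / cmod z"
        unfolding norm_divide norm_one using c1 by (intro divide_right_mono) (simp_all add: divide_le_eq)
      also have "\<dots> \<le> 1 / cmod z * ((1 + N) * g t)"
      proof -
        have "1 \<le> (1 + N) / (1 + \<bar>t\<bar>)" using True by (subst pos_le_divide_eq) auto
        then have "1 \<le> (1 + N) * g t" by (simp add: g_def)
        then have "1 / cmod z * 1 \<le> 1 / cmod z * ((1 + N) * g t)"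
          by (intro mult_left_mono) auto
        then show ?thesis by simp
      qed
      finally show ?thesis using True by simp
    next
      case False
      then have "cmod (1 / (complex_of_real t - z) / z) \<le> C * (indicator (- {- N..N}) t * g t)"
        using kC[OF z1(2) z(2), of t] by (auto simp: indicator_def)
      moreover have "0 \<le> (1 + N) / cmod z * g t" using N0 g0[of t] by simp
      ultimately show ?thesis by linarith
    qed
    have "cmod (borel_transform \<kappa> z / z) = cmod (\<integral>t. 1 / (complex_of_real t - z) / z \<partial>\<kappa>)"
      by (simp only: borel_transform_def Bochner_Integration.integral_divide_zero)
    also have "\<dots> \<le> (\<integral>t. (1 + N) / cmod z * g t + C * (indicator (- {- N..N}) t * g t) \<partial>\<kappa>)"
      by (rule Bochner_Integration.integral_norm_bound_integral[OF kI])
         (intro Bochner_Integration.integrable_add integrable_mult_right gI iI bd)+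
    also have "\<dots> = (1 + N) / cmod z * G + C * (\<integral>t. indicator (- {- N..N}) t * g t \<partial>\<kappa>)"
      unfolding G_def using gI iI by (subst Bochner_Integration.integral_add) auto
    also have "(1 + N) / cmod z * G \<le> d / 2"
    proof -
      have "(1 + N) * G < d / 2 * cmod z"
      proof -
        have "(1 + N) * G = d / 2 * ((1 + N) * G * (2 / d))" using d by simp
        also have "\<dots> < d / 2 * cmod z" using zG d by (intro mult_strict_left_mono) auto
        finally show ?thesis .
      qed
      then have "(1 + N) * G / cmod z \<le> d / 2"
        by (subst pos_divide_le_eq) (use z1 in auto)
      then show ?thesis by simp
    qed
    also have "C * (\<integral>t. indicator (- {- N..N}) t * g t \<partial>\<kappa>) < d / 2"
      using mult_strict_left_mono[OF n C] C unfolding N_def by simp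
    finally show ?thesis by simp
  qed
  show "\<forall>\<^sub>F z in upper_at_infinity e. dist (borel_transform \<kappa> z / z) 0 < d"
    unfolding eventually_inf_principal eventually_at_infinity
    by (rule exI[of _ R]) (use main in auto)
qed

section \<open>Borel transforms of measures carried by a compact set\<close>

locale compactly_carried_measure =
  fixes \<kappa> :: "real measure" and K :: "real set"
  assumes sets_\<kappa>: "sets \<kappa> = sets borel"
    and compact_K: "compact K"
    and carried: "AE s in \<kappa>. s \<in> K"
    and finite_K: "emeasure \<kappa> UNIV < \<infinity>"
begin

definition M :: real where "M = measure \<kappa> UNIV"

text \<open>
  Off \<open>K\<close> this is the Hilbert transform of \<open>\<kappa>\<close>, up to a constant factor.  Only these
  values matter; on \<open>K\<close> the integral need not exist and may have its default value.
\<close>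

definition G :: "real \<Rightarrow> real" where "G x = (\<integral>s. 1 / (s - x) \<partial>\<kappa>)"

lemma M_nonneg: "0 \<le> M" by (simp add: M_def)

lemma K_borel: "K \<in> sets borel"
  using compact_K by (simp add: borel_compact)

lemma finite_measure_\<kappa>: "finite_measure \<kappa>"
  using finite_K sets_eq_imp_space_eq[OF sets_\<kappa>] by (intro finite_measureI) simp

lemma measurable_\<kappa>: "f \<in> borel_measurable borel \<Longrightarrow> f \<in> borel_measurable \<kappa>"
  using sets_\<kappa> measurable_cong_sets by blast

text \<open>
  All estimates of the transform of \<open>\<kappa>\<close> reduce to bounds of the kernel on \<open>K\<close>.
\<close>

lemma integrable_bounded_on_K:
  fixes f :: "real \<Rightarrow> 'a::{banach,second_countable_topology}"
  assumes "f \<in> borel_measurable borel" "\<And>s. s \<in> K \<Longrightarrow> norm (f s) \<le> B"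
  shows "integrable \<kappa> f" and "norm (\<integral>s. f s \<partial>\<kappa>) \<le> B * M"
proof -
  interpret finite_measure \<kappa> by (rule finite_measure_\<kappa>)
  have ae: "AE s in \<kappa>. norm (f s) \<le> B"
    using carried by eventually_elim (rule assms)
  show "integrable \<kappa> f"
    by (rule integrable_const_bound[OF ae measurable_\<kappa>[OF assms(1)]])
  then have "norm (\<integral>s. f s \<partial>\<kappa>) \<le> (\<integral>s. norm (f s) \<partial>\<kappa>)" by simp
  also have "\<dots> \<le> (\<integral>s. B \<partial>\<kappa>)"
    using ae \<open>integrable \<kappa> f\<close> by (intro integral_mono_AE) auto
  also have "\<dots> = B * M"
    using sets_eq_imp_space_eq[OF sets_\<kappa>] by (simp add: M_def mult.commute)
  finally show "norm (\<integral>s. f s \<partial>\<kappa>) \<le> B * M" .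
qed

lemma transformable_\<kappa>: "transformable \<kappa>"
  unfolding transformable_def
proof (intro conjI sets_\<kappa>)
  show "integrable \<kappa> (\<lambda>t. 1 / (1 + \<bar>t\<bar>))"
  proof (rule integrable_bounded_on_K(1))
    show "(\<lambda>t::real. 1 / (1 + \<bar>t\<bar>)) \<in> borel_measurable borel" by measurable
    show "norm (1 / (1 + \<bar>s\<bar>)) \<le> 1" for s :: real by simp
  qed
qed

lemma K_bounded: obtains B where "0 < B" "\<And>s. s \<in> K \<Longrightarrow> \<bar>s\<bar> \<le> B"
  using compact_imp_bounded[OF compact_K] bounded_pos by (metis real_norm_def)

text \<open>
  Because \<open>z / (s - z) + 1 = s / (s - z)\<close>, which tends to \<open>0\<close> uniformly for \<open>s\<close> in \<open>K\<close>.
\<close>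

lemma borel_transform_tendsto_moment: "((\<lambda>z. z * borel_transform \<kappa> z) \<longlongrightarrow> - of_real M) (upper_at_infinity e)"
proof -
  obtain B where B: "0 < B" "\<And>s. s \<in> K \<Longrightarrow> \<bar>s\<bar> \<le> B" using K_bounded by blast
  have bd: "norm (z * borel_transform \<kappa> z + of_real M) \<le> B / (cmod z - B) * M" if z: "cmod z > B" for z
  proof -
    have k: "cmod z - B \<le> cmod (complex_of_real s - z)" if "s \<in> K" for s
      using B(2)[OF that] norm_triangle_ineq2[of z "complex_of_real s"] by (simp add: norm_minus_commute)
    have I: "integrable \<kappa> (\<lambda>s. 1 / (complex_of_real s - z))"
    proof (rule integrable_bounded_on_K(1)[OF resolvent_kernel_measurable])
      show "s \<in> K \<Longrightarrow> norm (1 / (complex_of_real s - z)) \<le> 1 / (cmod z - B)" for s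
        unfolding norm_divide norm_one using k[of s] z by (intro frac_le) auto
    qed
    have I1: "integrable \<kappa> (\<lambda>s. 1 :: complex)"
      by (rule integrable_bounded_on_K(1)[where B = 1]) auto
    have "(\<integral>s. 1 \<partial>\<kappa>) = complex_of_real M"
      using sets_eq_imp_space_eq[OF sets_\<kappa>] by (simp add: M_def scaleR_conv_of_real)
    then have "(\<integral>s. z * (1 / (complex_of_real s - z)) + 1 \<partial>\<kappa>) = z * borel_transform \<kappa> z + of_real M"
      using Bochner_Integration.integral_add[OF integrable_mult_right[OF I, of z] I1]
      by (simp only: borel_transform_def Bochner_Integration.integral_mult_right_zero)
    moreover have "norm (\<integral>s. z * (1 / (complex_of_real s - z)) + 1 \<partial>\<kappa>) \<le> B / (cmod z - B) * M"
    proof (rule integrable_bounded_on_K(2))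
      show "(\<lambda>s. z * (1 / (complex_of_real s - z)) + 1) \<in> borel_measurable borel" by measurable
      fix s assume s: "s \<in> K"
      have "0 < cmod (complex_of_real s - z)" using k[OF s] z by linarith
      then have "complex_of_real s - z \<noteq> 0" by simp
      then have "z * (1 / (complex_of_real s - z)) + 1 = of_real s / (complex_of_real s - z)"
        by (simp add: field_simps)
      then show "norm (z * (1 / (complex_of_real s - z)) + 1) \<le> B / (cmod z - B)"
        using k[OF s] z B(1) B(2)[OF s] by (simp only: norm_divide norm_of_real) (intro frac_le, auto)
    qed
    ultimately show ?thesis by simp
  qed
  have "((\<lambda>z. z * borel_transform \<kappa> z + of_real M) \<longlongrightarrow> 0) at_infinity"
  proof (rule Lim_null_comparison)
    show "\<forall>\<^sub>F z in at_infinity. norm (z * borel_transform \<kappa> z + of_real M) \<le> B / (cmod z - B) * M"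
      unfolding eventually_at_infinity by (intro exI[of _ "B + 1"] allI impI bd) simp
    have "filterlim (\<lambda>z::complex. - B + cmod z) at_top at_infinity"
      by (rule filterlim_tendsto_add_at_top[OF tendsto_const filterlim_norm_at_top])
    then have "((\<lambda>z::complex. B / (- B + cmod z)) \<longlongrightarrow> 0) at_infinity"
      by (intro tendsto_divide_0[OF tendsto_const] filterlim_at_top_imp_at_infinity)
    then have "((\<lambda>z::complex. B / (- B + cmod z) * M) \<longlongrightarrow> 0 * M) at_infinity"
      by (intro tendsto_intros)
    then show "((\<lambda>z. B / (cmod z - B) * M) \<longlongrightarrow> 0) at_infinity" by simp
  qed
  then have "((\<lambda>z. (z * borel_transform \<kappa> z + of_real M) - of_real M) \<longlongrightarrow> 0 - of_real M) at_infinity"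
    by (intro tendsto_intros)
  then show ?thesis using tendsto_mono[OF inf_le1] by simp
qed

lemma borel_transform_tendsto_0: "(borel_transform \<kappa> \<longlongrightarrow> 0) (upper_at_infinity e)"
proof -
  have "((\<lambda>z. (z * borel_transform \<kappa> z) * inverse z) \<longlongrightarrow> - of_real M * 0) (upper_at_infinity e)"
    by (intro tendsto_intros borel_transform_tendsto_moment tendsto_mono[OF inf_le1 tendsto_inverse_0])
  moreover have "\<forall>\<^sub>F z in upper_at_infinity e. (z * borel_transform \<kappa> z) * inverse z = borel_transform \<kappa> z"
    using filter_leD[OF inf_le1 eventually_not_equal_at_infinity[of 0]] by eventually_elim simp
  ultimately show ?thesis by (simp add: tendsto_cong)
qed

lemma separated_from_K: assumes "x \<notin> K" obtains d where "0 < d" "\<And>s. s \<in> K \<Longrightarrow> d \<le> \<bar>s - x\<bar>"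
proof (cases "K = {}")
  case True
  then show ?thesis using that[of 1] by auto
next
  case False
  show ?thesis
  proof (rule that[of "infdist x K"])
    show "0 < infdist x K"
      by (rule infdist_pos_not_in_closed[OF compact_imp_closed[OF compact_K] False assms])
    show "infdist x K \<le> \<bar>s - x\<bar>" if "s \<in> K" for s
      using infdist_le[OF that, of x] by (simp add: dist_real_def abs_minus_commute)
  qed
qed

lemma G_bound:
  assumes "0 < d" "\<And>s. s \<in> K \<Longrightarrow> d \<le> \<bar>s - x\<bar>"
  shows "\<bar>G x\<bar> \<le> M / d"
proof -
  have "norm (\<integral>s. 1 / (s - x) \<partial>\<kappa>) \<le> 1 / d * M"
  proof (rule integrable_bounded_on_K(2))
    show "(\<lambda>s. 1 / (s - x)) \<in> borel_measurable borel" by measurable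
    fix s assume "s \<in> K"
    then show "norm (1 / (s - x)) \<le> 1 / d"
      unfolding norm_divide norm_one using assms(1) assms(2)[of s] by (intro frac_le) auto
  qed
  then show ?thesis by (simp add: G_def)
qed

lemma borel_transform_boundary_value:
  assumes "x \<notin> K"
  shows "(borel_transform \<kappa> \<longlongrightarrow> of_real (G x)) (at (of_real x))"
proof -
  obtain d where d: "0 < d" "\<And>s. s \<in> K \<Longrightarrow> d \<le> \<bar>s - x\<bar>" using separated_from_K[OF assms] by blast
  have bd: "norm (borel_transform \<kappa> z - of_real (G x)) \<le> cmod (z - of_real x) / (d / 2 * d) * M"
    if z: "z \<in> ball (of_real x) (d / 2)" for z
  proof -
    have kx: "d \<le> cmod (complex_of_real s - of_real x)" if "s \<in> K" for s
      using d(2)[OF that] by (metis norm_of_real of_real_diff)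
    have kz: "d / 2 \<le> cmod (complex_of_real s - z)" if "s \<in> K" for s
      using kx[OF that] z norm_triangle_ineq[of "complex_of_real s - z" "z - of_real x"]
      by (simp add: dist_norm norm_minus_commute)
    have I1: "integrable \<kappa> (\<lambda>s. 1 / (complex_of_real s - z))"
    proof (rule integrable_bounded_on_K(1)[OF resolvent_kernel_measurable])
      show "s \<in> K \<Longrightarrow> norm (1 / (complex_of_real s - z)) \<le> 1 / (d / 2)" for s
        unfolding norm_divide norm_one using kz[of s] d(1) by (intro frac_le) auto
    qed
    have I2: "integrable \<kappa> (\<lambda>s. 1 / (complex_of_real s - of_real x))"
    proof (rule integrable_bounded_on_K(1)[OF resolvent_kernel_measurable])
      show "s \<in> K \<Longrightarrow> norm (1 / (complex_of_real s - of_real x)) \<le> 1 / d" for s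
        unfolding norm_divide norm_one using kx[of s] d(1) by (intro frac_le) auto
    qed
    have Gx: "of_real (G x) = (\<integral>s. 1 / (complex_of_real s - of_real x) \<partial>\<kappa>)"
      unfolding G_def integral_complex_of_real[symmetric] by simp
    have "borel_transform \<kappa> z - of_real (G x) = (\<integral>s. 1 / (complex_of_real s - z) - 1 / (complex_of_real s - of_real x) \<partial>\<kappa>)"
      unfolding Gx borel_transform_def using I1 I2 by (rule Bochner_Integration.integral_diff[symmetric])
    also have "norm \<dots> \<le> cmod (z - of_real x) / (d / 2 * d) * M"
    proof (rule integrable_bounded_on_K(2))
      show "(\<lambda>s. 1 / (complex_of_real s - z) - 1 / (complex_of_real s - of_real x)) \<in> borel_measurable borel" by measurable
      fix s assume s: "s \<in> K"
      have "0 < cmod (complex_of_real s - z)" "0 < cmod (complex_of_real s - of_real x)"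
        using kz[OF s] kx[OF s] d(1) by linarith+
      then have nz: "complex_of_real s - z \<noteq> 0" "complex_of_real s - of_real x \<noteq> 0"
        by simp_all
      then have "1 / (complex_of_real s - z) - 1 / (complex_of_real s - of_real x) =
          (z - of_real x) / ((complex_of_real s - z) * (complex_of_real s - of_real x))"
        by (simp add: divide_simps)
      also have "cmod \<dots> \<le> cmod (z - of_real x) / (d / 2 * d)"
        unfolding norm_divide norm_mult using kz[OF s] kx[OF s] d(1)
        by (intro frac_le mult_mono mult_pos_pos) auto
      finally show "norm (1 / (complex_of_real s - z) - 1 / (complex_of_real s - of_real x)) \<le> cmod (z - of_real x) / (d / 2 * d)" .
    qed
    finally show ?thesis .
  qed
  have "((\<lambda>z. borel_transform \<kappa> z - of_real (G x)) \<longlongrightarrow> 0) (at (of_real x))"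
  proof (rule Lim_null_comparison)
    show "\<forall>\<^sub>F z in at (complex_of_real x). norm (borel_transform \<kappa> z - of_real (G x)) \<le> cmod (z - of_real x) / (d / 2 * d) * M"
      unfolding eventually_at_topological
      by (rule exI[of _ "ball (of_real x) (d / 2)"]) (use d bd in auto)
    have "((\<lambda>z. cmod (z - of_real x) / (d / 2 * d) * M) \<longlongrightarrow> cmod (of_real x - of_real x) / (d / 2 * d) * M) (at (complex_of_real x))"
      using d by (intro tendsto_intros) auto
    then show "((\<lambda>z. cmod (z - of_real x) / (d / 2 * d) * M) \<longlongrightarrow> 0) (at (complex_of_real x))" by simp
  qed
  then show ?thesis using Lim_null by blast
qed

text \<open>
  The shift by \<open>e n * u\<close> allows non-tangential approach, as needed after the substitution
  \<open>x = t + e u\<close> in a Poisson integral.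
\<close>

lemma boundary_sequence:
  assumes "x \<notin> K" and e: "\<And>n. 0 < e n" "e \<longlonglongrightarrow> 0"
  shows "(\<lambda>n. borel_transform \<kappa> (of_real (x + e n * u) + \<i> * of_real (e n))) \<longlonglongrightarrow> of_real (G x)"
proof (rule filterlim_compose[OF borel_transform_boundary_value[OF assms(1)]])
  have "(\<lambda>n. of_real (x + e n * u) + \<i> * of_real (e n)) \<longlonglongrightarrow> of_real (x + 0 * u) + \<i> * of_real 0"
    by (intro tendsto_intros e)
  then have "(\<lambda>n. of_real (x + e n * u) + \<i> * of_real (e n)) \<longlonglongrightarrow> complex_of_real x" by simp
  moreover have "of_real (x + e n * u) + \<i> * of_real (e n) \<noteq> complex_of_real x" for n
    using e(1)[of n] by (simp add: complex_eq_iff)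
  ultimately show "filterlim (\<lambda>n. of_real (x + e n * u) + \<i> * of_real (e n)) (at (complex_of_real x)) sequentially"
    by (simp add: filterlim_at)
qed

end

section \<open>A two-weight estimate for the Cauchy transform\<close>

text \<open>
  With \<open>N = 1 - \<alpha> (p + q)\<close> one has \<open>F = (p + q) / N\<close> and \<open>Q = p (1 - \<alpha> q) / N\<close>, whence
  \<open>|N|\<^sup>2 Im F = Im p + Im q\<close> and \<open>|N|\<^sup>2 Im Q = |1 - \<alpha> q|\<^sup>2 Im p + \<alpha>\<^sup>2 |p|\<^sup>2 Im q\<close>.  The part of
  \<open>\<alpha>\<^sup>2 |p|\<^sup>2 Im F\<close> with \<open>Im q\<close> is dominated by \<open>Im Q\<close> directly, the part with \<open>Im p\<close> because
  \<open>\<alpha> p = (1 - \<alpha> q) - N\<close>.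
\<close>

lemma partial_perturbation_estimate:
  fixes p q F Q :: complex and \<alpha> :: real
  assumes eq: "(p + q) * (1 + of_real \<alpha> * F) = F" and p: "0 \<le> Im p" and q: "0 \<le> Im q"
    and Q: "Q = p + of_real \<alpha> * p\<^sup>2 * (1 + of_real \<alpha> * F)"
  shows "0 \<le> Im Q" and "\<alpha>\<^sup>2 * (cmod p)\<^sup>2 * Im F \<le> 2 * Im Q + 2 * Im p"
proof -
  define N where "N = 1 - of_real \<alpha> * (p + q)"
  have "N * (1 + of_real \<alpha> * F) = (1 + of_real \<alpha> * F) - of_real \<alpha> * ((p + q) * (1 + of_real \<alpha> * F))"
    by (simp add: N_def algebra_simps)
  also have "\<dots> = 1" unfolding eq by simp
  finally have N1: "N * (1 + of_real \<alpha> * F) = 1" .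
  then have N0: "N \<noteq> 0" by auto
  have inv: "1 + of_real \<alpha> * F = 1 / N" using N1 N0 by (simp add: field_simps)
  have F: "F = (p + q) / N" using eq unfolding inv by simp
  have QN: "Q = p * (1 - of_real \<alpha> * q) / N"
    unfolding Q inv using N0 by (simp add: field_simps N_def power2_eq_square)
  have ReN: "Re N = 1 - \<alpha> * (Re p + Re q)" and ImN: "Im N = - \<alpha> * (Im p + Im q)"
    by (simp_all add: N_def)
  have Im_over_N: "Im (u / N) = (Im u * Re N - Re u * Im N) / (cmod N)\<^sup>2" for u
    by (simp add: Im_divide cmod_power2)
  have "(Im p + Im q) * Re N - (Re p + Re q) * Im N = Im p + Im q"
    unfolding ReN ImN by (simp add: algebra_simps)
  then have ImF: "Im F = (Im p + Im q) / (cmod N)\<^sup>2"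
    unfolding F Im_over_N by simp
  define A where "A = (cmod (1 - of_real \<alpha> * q))\<^sup>2"
  define P where "P = (cmod p)\<^sup>2"
  have A': "A = (1 - \<alpha> * Re q)\<^sup>2 + (\<alpha> * Im q)\<^sup>2" and P': "P = (Re p)\<^sup>2 + (Im p)\<^sup>2"
    by (simp_all add: A_def P_def cmod_power2)
  have "Im (p * (1 - of_real \<alpha> * q)) * Re N - Re (p * (1 - of_real \<alpha> * q)) * Im N = A * Im p + \<alpha>\<^sup>2 * P * Im q"
    unfolding A' P' ReN ImN times_complex.sel minus_complex.sel Re_complex_of_real Im_complex_of_real one_complex.sel
    by algebra
  then have ImQ: "Im Q = (A * Im p + \<alpha>\<^sup>2 * P * Im q) / (cmod N)\<^sup>2"
    unfolding QN Im_over_N by simp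
  have A0: "0 \<le> A" "0 \<le> P" by (simp_all add: A_def P_def)
  show "0 \<le> Im Q" unfolding ImQ using p q A0 by (intro divide_nonneg_nonneg add_nonneg_nonneg mult_nonneg_nonneg) auto
  have "of_real \<alpha> * p = (1 - of_real \<alpha> * q) - N" by (simp add: N_def algebra_simps)
  then have "\<bar>\<alpha>\<bar> * cmod p \<le> cmod (1 - of_real \<alpha> * q) + cmod N"
    by (metis norm_triangle_ineq4 norm_mult norm_of_real)
  then have "(\<bar>\<alpha>\<bar> * cmod p)\<^sup>2 \<le> (cmod (1 - of_real \<alpha> * q) + cmod N)\<^sup>2"
    by (intro power_mono) auto
  also have "\<dots> \<le> 2 * A + 2 * (cmod N)\<^sup>2"
    unfolding A_def using sum_squares_bound[of "cmod (1 - of_real \<alpha> * q)" "cmod N"] by (simp add: power2_sum)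
  finally have "\<alpha>\<^sup>2 * P * Im p \<le> (2 * A + 2 * (cmod N)\<^sup>2) * Im p"
    using p by (intro mult_right_mono) (auto simp: P_def power_mult_distrib)
  moreover have "0 \<le> \<alpha>\<^sup>2 * P * Im q" using q A0 by simp
  ultimately have "\<alpha>\<^sup>2 * P * (Im p + Im q) \<le> 2 * (A * Im p + \<alpha>\<^sup>2 * P * Im q) + 2 * Im p * (cmod N)\<^sup>2"
    by (simp add: algebra_simps)
  then have "\<alpha>\<^sup>2 * P * (Im p + Im q) / (cmod N)\<^sup>2 \<le> (2 * (A * Im p + \<alpha>\<^sup>2 * P * Im q) + 2 * Im p * (cmod N)\<^sup>2) / (cmod N)\<^sup>2"
    by (rule divide_right_mono) simp
  also have "\<dots> = 2 * Im Q + 2 * Im p"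
    unfolding ImQ using N0 by (simp add: add_divide_distrib)
  finally show "\<alpha>\<^sup>2 * (cmod p)\<^sup>2 * Im F \<le> 2 * Im Q + 2 * Im p"
    unfolding ImF P_def[symmetric] by simp
qed

context compactly_carried_measure
begin

text \<open>
  \<open>Q\<close> and \<open>p\<close> are both asymptotic to \<open>-M/z\<close>: in \<open>z Q\<close> the extra terms are products of
  \<open>z p\<close>, which is bounded, with \<open>p\<close> and with \<open>F/z\<close>, which tend to \<open>0\<close>.
\<close>

lemma two_weight_estimate:
  assumes \<kappa>': "transformable \<kappa>'" and \<mu>: "transformable \<mu>" and \<alpha>: "\<alpha> \<noteq> 0" and e: "0 < e"
    and eq: "\<And>z. 0 < Im z \<Longrightarrow>
      (borel_transform \<kappa> z + borel_transform \<kappa>' z) * (1 + of_real \<alpha> * borel_transform \<mu> z) = borel_transform \<mu> z"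
  shows "(\<integral>\<^sup>+x. ennreal ((cmod (borel_transform \<kappa> (of_real x + \<i> * of_real e)))\<^sup>2
            * Im (borel_transform \<mu> (of_real x + \<i> * of_real e))) \<partial>lborel) \<le> ennreal (4 * pi * M / \<alpha>\<^sup>2)"
proof -
  define p where "p = borel_transform \<kappa>"
  define F where "F = borel_transform \<mu>"
  define Q where "Q = (\<lambda>z. p z + of_real \<alpha> * (p z)\<^sup>2 * (1 + of_real \<alpha> * F z))"
  have p0: "0 \<le> Im (p z)" if "0 < Im z" for z
    unfolding p_def by (rule Im_borel_transform_nonneg[OF transformable_\<kappa> that])
  have est: "0 \<le> Im (Q z)" "\<alpha>\<^sup>2 * (cmod (p z))\<^sup>2 * Im (F z) \<le> 2 * Im (Q z) + 2 * Im (p z)" if "0 < Im z" for z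
    using partial_perturbation_estimate[OF eq[OF that] p0[OF that, unfolded p_def] Im_borel_transform_nonneg[OF \<kappa>' that], of "Q z"]
    unfolding Q_def p_def F_def by auto
  have hp: "p holomorphic_on {z. 0 < Im z}" unfolding p_def by (rule borel_transform_holomorphic[OF transformable_\<kappa>])
  have hF: "F holomorphic_on {z. 0 < Im z}" unfolding F_def by (rule borel_transform_holomorphic[OF \<mu>])
  have hQ: "Q holomorphic_on {z. 0 < Im z}" unfolding Q_def by (intro holomorphic_intros hp hF)
  have limp: "((\<lambda>z. z * p z) \<longlongrightarrow> - of_real M) (upper_at_infinity e)"
    unfolding p_def by (rule borel_transform_tendsto_moment)
  have limp0: "(p \<longlongrightarrow> 0) (upper_at_infinity e)"
    unfolding p_def by (rule borel_transform_tendsto_0)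
  have limF: "((\<lambda>z. F z / z) \<longlongrightarrow> 0) (upper_at_infinity e)"
    unfolding F_def by (rule borel_transform_over_z_tendsto_0[OF \<mu> e])
  have "((\<lambda>z. z * p z + of_real \<alpha> * ((z * p z) * p z) + of_real \<alpha> * of_real \<alpha> * ((z * p z) * (z * p z) * (F z / z)))
      \<longlongrightarrow> - of_real M + of_real \<alpha> * (- of_real M * 0) + of_real \<alpha> * of_real \<alpha> * (- of_real M * - of_real M * 0)) (upper_at_infinity e)"
    by (intro tendsto_intros limp limp0 limF)
  moreover have "\<forall>\<^sub>F z in upper_at_infinity e.
      z * p z + of_real \<alpha> * ((z * p z) * p z) + of_real \<alpha> * of_real \<alpha> * ((z * p z) * (z * p z) * (F z / z)) = z * Q z"
    using filter_leD[OF inf_le1 eventually_not_equal_at_infinity[of 0]]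
    by eventually_elim (simp add: Q_def power2_eq_square field_simps)
  ultimately have limQ: "((\<lambda>z. z * Q z) \<longlongrightarrow> - of_real M) (upper_at_infinity e)"
    by (simp add: tendsto_cong)
  let ?z = "\<lambda>x. complex_of_real x + \<i> * of_real e"
  have z0: "0 < Im (?z x)" for x using e by simp
  have meas[measurable]: "(\<lambda>x. f (?z x)) \<in> borel_measurable borel" if "f holomorphic_on {z. 0 < Im z}" for f
    by (rule borel_measurable_continuous_onI[OF holomorphic_upper_line_continuous[OF that e]])
  have [measurable]: "(\<lambda>x. Im (Q (?z x))) \<in> borel_measurable borel" "(\<lambda>x. Im (p (?z x))) \<in> borel_measurable borel"
    using meas[OF hQ] meas[OF hp] by measurable
  have "(\<integral>\<^sup>+x. ennreal ((cmod (p (?z x)))\<^sup>2 * Im (F (?z x))) \<partial>lborel)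
      \<le> (\<integral>\<^sup>+x. ennreal (2 / \<alpha>\<^sup>2) * (ennreal (Im (Q (?z x))) + ennreal (Im (p (?z x)))) \<partial>lborel)"
  proof (rule nn_integral_mono)
    fix x
    have "\<alpha>\<^sup>2 * ((cmod (p (?z x)))\<^sup>2 * Im (F (?z x))) \<le> 2 * (Im (Q (?z x)) + Im (p (?z x)))"
      using est(2)[OF z0, of x] by (simp only: mult.assoc distrib_left)
    then have "(cmod (p (?z x)))\<^sup>2 * Im (F (?z x)) \<le> 2 / \<alpha>\<^sup>2 * (Im (Q (?z x)) + Im (p (?z x)))"
      using \<alpha> by (simp add: field_simps)
    then show "ennreal ((cmod (p (?z x)))\<^sup>2 * Im (F (?z x)))
        \<le> ennreal (2 / \<alpha>\<^sup>2) * (ennreal (Im (Q (?z x))) + ennreal (Im (p (?z x))))"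
      using est(1)[OF z0, of x] p0[OF z0, of x]
      by (simp add: ennreal_plus[symmetric] ennreal_mult[symmetric] ennreal_leI del: ennreal_plus)
  qed
  also have "\<dots> = ennreal (2 / \<alpha>\<^sup>2) * ((\<integral>\<^sup>+x. ennreal (Im (Q (?z x))) \<partial>lborel) + (\<integral>\<^sup>+x. ennreal (Im (p (?z x))) \<partial>lborel))"
    by (simp add: nn_integral_cmult nn_integral_add)
  also have "(\<integral>\<^sup>+x. ennreal (Im (Q (?z x))) \<partial>lborel) = ennreal (pi * M)"
    using nn_integral_Im_upper_line[OF hQ e limQ est(1)] by simp
  also have "(\<integral>\<^sup>+x. ennreal (Im (p (?z x))) \<partial>lborel) = ennreal (pi * M)"
    using nn_integral_Im_upper_line[OF hp e limp p0] by simp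
  also have "ennreal (2 / \<alpha>\<^sup>2) * (ennreal (pi * M) + ennreal (pi * M)) = ennreal (4 * pi * M / \<alpha>\<^sup>2)"
    using M_nonneg by (simp add: ennreal_plus[symmetric] ennreal_mult[symmetric] del: ennreal_plus)
  finally show ?thesis unfolding p_def F_def .
qed

lemma G_measurable: "(\<lambda>x. G x) \<in> borel_measurable borel"
proof -
  interpret sigma_finite_measure \<kappa> by (rule transformable_sigma_finite[OF transformable_\<kappa>])
  have "(\<lambda>x. \<integral>s. 1 / (s - x) \<partial>\<kappa>) \<in> borel_measurable borel"
  proof (rule borel_measurable_lebesgue_integral)
    have "(\<lambda>(x, s). 1 / (s - x)) \<in> borel_measurable (borel \<Otimes>\<^sub>M borel :: (real \<times> real) measure)" by measurable
    then show "(\<lambda>(x, s). 1 / (s - x)) \<in> borel_measurable (borel \<Otimes>\<^sub>M \<kappa>)"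
      using measurable_cong_sets[OF sets_pair_measure_cong[OF refl sets_\<kappa>] refl] by blast
  qed
  then show ?thesis by (simp add: G_def)
qed

text \<open>
  Writing \<open>Im F\<close> as a Poisson integral and exchanging the integrals turns the hypothesis into
  a bound for the \<open>\<mu>\<close>-integral of the Poisson extension of \<open>|p|\<^sup>2\<close>.  That extension tends to \<open>\<pi> G\<^sup>2\<close>
  off \<open>K\<close>; Fatou's lemma gives the claim, with a cruder constant.
\<close>

lemma G_square_integrable:
  assumes \<mu>: "transformable \<mu>"
    and bd: "\<And>e. 0 < e \<Longrightarrow> (\<integral>\<^sup>+x. ennreal ((cmod (borel_transform \<kappa> (of_real x + \<i> * of_real e)))\<^sup>2
            * Im (borel_transform \<mu> (of_real x + \<i> * of_real e))) \<partial>lborel) \<le> C"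
  shows "(\<integral>\<^sup>+t\<in>-K. ennreal ((G t)\<^sup>2) \<partial>\<mu>) \<le> 2 * C"
proof -
  interpret M: sigma_finite_measure \<mu> by (rule transformable_sigma_finite[OF \<mu>])
  interpret P: pair_sigma_finite lborel \<mu> by standard
  have pair_sets: "sets (lborel \<Otimes>\<^sub>M \<mu>) = sets (borel \<Otimes>\<^sub>M borel :: (real \<times> real) measure)"
    by (rule sets_pair_measure_cong) (simp_all add: transformable_sets[OF \<mu>])
  define A where "A = (\<lambda>e x. (cmod (borel_transform \<kappa> (of_real x + \<i> * of_real e)))\<^sup>2)"
  have A_meas: "A e \<in> borel_measurable borel" if "0 < e" for e
  proof -
    note [measurable] = borel_measurable_continuous_onI[OF
        holomorphic_upper_line_continuous[OF borel_transform_holomorphic[OF transformable_\<kappa>] that]]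
    show ?thesis unfolding A_def by measurable
  qed
  define \<Phi> where "\<Phi> = (\<lambda>e t. \<integral>\<^sup>+u. ennreal (A e (t + e * u) / (1 + u\<^sup>2)) \<partial>lborel)"
  have \<Phi>_meas: "\<Phi> e \<in> borel_measurable \<mu>" if "0 < e" for e
  proof -
    note [measurable] = A_meas[OF that]
    have "(\<lambda>t. \<integral>\<^sup>+u. ennreal (A e (t + e * u) / (1 + u\<^sup>2)) \<partial>lborel) \<in> borel_measurable borel" by measurable
    then show ?thesis unfolding \<Phi>_def by (rule transformable_measurable[OF \<mu>])
  qed
  \<comment> \<open>The substitution \<open>x = t + e u\<close> turns the Poisson kernel at height \<open>e\<close> into \<open>1 / (1 + u\<^sup>2)\<close>.\<close>
  have \<Phi>_int: "(\<integral>\<^sup>+t. \<Phi> e t \<partial>\<mu>) \<le> C" if e: "0 < e" for e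
  proof -
    note [measurable] = A_meas[OF that]
    let ?h = "\<lambda>x t. ennreal (A e x * (e / ((t - x)\<^sup>2 + e\<^sup>2)))"
    have "\<Phi> e t = (\<integral>\<^sup>+x. ?h x t \<partial>lborel)" for t
    proof -
      have "(\<integral>\<^sup>+x. ?h x t \<partial>lborel) = ennreal \<bar>e\<bar> * (\<integral>\<^sup>+u. ?h (t + e * u) t \<partial>lborel)"
        using e by (intro nn_integral_real_affine) auto
      also have "\<dots> = (\<integral>\<^sup>+u. ennreal \<bar>e\<bar> * ?h (t + e * u) t \<partial>lborel)"
        by (rule nn_integral_cmult[symmetric]) measurable
      also have "\<dots> = \<Phi> e t"
        unfolding \<Phi>_def
      proof (intro nn_integral_cong)
        fix u :: real
        have "(t - (t + e * u))\<^sup>2 + e\<^sup>2 = e * (e * (1 + u\<^sup>2))" by (simp add: power2_eq_square algebra_simps)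
        then have "e * (e / ((t - (t + e * u))\<^sup>2 + e\<^sup>2)) = 1 / (1 + u\<^sup>2)"
          using e by simp
        then have "e * (A e (t + e * u) * (e / ((t - (t + e * u))\<^sup>2 + e\<^sup>2))) = A e (t + e * u) * (1 / (1 + u\<^sup>2))"
          by (metis mult.left_commute)
        then show "ennreal \<bar>e\<bar> * ?h (t + e * u) t = ennreal (A e (t + e * u) / (1 + u\<^sup>2))"
          using e by (simp add: ennreal_mult[symmetric] A_def)
      qed
      finally show ?thesis ..
    qed
    then have "(\<integral>\<^sup>+t. \<Phi> e t \<partial>\<mu>) = (\<integral>\<^sup>+t. \<integral>\<^sup>+x. ?h x t \<partial>lborel \<partial>\<mu>)" by simp
    also have "\<dots> = (\<integral>\<^sup>+x. \<integral>\<^sup>+t. ?h x t \<partial>\<mu> \<partial>lborel)"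
    proof (rule P.Fubini')
      have "(\<lambda>(x, t). ?h x t) \<in> borel_measurable (borel \<Otimes>\<^sub>M borel :: (real \<times> real) measure)" by measurable
      then show "(\<lambda>(x, t). ?h x t) \<in> borel_measurable (lborel \<Otimes>\<^sub>M \<mu>)"
        using measurable_cong_sets[OF pair_sets refl] by blast
    qed
    also have "\<dots> = (\<integral>\<^sup>+x. ennreal (A e x * Im (borel_transform \<mu> (of_real x + \<i> * of_real e))) \<partial>lborel)"
    proof (intro nn_integral_cong)
      fix x
      let ?z = "complex_of_real x + \<i> * of_real e"
      have z: "0 < Im ?z" using e by simp
      have eq: "e / ((t - x)\<^sup>2 + e\<^sup>2) = Im ?z / (cmod (complex_of_real t - ?z))\<^sup>2" for t
        by (simp add: cmod_power2)
      have "(\<integral>\<^sup>+t. ?h x t \<partial>\<mu>) = (\<integral>\<^sup>+t. ennreal (A e x * (Im ?z / (cmod (complex_of_real t - ?z))\<^sup>2)) \<partial>\<mu>)"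
        by (simp only: eq)
      also have "\<dots> = ennreal (\<integral>t. A e x * (Im ?z / (cmod (complex_of_real t - ?z))\<^sup>2) \<partial>\<mu>)"
        using Im_borel_transform(2)[OF \<mu> z] e
        by (intro nn_integral_eq_integral integrable_mult_right AE_I2) (auto simp: A_def)
      also have "\<dots> = ennreal (A e x * Im (borel_transform \<mu> ?z))"
        by (simp only: Im_borel_transform(1)[OF \<mu> z] Bochner_Integration.integral_mult_right_zero)
      finally show "(\<integral>\<^sup>+t. ?h x t \<partial>\<mu>) = ennreal (A e x * Im (borel_transform \<mu> ?z))" .
    qed
    also have "\<dots> \<le> C" unfolding A_def by (rule bd[OF e])
    finally show ?thesis .
  qed
  define e where "e = (\<lambda>n. 1 / real (Suc n))"
  have e0: "0 < e n" for n by (simp add: e_def)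
  have elim: "e \<longlonglongrightarrow> 0" unfolding e_def by (rule lim_1_over_n[THEN LIMSEQ_Suc])
  have low: "ennreal ((G t)\<^sup>2) * indicator (-K) t \<le> 2 * liminf (\<lambda>n. \<Phi> (e n) t)" for t
  proof (cases "t \<in> K")
    case False
    \<comment> \<open>The part \<open>0 \<le> u \<le> 1\<close> of the Poisson kernel, where \<open>1 / (1 + u\<^sup>2) \<ge> 1/2\<close>, is enough.\<close>
    have "ennreal ((G t)\<^sup>2 / 2) = (\<integral>\<^sup>+u. ennreal ((G t)\<^sup>2 / 2) * indicator {0..1::real} u \<partial>lborel)"
      by (simp add: nn_integral_cmult_indicator)
    also have "\<dots> \<le> (\<integral>\<^sup>+u. liminf (\<lambda>n. ennreal (A (e n) (t + e n * u) / (1 + u\<^sup>2))) \<partial>lborel)"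
    proof (rule nn_integral_mono)
      fix u :: real
      have u1: "1 + u\<^sup>2 \<noteq> 0" by (metis add_nonneg_pos add.commute less_irrefl zero_le_power2 zero_less_one)
      have "(\<lambda>n. A (e n) (t + e n * u)) \<longlonglongrightarrow> (cmod (of_real (G t)))\<^sup>2"
        unfolding A_def by (intro tendsto_intros boundary_sequence False e0 elim)
      then have "(\<lambda>n. A (e n) (t + e n * u) / (1 + u\<^sup>2)) \<longlonglongrightarrow> (G t)\<^sup>2 / (1 + u\<^sup>2)"
        using u1 by (intro tendsto_divide tendsto_const) auto
      then have "liminf (\<lambda>n. ennreal (A (e n) (t + e n * u) / (1 + u\<^sup>2))) = ennreal ((G t)\<^sup>2 / (1 + u\<^sup>2))"
        by (intro lim_imp_Liminf tendsto_ennrealI) auto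
      moreover have "(G t)\<^sup>2 / 2 \<le> (G t)\<^sup>2 / (1 + u\<^sup>2)" if "u \<in> {0..1}"
      proof -
        have "u\<^sup>2 \<le> 1" using that by (simp add: power_le_one)
        then show ?thesis by (intro divide_left_mono) (auto simp: add_pos_nonneg)
      qed
      ultimately show "ennreal ((G t)\<^sup>2 / 2) * indicator {0..1} u \<le> liminf (\<lambda>n. ennreal (A (e n) (t + e n * u) / (1 + u\<^sup>2)))"
        by (auto simp: indicator_def intro!: ennreal_leI)
    qed
    also have "\<dots> \<le> liminf (\<lambda>n. \<Phi> (e n) t)"
      unfolding \<Phi>_def
    proof (rule nn_integral_liminf)
      fix n
      note [measurable] = A_meas[OF e0]
      show "(\<lambda>u. ennreal (A (e n) (t + e n * u) / (1 + u\<^sup>2))) \<in> borel_measurable lborel" by measurable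
    qed
    finally have "2 * ennreal ((G t)\<^sup>2 / 2) \<le> 2 * liminf (\<lambda>n. \<Phi> (e n) t)" by (intro mult_left_mono) auto
    moreover have "2 * ennreal ((G t)\<^sup>2 / 2) = ennreal ((G t)\<^sup>2)"
      using ennreal_mult[of 2 "(G t)\<^sup>2 / 2"] by simp
    ultimately show ?thesis using False by simp
  qed simp
  have "(\<integral>\<^sup>+t\<in>-K. ennreal ((G t)\<^sup>2) \<partial>\<mu>) \<le> (\<integral>\<^sup>+t. 2 * liminf (\<lambda>n. \<Phi> (e n) t) \<partial>\<mu>)"
    by (rule nn_integral_mono) (rule low)
  also have "\<dots> = 2 * (\<integral>\<^sup>+t. liminf (\<lambda>n. \<Phi> (e n) t) \<partial>\<mu>)"
    by (rule nn_integral_cmult) (intro borel_measurable_liminf \<Phi>_meas e0)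
  also have "\<dots> \<le> 2 * liminf (\<lambda>n. \<integral>\<^sup>+t. \<Phi> (e n) t \<partial>\<mu>)"
    by (intro mult_left_mono nn_integral_liminf \<Phi>_meas e0) auto
  also have "\<dots> \<le> 2 * C"
  proof (intro mult_left_mono)
    have "liminf (\<lambda>n. \<integral>\<^sup>+t. \<Phi> (e n) t \<partial>\<mu>) \<le> liminf (\<lambda>n. C)"
      by (intro Liminf_mono always_eventually allI \<Phi>_int e0)
    then show "liminf (\<lambda>n. \<integral>\<^sup>+t. \<Phi> (e n) t \<partial>\<mu>) \<le> C" by (simp add: Liminf_const)
  qed simp
  finally show ?thesis .
qed

end

section \<open>Boole's identity for singular measures\<close>

lemma nn_integral_inverse_square_tail:
  assumes "0 < r"
  shows "(\<integral>\<^sup>+x\<in>{r..}. ennreal (1 / x\<^sup>2) \<partial>lborel) = ennreal (1 / r)"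
proof -
  have "(\<integral>\<^sup>+x. ennreal (1 / x\<^sup>2) * indicator {r..} x \<partial>lborel) = ennreal (0 - (- (1 / r)))"
  proof (rule nn_integral_FTC_atLeast)
    fix x assume "r \<le> x"
    then have "x \<noteq> 0" using assms by auto
    then show "((\<lambda>x. - (1 / x)) has_real_derivative 1 / x\<^sup>2) (at x)"
      by (auto intro!: derivative_eq_intros simp: power2_eq_square)
  next
    have "((\<lambda>x. 1 / x) \<longlongrightarrow> (0::real)) at_top"
      by (intro tendsto_divide_0[OF tendsto_const] filterlim_at_top_imp_at_infinity filterlim_ident)
    then show "((\<lambda>x. - (1 / x)) \<longlongrightarrow> (0::real)) at_top"
      using tendsto_minus by fastforce
  qed auto
  then show ?thesis by simp
qed

text \<open>
  The tails of the bound for \<open>G\<^sup>2 / (G\<^sup>2 + y\<^sup>2)\<close> that results from \<open>|G| \<le> m / x\<close> at distance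
  \<open>x\<close> from \<open>K\<close>.
\<close>

definition cauchy_tail :: "real \<Rightarrow> real \<Rightarrow> real \<Rightarrow> ennreal" where
  "cauchy_tail m y r = (\<integral>\<^sup>+x\<in>{r..}. ennreal (m\<^sup>2 / (m\<^sup>2 + y\<^sup>2 * x\<^sup>2)) \<partial>lborel)"

lemma cauchy_tail_0:
  assumes "0 < m" "0 < y"
  shows "cauchy_tail m y 0 = ennreal (pi * m / (2 * y))"
proof -
  have "(\<integral>\<^sup>+x. ennreal (m\<^sup>2 / (m\<^sup>2 + y\<^sup>2 * x\<^sup>2)) * indicator {0..} x \<partial>lborel) = ennreal (m / y * (pi / 2) - m / y * arctan (y * 0 / m))"
  proof (rule nn_integral_FTC_atLeast)
    fix x :: real
    have "((\<lambda>x. m / y * arctan (y * x / m)) has_real_derivative m / y * (y / m / (1 + (y * x / m)\<^sup>2))) (at x)"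
      using assms by (auto intro!: derivative_eq_intros simp: power2_eq_square divide_inverse)
    moreover have "m / y * (y / m / (1 + (y * x / m)\<^sup>2)) = m\<^sup>2 / (m\<^sup>2 + y\<^sup>2 * x\<^sup>2)"
    proof -
      have "m\<^sup>2 * (1 + (y * x / m)\<^sup>2) = m\<^sup>2 + y\<^sup>2 * x\<^sup>2"
        using assms by (simp add: power_divide power_mult_distrib distrib_left)
      then show ?thesis using assms by (simp add: divide_simps)
    qed
    ultimately show "((\<lambda>x. m / y * arctan (y * x / m)) has_real_derivative m\<^sup>2 / (m\<^sup>2 + y\<^sup>2 * x\<^sup>2)) (at x)" by simp
  next
    have "filterlim (\<lambda>x. y / m * x) at_top at_top"
      using assms by (intro filterlim_tendsto_pos_mult_at_top[OF tendsto_const _ filterlim_ident]) auto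
    then have "((\<lambda>x. m / y * arctan (y / m * x)) \<longlongrightarrow> m / y * (pi / 2)) at_top"
      by (intro tendsto_intros filterlim_compose[OF tendsto_arctan_at_top])
    then show "((\<lambda>x. m / y * arctan (y * x / m)) \<longlongrightarrow> m / y * (pi / 2)) at_top" by simp
  qed (auto intro!: divide_nonneg_nonneg add_nonneg_nonneg)
  then show ?thesis by (simp add: cauchy_tail_def mult.commute)
qed

lemma cauchy_tail_le:
  assumes "0 < r" "0 < y"
  shows "cauchy_tail m y r \<le> ennreal (m\<^sup>2 / (y\<^sup>2 * r))"
proof -
  have "cauchy_tail m y r \<le> (\<integral>\<^sup>+x. ennreal (m\<^sup>2 / y\<^sup>2 * (1 / x\<^sup>2)) * indicator {r..} x \<partial>lborel)"
    unfolding cauchy_tail_def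
  proof (rule nn_integral_mono)
    fix x
    show "ennreal (m\<^sup>2 / (m\<^sup>2 + y\<^sup>2 * x\<^sup>2)) * indicator {r..} x \<le> ennreal (m\<^sup>2 / y\<^sup>2 * (1 / x\<^sup>2)) * indicator {r..} x"
    proof (cases "r \<le> x")
      case True
      then have "m\<^sup>2 / (m\<^sup>2 + y\<^sup>2 * x\<^sup>2) \<le> m\<^sup>2 / (y\<^sup>2 * x\<^sup>2)"
        using assms by (intro divide_left_mono mult_pos_pos add_nonneg_pos) auto
      then show ?thesis using True by (simp add: ennreal_leI)
    qed simp
  qed
  also have "\<dots> = (\<integral>\<^sup>+x. ennreal (m\<^sup>2 / y\<^sup>2) * (ennreal (1 / x\<^sup>2) * indicator {r..} x) \<partial>lborel)"
  proof (rule nn_integral_cong)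
    fix x :: real
    have "ennreal (m\<^sup>2 / y\<^sup>2 * (1 / x\<^sup>2)) = ennreal (m\<^sup>2 / y\<^sup>2) * ennreal (1 / x\<^sup>2)"
      by (rule ennreal_mult) auto
    then show "ennreal (m\<^sup>2 / y\<^sup>2 * (1 / x\<^sup>2)) * indicator {r..} x = ennreal (m\<^sup>2 / y\<^sup>2) * (ennreal (1 / x\<^sup>2) * indicator {r..} x)"
      by (simp only: mult.assoc)
  qed
  also have "\<dots> = ennreal (m\<^sup>2 / y\<^sup>2) * ennreal (1 / r)"
    unfolding nn_integral_inverse_square_tail[OF assms(1), symmetric] by (rule nn_integral_cmult) measurable
  also have "\<dots> = ennreal (m\<^sup>2 / (y\<^sup>2 * r))"
    using assms by (simp add: ennreal_mult[symmetric])
  finally show ?thesis .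
qed

lemma cauchy_density_integrable: "(\<integral>\<^sup>+x. ennreal (1 / (1 + x\<^sup>2)) \<partial>lborel) < \<infinity>"
proof -
  let ?f = "\<lambda>x::real. ennreal (1 / (1 + x\<^sup>2))"
  have "(\<integral>\<^sup>+x. ?f x \<partial>lborel) \<le> (\<integral>\<^sup>+x. ?f x * indicator {0..} x + ?f (- x) * indicator {0..} (- x) \<partial>lborel)"
    by (intro nn_integral_mono) (auto simp: indicator_def)
  also have "\<dots> = (\<integral>\<^sup>+x. ?f x * indicator {0..} x \<partial>lborel) + (\<integral>\<^sup>+x. ?f (- x) * indicator {0..} (- x) \<partial>lborel)"
    by (rule nn_integral_add) auto
  also have "(\<integral>\<^sup>+x. ?f (- x) * indicator {0..} (- x) \<partial>lborel) = (\<integral>\<^sup>+x. ?f x * indicator {0..} x \<partial>lborel)"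
    using nn_integral_real_affine[of "\<lambda>x. ?f x * indicator {0..} x" "-1" 0] by simp
  also have "(\<integral>\<^sup>+x. ?f x * indicator {0..} x \<partial>lborel) = ennreal (pi / 2)"
    using cauchy_tail_0[of 1 1] by (simp add: cauchy_tail_def)
  finally show ?thesis by (auto simp: less_top[symmetric] top_unique)
qed

context compactly_carried_measure
begin

text \<open>
  The function \<open>i p / (p + i y)\<close> has nonnegative imaginary part and is asymptotic to \<open>-(M/y)/z\<close>, so its
  imaginary part has integral \<open>\<pi> M / y\<close> over every line.  As the line descends to the real
  axis this imaginary part converges off \<open>K\<close>, hence almost everywhere, and it is dominated: it is at
  most \<open>1\<close>, and of order \<open>1/x\<^sup>2\<close> far from \<open>K\<close>.
\<close>

lemma Boole_identity:
  assumes y: "0 < y" and null: "emeasure lborel K = 0"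
  shows "(\<integral>\<^sup>+x\<in>-K. ennreal ((G x)\<^sup>2 / ((G x)\<^sup>2 + y\<^sup>2)) \<partial>lborel) = ennreal (pi * M / y)"
proof -
  define p where "p = borel_transform \<kappa>"
  define f where "f = (\<lambda>z. \<i> * (p z / (p z + \<i> * of_real y)))"
  have p0: "0 \<le> Im (p z)" if "0 < Im z" for z
    unfolding p_def by (rule Im_borel_transform_nonneg[OF transformable_\<kappa> that])
  have den: "p z + \<i> * of_real y \<noteq> 0" if "0 < Im z" for z
    using p0[OF that] y by (auto simp: complex_eq_iff)
  have Imf: "Im (f z) = ((cmod (p z))\<^sup>2 + y * Im (p z)) / (cmod (p z + \<i> * of_real y))\<^sup>2" for z
  proof -
    have "Im (f z) = Re (p z / (p z + \<i> * of_real y))"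
      unfolding f_def by (simp only: times_complex.sel imaginary_unit.sel mult_zero_left mult_1 add_0_left)
    also have "\<dots> = ((cmod (p z))\<^sup>2 + y * Im (p z)) / (cmod (p z + \<i> * of_real y))\<^sup>2"
      unfolding Re_divide cmod_power2 by (simp add: power2_eq_square algebra_simps)
    finally show ?thesis .
  qed
  have f0: "0 \<le> Im (f z)" if "0 < Im z" for z
    unfolding Imf using p0[OF that] y by (intro divide_nonneg_nonneg add_nonneg_nonneg) auto
  have hp: "p holomorphic_on {z. 0 < Im z}" unfolding p_def by (rule borel_transform_holomorphic[OF transformable_\<kappa>])
  have hf: "f holomorphic_on {z. 0 < Im z}"
    unfolding f_def using den by (intro holomorphic_intros hp) auto
  define e where "e = (\<lambda>n. 1 / real (Suc n))"
  have e0: "0 < e n" "e n \<le> 1" for n by (simp_all add: e_def)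
  have elim: "e \<longlonglongrightarrow> 0" unfolding e_def by (rule lim_1_over_n[THEN LIMSEQ_Suc])
  have limf: "((\<lambda>z. z * f z) \<longlongrightarrow> - of_real (M / y)) (upper_at_infinity d)" for d
  proof -
    have "((\<lambda>z. \<i> * ((z * p z) / (p z + \<i> * of_real y))) \<longlongrightarrow> \<i> * (- of_real M / (0 + \<i> * of_real y))) (upper_at_infinity d)"
      unfolding p_def using y
      by (intro tendsto_intros borel_transform_tendsto_moment borel_transform_tendsto_0) auto
    moreover have "\<i> * (- of_real M / (0 + \<i> * of_real y)) = - complex_of_real (M / y)"
      by simp
    ultimately show ?thesis by (simp add: f_def mult.left_commute)
  qed
  let ?z = "\<lambda>n x. complex_of_real x + \<i> * of_real (e n)"
  have int: "(\<integral>\<^sup>+x. ennreal (Im (f (?z n x))) \<partial>lborel) = ennreal (pi * M / y)" for n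
    using nn_integral_Im_upper_line[OF hf e0(1) limf f0] by simp
  obtain B where B: "0 < B" "\<And>s. s \<in> K \<Longrightarrow> \<bar>s\<bar> \<le> B" using K_bounded by blast
  \<comment> \<open>For \<open>|x| > R\<close> the distance from \<open>x\<close> to \<open>K\<close> is at least \<open>|x| / 2\<close>.\<close>
  define R where "R = 2 * B + 1"
  define C1 where "C1 = (4 * M\<^sup>2 + 4 * M * y) / y\<^sup>2"
  define C where "C = 1 + R\<^sup>2 + 2 * C1"
  have C1: "0 \<le> C1" using M_nonneg y by (simp add: C1_def)
  have dom: "Im (f (?z n x)) \<le> C * (1 / (1 + x\<^sup>2))" for n x
  proof -
    let ?w = "?z n x"
    have w: "0 < Im ?w" using e0[of n] by simp
    have pos: "0 < 1 + x\<^sup>2" by (simp add: add_pos_nonneg)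
    have "Im (f ?w) * (1 + x\<^sup>2) \<le> C"
    proof (cases "\<bar>x\<bar> \<le> R")
      case True
      have "cmod (p ?w) \<le> cmod (p ?w + \<i> * of_real y)"
        unfolding cmod_def using p0[OF w] y by (intro real_sqrt_le_mono add_mono) (auto intro: power_mono)
      then have "cmod (p ?w / (p ?w + \<i> * of_real y)) \<le> 1"
        using den[OF w] by (simp add: norm_divide divide_le_eq)
      then have "Im (f ?w) \<le> 1"
        using abs_Im_le_cmod[of "f ?w"] by (simp only: f_def norm_mult norm_ii mult_1)
      moreover have "x\<^sup>2 \<le> R\<^sup>2" using True by (rule abs_le_square_iff[THEN iffD1, OF order_trans[OF _ abs_ge_self]])
      ultimately have "Im (f ?w) * (1 + x\<^sup>2) \<le> 1 * (1 + R\<^sup>2)"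
        using f0[OF w] by (intro mult_mono) auto
      then show ?thesis using C1 by (simp add: C_def)
    next
      case False
      have x: "\<bar>x\<bar> > 2 * B" "\<bar>x\<bar> > 1" using False B(1) by (auto simp: R_def)
      have k: "\<bar>x\<bar> / 2 \<le> cmod (complex_of_real s - ?w)" if "s \<in> K" for s
      proof -
        have "\<bar>x\<bar> / 2 \<le> \<bar>s - x\<bar>" using B(2)[OF that] x by linarith
        also have "\<dots> \<le> cmod (complex_of_real s - ?w)" using abs_Re_le_cmod[of "complex_of_real s - ?w"] by simp
        finally show ?thesis .
      qed
      have x2: "\<bar>x\<bar> / 2 > 0" using x by linarith
      have "cmod (p ?w) \<le> 1 / (\<bar>x\<bar> / 2) * M"
        unfolding p_def borel_transform_def
      proof (rule integrable_bounded_on_K(2)[OF resolvent_kernel_measurable])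
        show "norm (1 / (complex_of_real s - ?w)) \<le> 1 / (\<bar>x\<bar> / 2)" if "s \<in> K" for s
          unfolding norm_divide norm_one using k[OF that] x2 by (intro frac_le) auto
      qed
      then have "(cmod (p ?w))\<^sup>2 \<le> (1 / (\<bar>x\<bar> / 2) * M)\<^sup>2" by (intro power_mono) auto
      then have b1: "(cmod (p ?w))\<^sup>2 \<le> 4 * M\<^sup>2 / x\<^sup>2" by (simp add: power_mult_distrib power_divide)
      have "norm (\<integral>s. Im ?w / (cmod (complex_of_real s - ?w))\<^sup>2 \<partial>\<kappa>) \<le> 1 / (\<bar>x\<bar> / 2)\<^sup>2 * M"
      proof (rule integrable_bounded_on_K(2))
        show "(\<lambda>s. Im ?w / (cmod (complex_of_real s - ?w))\<^sup>2) \<in> borel_measurable borel" by measurable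
        show "norm (Im ?w / (cmod (complex_of_real s - ?w))\<^sup>2) \<le> 1 / (\<bar>x\<bar> / 2)\<^sup>2" if "s \<in> K" for s
        proof -
          have "Im ?w / (cmod (complex_of_real s - ?w))\<^sup>2 \<le> 1 / (\<bar>x\<bar> / 2)\<^sup>2"
            using k[OF that] x2 e0[of n] by (intro frac_le power_mono) auto
          then show ?thesis using e0[of n] by simp
        qed
      qed
      then have b2: "Im (p ?w) \<le> 4 * M / x\<^sup>2"
        unfolding p_def Im_borel_transform(1)[OF transformable_\<kappa> w] by (simp add: power_divide)
      have "y \<le> cmod (p ?w + \<i> * of_real y)"
        using p0[OF w] y abs_Im_le_cmod[of "p ?w + \<i> * of_real y"] by simp
      then have "y\<^sup>2 \<le> (cmod (p ?w + \<i> * of_real y))\<^sup>2" using y by (intro power_mono) auto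
      then have "Im (f ?w) \<le> (4 * M\<^sup>2 / x\<^sup>2 + y * (4 * M / x\<^sup>2)) / y\<^sup>2"
        unfolding Imf using b1 b2 p0[OF w] y M_nonneg by (intro frac_le add_mono mult_left_mono) auto
      also have "\<dots> = C1 / x\<^sup>2" by (simp add: C1_def add_divide_distrib mult_ac)
      finally have "Im (f ?w) * (1 + x\<^sup>2) \<le> C1 / x\<^sup>2 * (1 + x\<^sup>2)"
        using pos by (intro mult_right_mono) auto
      also have "\<dots> \<le> C1 / x\<^sup>2 * (2 * x\<^sup>2)"
      proof (intro mult_left_mono)
        have "1 \<le> x\<^sup>2" using x(2) by (simp add: abs_square_less_1 less_imp_le not_less[symmetric])
        then show "1 + x\<^sup>2 \<le> 2 * x\<^sup>2" by simp
      qed (use C1 in auto)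
      also have "\<dots> \<le> C" using x by (simp add: C_def)
      finally show ?thesis .
    qed
    then show ?thesis using pos by (simp add: pos_le_divide_eq)
  qed
  have "(\<lambda>n. \<integral>\<^sup>+x. ennreal (Im (f (?z n x))) \<partial>lborel)
      \<longlonglongrightarrow> (\<integral>\<^sup>+x. ennreal ((G x)\<^sup>2 / ((G x)\<^sup>2 + y\<^sup>2)) * indicator (-K) x \<partial>lborel)"
  proof (rule nn_integral_dominated_convergence[where w = "\<lambda>x. ennreal (C * (1 / (1 + x\<^sup>2)))"])
    show "(\<lambda>x. ennreal (Im (f (?z n x)))) \<in> borel_measurable lborel" for n
    proof -
      note [measurable] = borel_measurable_continuous_onI[OF holomorphic_upper_line_continuous[OF hf e0(1)]]
      show ?thesis by measurable
    qed
    note [measurable] = G_measurable K_borel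
    show "(\<lambda>x. ennreal ((G x)\<^sup>2 / ((G x)\<^sup>2 + y\<^sup>2)) * indicator (-K) x) \<in> borel_measurable lborel" by measurable
    show "(\<lambda>x. ennreal (C * (1 / (1 + x\<^sup>2)))) \<in> borel_measurable lborel" by measurable
    show "AE x in lborel. ennreal (Im (f (?z n x))) \<le> ennreal (C * (1 / (1 + x\<^sup>2)))" for n
      using dom by (intro AE_I2 ennreal_leI)
    have C0: "0 \<le> C" using C1 by (simp add: C_def)
    have "(\<integral>\<^sup>+x. ennreal (C * (1 / (1 + x\<^sup>2))) \<partial>lborel) = (\<integral>\<^sup>+x. ennreal C * ennreal (1 / (1 + x\<^sup>2)) \<partial>lborel)"
      using C0 by (intro nn_integral_cong ennreal_mult) auto
    also have "\<dots> = ennreal C * (\<integral>\<^sup>+x. ennreal (1 / (1 + x\<^sup>2)) \<partial>lborel)"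
      by (rule nn_integral_cmult) measurable
    also have "\<dots> < \<infinity>" using cauchy_density_integrable by (simp add: ennreal_mult_less_top)
    finally show "(\<integral>\<^sup>+x. ennreal (C * (1 / (1 + x\<^sup>2))) \<partial>lborel) < \<infinity>" .
    have "AE x in lborel. x \<notin> K" using null by (intro AE_not_in) (simp add: null_sets_def K_borel)
    then show "AE x in lborel. (\<lambda>n. ennreal (Im (f (?z n x)))) \<longlonglongrightarrow> ennreal ((G x)\<^sup>2 / ((G x)\<^sup>2 + y\<^sup>2)) * indicator (-K) x"
    proof eventually_elim
      case (elim x)
      have "(\<lambda>n. p (?z n x)) \<longlonglongrightarrow> of_real (G x)"
        using boundary_sequence[OF elim e0(1) \<open>e \<longlonglongrightarrow> 0\<close>, of 0] by (simp add: p_def)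
      moreover have nz: "complex_of_real (G x) + \<i> * of_real y \<noteq> 0" using y by (simp add: complex_eq_iff)
      ultimately have "(\<lambda>n. Im (f (?z n x))) \<longlonglongrightarrow> Im (\<i> * (of_real (G x) / (of_real (G x) + \<i> * of_real y)))"
        unfolding f_def by (intro tendsto_intros)
      also have "Im (\<i> * (of_real (G x) / (of_real (G x) + \<i> * of_real y))) = (G x)\<^sup>2 / ((G x)\<^sup>2 + y\<^sup>2)"
      proof -
        have "Im (\<i> * (of_real (G x) / (of_real (G x) + \<i> * of_real y))) = Re (of_real (G x) / (of_real (G x) + \<i> * of_real y))"
          by (simp only: times_complex.sel imaginary_unit.sel mult_zero_left mult_1 add_0_left)
        also have "\<dots> = (G x)\<^sup>2 / ((G x)\<^sup>2 + y\<^sup>2)"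
          by (simp add: Re_divide power2_eq_square)
        finally show ?thesis .
      qed
      finally show ?case using elim by (simp add: tendsto_ennrealI)
    qed
  qed
  then show ?thesis unfolding int by (rule LIMSEQ_unique[OF _ tendsto_const])
qed

end

section \<open>Square integrals off small sets\<close>

context compactly_carried_measure
begin

text \<open>
  \<open>g\<^sup>2 / (g\<^sup>2 + y\<^sup>2)\<close> increases with \<open>|g|\<close>, and \<open>|G x| \<le> M / r\<close>.
\<close>

lemma G_ratio_le:
  assumes r: "0 < r" "\<And>s. s \<in> K \<Longrightarrow> r \<le> \<bar>s - x\<bar>" and pos: "0 < M" "0 < y"
  shows "(G x)\<^sup>2 / ((G x)\<^sup>2 + y\<^sup>2) \<le> M\<^sup>2 / (M\<^sup>2 + y\<^sup>2 * r\<^sup>2)"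
proof -
  have "\<bar>G x\<bar> \<le> M / r" by (rule G_bound[OF r])
  then have "\<bar>G x\<bar> * r \<le> M" using r(1) by (simp add: pos_le_divide_eq)
  then have "(\<bar>G x\<bar> * r)\<^sup>2 \<le> M\<^sup>2" using r(1) by (intro power_mono) auto
  then have "y\<^sup>2 * ((G x)\<^sup>2 * r\<^sup>2) \<le> y\<^sup>2 * M\<^sup>2"
    by (intro mult_left_mono) (auto simp: power_mult_distrib)
  then have "(G x)\<^sup>2 * (M\<^sup>2 + y\<^sup>2 * r\<^sup>2) \<le> M\<^sup>2 * ((G x)\<^sup>2 + y\<^sup>2)"
    by (simp add: algebra_simps)
  moreover have "0 < M\<^sup>2 + y\<^sup>2 * r\<^sup>2" "0 < (G x)\<^sup>2 + y\<^sup>2"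
    using pos by (simp_all add: add_pos_nonneg add_nonneg_pos)
  moreover have "u / v \<le> m / n" if "u * n \<le> m * v" "0 < n" "0 < v" for u v m n :: real
    using that by (simp add: field_simps)
  ultimately show ?thesis by blast
qed

lemma G_right_tail:
  assumes K: "\<And>s. s \<in> K \<Longrightarrow> s \<le> c" and "c \<le> b" and pos: "0 < M" "0 < y"
  shows "(\<integral>\<^sup>+x\<in>{b<..}. ennreal ((G x)\<^sup>2 / ((G x)\<^sup>2 + y\<^sup>2)) \<partial>lborel) \<le> cauchy_tail M y (b - c)"
proof -
  let ?k = "\<lambda>x. ennreal (M\<^sup>2 / (M\<^sup>2 + y\<^sup>2 * x\<^sup>2))"
  have "(\<integral>\<^sup>+x\<in>{b<..}. ennreal ((G x)\<^sup>2 / ((G x)\<^sup>2 + y\<^sup>2)) \<partial>lborel) \<le> (\<integral>\<^sup>+x. ?k (x - c) * indicator {b..} x \<partial>lborel)"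
  proof (rule nn_integral_mono)
    fix x
    show "ennreal ((G x)\<^sup>2 / ((G x)\<^sup>2 + y\<^sup>2)) * indicator {b<..} x \<le> ?k (x - c) * indicator {b..} x"
    proof (cases "b < x")
      case True
      have "x - c \<le> \<bar>s - x\<bar>" if "s \<in> K" for s using K[OF that] True \<open>c \<le> b\<close> by linarith
      then show ?thesis using G_ratio_le[of "x - c" x y] True \<open>c \<le> b\<close> pos by (simp add: ennreal_leI)
    qed simp
  qed
  also have "\<dots> = (\<integral>\<^sup>+u. ?k u * indicator {b - c..} u \<partial>lborel)"
    by (subst nn_integral_real_affine[where c = 1 and t = c])
       (auto intro!: nn_integral_cong simp: indicator_def)
  finally show ?thesis by (simp add: cauchy_tail_def)
qed

lemma G_left_tail:
  assumes K: "\<And>s. s \<in> K \<Longrightarrow> c \<le> s" and "a \<le> c" and pos: "0 < M" "0 < y"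
  shows "(\<integral>\<^sup>+x\<in>{..<a}. ennreal ((G x)\<^sup>2 / ((G x)\<^sup>2 + y\<^sup>2)) \<partial>lborel) \<le> cauchy_tail M y (c - a)"
proof -
  let ?k = "\<lambda>x. ennreal (M\<^sup>2 / (M\<^sup>2 + y\<^sup>2 * x\<^sup>2))"
  have "(\<integral>\<^sup>+x\<in>{..<a}. ennreal ((G x)\<^sup>2 / ((G x)\<^sup>2 + y\<^sup>2)) \<partial>lborel) \<le> (\<integral>\<^sup>+x. ?k (c - x) * indicator {..a} x \<partial>lborel)"
  proof (rule nn_integral_mono)
    fix x
    show "ennreal ((G x)\<^sup>2 / ((G x)\<^sup>2 + y\<^sup>2)) * indicator {..<a} x \<le> ?k (c - x) * indicator {..a} x"
    proof (cases "x < a")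
      case True
      have "c - x \<le> \<bar>s - x\<bar>" if "s \<in> K" for s using K[OF that] True \<open>a \<le> c\<close> by linarith
      then show ?thesis using G_ratio_le[of "c - x" x y] True \<open>a \<le> c\<close> pos by (simp add: ennreal_leI)
    qed simp
  qed
  also have "\<dots> = (\<integral>\<^sup>+u. ?k u * indicator {c - a..} u \<partial>lborel)"
    by (subst nn_integral_real_affine[where c = "-1" and t = c])
       (auto intro!: nn_integral_cong simp: indicator_def)
  finally show ?thesis by (simp add: cauchy_tail_def)
qed

text \<open>
  Boole's identity distributes the mass \<open>\<pi> M / y\<close> over \<open>E\<close>, over \<open>I - E\<close> and over the two
  half-lines outside \<open>I\<close>.  A half-line adjacent to \<open>K\<close> may take up to half of it, and
  both together all of it if \<open>K\<close> reaches both ends of \<open>I\<close>.  With \<open>K\<close> in one half of \<open>I\<close> the far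
  half-line takes only \<open>O(1/y\<^sup>2)\<close>.
\<close>

lemma G_square_lower_bound:
  assumes ab: "a < b" and KI: "K \<subseteq> {a..b}" and half: "K \<subseteq> {..(a + b) / 2} \<or> K \<subseteq> {(a + b) / 2..}"
    and null: "emeasure lborel K = 0" and M: "0 < M"
    and E: "E \<in> sets borel" "emeasure lborel E \<le> ennreal e" and e: "0 < e" "e \<le> (b - a) * pi\<^sup>2 / 64"
  shows "ennreal (pi\<^sup>2 * M\<^sup>2 / (32 * e)) \<le> (\<integral>\<^sup>+x\<in>{a..b} - K - E. ennreal ((G x)\<^sup>2) \<partial>lborel)"
proof -
  define d where "d = (b - a) / 2"
  have d: "0 < d" using ab by (simp add: d_def)
  \<comment> \<open>With this \<open>y\<close> one half of the mass \<open>\<pi> M / y\<close> equals \<open>2 e\<close>, twice what \<open>E\<close> can absorb.\<close>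
  define y where "y = pi * M / (4 * e)"
  have y: "0 < y" using M e by (simp add: y_def)
  define \<phi> where "\<phi> = (\<lambda>x. ennreal ((G x)\<^sup>2 / ((G x)\<^sup>2 + y\<^sup>2)))"
  define J where "J = (\<integral>\<^sup>+x\<in>{a..b} - K - E. ennreal ((G x)\<^sup>2) \<partial>lborel)"
  note [measurable] = G_measurable K_borel E(1)
  have \<phi>m[measurable]: "\<phi> \<in> borel_measurable borel" unfolding \<phi>_def by measurable
  have tails: "(\<integral>\<^sup>+x\<in>{..<a}. \<phi> x \<partial>lborel) + (\<integral>\<^sup>+x\<in>{b<..}. \<phi> x \<partial>lborel) \<le> cauchy_tail M y 0 + cauchy_tail M y d"
    using half
  proof
    assume h: "K \<subseteq> {..(a + b) / 2}"
    have "(\<integral>\<^sup>+x\<in>{b<..}. \<phi> x \<partial>lborel) \<le> cauchy_tail M y (b - (a + b) / 2)"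
      unfolding \<phi>_def by (rule G_right_tail) (use h ab M y in auto)
    moreover have "(\<integral>\<^sup>+x\<in>{..<a}. \<phi> x \<partial>lborel) \<le> cauchy_tail M y (a - a)"
      unfolding \<phi>_def by (rule G_left_tail) (use KI ab M y in auto)
    moreover have "b - (a + b) / 2 = d" by (simp add: d_def field_simps)
    ultimately show ?thesis by (metis add_mono diff_self)
  next
    assume h: "K \<subseteq> {(a + b) / 2..}"
    have "(\<integral>\<^sup>+x\<in>{..<a}. \<phi> x \<partial>lborel) \<le> cauchy_tail M y ((a + b) / 2 - a)"
      unfolding \<phi>_def by (rule G_left_tail) (use h ab M y in auto)
    moreover have "(\<integral>\<^sup>+x\<in>{b<..}. \<phi> x \<partial>lborel) \<le> cauchy_tail M y (b - b)"
      unfolding \<phi>_def by (rule G_right_tail) (use KI ab M y in auto)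
    moreover have "(a + b) / 2 - a = d" by (simp add: d_def field_simps)
    ultimately show ?thesis by (metis add_mono add.commute diff_self)
  qed
  have pw: "\<phi> x * indicator (-K) x \<le> (indicator E x + ennreal (1 / y\<^sup>2) * (ennreal ((G x)\<^sup>2) * indicator ({a..b} - K - E) x))
      + (\<phi> x * indicator {..<a} x + \<phi> x * indicator {b<..} x)" for x
  proof -
    have den: "0 < (G x)\<^sup>2 + y\<^sup>2" using y by (simp add: add_nonneg_pos)
    have "\<phi> x \<le> 1" unfolding \<phi>_def using den by (simp add: divide_le_eq)
    moreover have "\<phi> x \<le> ennreal (1 / y\<^sup>2) * ennreal ((G x)\<^sup>2)"
    proof -
      have "(G x)\<^sup>2 / ((G x)\<^sup>2 + y\<^sup>2) \<le> (G x)\<^sup>2 / y\<^sup>2"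
        using y den by (intro divide_left_mono mult_pos_pos) auto
      then show ?thesis unfolding \<phi>_def using y by (simp add: ennreal_mult[symmetric] ennreal_leI)
    qed
    ultimately show ?thesis by (auto simp: indicator_def)
  qed
  have "ennreal (pi * M / y) = (\<integral>\<^sup>+x. \<phi> x * indicator (-K) x \<partial>lborel)"
    unfolding \<phi>_def using Boole_identity[OF y null] by simp
  also have "\<dots> \<le> (\<integral>\<^sup>+x. (indicator E x + ennreal (1 / y\<^sup>2) * (ennreal ((G x)\<^sup>2) * indicator ({a..b} - K - E) x))
      + (\<phi> x * indicator {..<a} x + \<phi> x * indicator {b<..} x) \<partial>lborel)"
    by (rule nn_integral_mono) (rule pw)
  also have "\<dots> = (emeasure lborel E + ennreal (1 / y\<^sup>2) * J) + ((\<integral>\<^sup>+x\<in>{..<a}. \<phi> x \<partial>lborel) + (\<integral>\<^sup>+x\<in>{b<..}. \<phi> x \<partial>lborel))"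
    unfolding J_def using E(1) by (simp add: nn_integral_add nn_integral_cmult)
  also have "\<dots> \<le> (ennreal e + ennreal (1 / y\<^sup>2) * J) + (cauchy_tail M y 0 + cauchy_tail M y d)"
    by (intro add_mono tails E(2) order_refl)
  also have "\<dots> \<le> (ennreal e + ennreal (1 / y\<^sup>2) * J) + (ennreal (pi * M / (2 * y)) + ennreal (M\<^sup>2 / (y\<^sup>2 * d)))"
    using cauchy_tail_0[OF M y] cauchy_tail_le[OF d y] by (intro add_mono) auto
  finally have main: "ennreal (pi * M / y) \<le> (ennreal e + ennreal (1 / y\<^sup>2) * J) + (ennreal (pi * M / (2 * y)) + ennreal (M\<^sup>2 / (y\<^sup>2 * d)))" .
  show ?thesis
  proof (cases J)
    case top
    then show ?thesis by (simp add: J_def)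
  next
    case (real j)
    have "pi * M / y \<le> (e + 1 / y\<^sup>2 * j) + (pi * M / (2 * y) + M\<^sup>2 / (y\<^sup>2 * d))"
    proof -
      have "0 \<le> (e + 1 / y\<^sup>2 * j) + (pi * M / (2 * y) + M\<^sup>2 / (y\<^sup>2 * d))"
        using real e y M d by (intro add_nonneg_nonneg) auto
      moreover have "ennreal (pi * M / y) \<le> ennreal ((e + 1 / y\<^sup>2 * j) + (pi * M / (2 * y) + M\<^sup>2 / (y\<^sup>2 * d)))"
        using main real e y M d unfolding \<open>J = ennreal j\<close>
        by (simp add: ennreal_plus[symmetric] ennreal_mult[symmetric] del: ennreal_plus)
      ultimately show ?thesis by (simp add: ennreal_le_iff)
    qed
    moreover have "pi * M / y = 4 * e" "pi * M / (2 * y) = 2 * e"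
      using M e by (simp_all add: y_def)
    moreover have "1 / y\<^sup>2 * j + M\<^sup>2 / (y\<^sup>2 * d) = (j + M\<^sup>2 / d) / y\<^sup>2"
      using y d by (simp add: field_simps)
    ultimately have "e \<le> (j + M\<^sup>2 / d) / y\<^sup>2" by linarith
    then have "e * y\<^sup>2 \<le> j + M\<^sup>2 / d" using y by (simp add: pos_le_divide_eq)
    moreover have "e * y\<^sup>2 = 2 * (pi\<^sup>2 * M\<^sup>2 / (32 * e))"
      using e by (simp add: y_def power2_eq_square field_simps)
    moreover have "M\<^sup>2 / d \<le> pi\<^sup>2 * M\<^sup>2 / (32 * e)"
    proof -
      have "32 * e \<le> pi\<^sup>2 * d" using e(2) by (simp add: d_def field_simps)
      then have "M\<^sup>2 * (32 * e) \<le> M\<^sup>2 * (pi\<^sup>2 * d)" by (intro mult_left_mono) auto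
      then show ?thesis using d e by (simp add: field_simps)
    qed
    ultimately have "pi\<^sup>2 * M\<^sup>2 / (32 * e) \<le> j" by linarith
    then show ?thesis using real by (simp add: J_def ennreal_leI)
  qed
qed

end

section \<open>Distribution function and increasing rearrangement\<close>

lemma distr_fun_mono: "\<lbrakk>w \<in> borel_measurable borel; I \<in> sets borel; y \<le> y'\<rbrakk> \<Longrightarrow> distr_fun w I y \<le> distr_fun w I y'"
  unfolding distr_fun_def
  by (intro emeasure_mono) (auto dest: order_less_le_trans intro: ennreal_leI)

lemma distr_fun_measurable:
  assumes [measurable]: "w \<in> borel_measurable borel" "I \<in> sets borel"
  shows "distr_fun w I \<in> borel_measurable borel"
proof -
  have "distr_fun w I y = (\<integral>\<^sup>+x. (if x \<in> I \<and> w x < ennreal y then 1 else 0) \<partial>lborel)" for y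
  proof -
    have "distr_fun w I y = (\<integral>\<^sup>+x. indicator {x \<in> I. w x < ennreal y} x \<partial>lborel)"
      unfolding distr_fun_def by (rule nn_integral_indicator[symmetric]) measurable
    also have "\<dots> = (\<integral>\<^sup>+x. (if x \<in> I \<and> w x < ennreal y then 1 else 0) \<partial>lborel)"
      by (intro nn_integral_cong) (simp add: indicator_def)
    finally show ?thesis .
  qed
  moreover have "(\<lambda>y. \<integral>\<^sup>+x. (if x \<in> I \<and> w x < ennreal y then 1 else 0) \<partial>lborel) \<in> borel_measurable borel"
    by measurable
  ultimately show ?thesis by (simp add: fun_eq_iff[symmetric] cong: measurable_cong)
qed

text \<open>
  The divergence takes place at \<open>0\<close> only: where \<open>D\<close> is bounded below, its reciprocal has
  finite integral over bounded intervals.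
\<close>

lemma reciprocal_integral_shrink:
  fixes D :: "real \<Rightarrow> ennreal"
  assumes mono: "\<And>y y'. y \<le> y' \<Longrightarrow> D y \<le> D y'" and [measurable]: "D \<in> borel_measurable borel"
    and inf: "(\<integral>\<^sup>+y\<in>{0<..<\<delta>}. 1 / D y \<partial>lborel) = \<infinity>" and \<eta>: "0 < \<eta>"
  shows "\<exists>\<delta>'>0. D \<delta>' \<le> ennreal \<eta> \<and> (\<integral>\<^sup>+y\<in>{0<..<\<delta>'}. 1 / D y \<partial>lborel) = \<infinity>"
proof -
  have \<delta>: "0 < \<delta>"
  proof (rule ccontr)
    assume "\<not> 0 < \<delta>"
    then have "(\<integral>\<^sup>+y\<in>{0<..<\<delta>}. 1 / D y \<partial>lborel) = 0" by simp
    then show False using inf by simp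
  qed
  have fin: "(\<integral>\<^sup>+y\<in>{t<..<\<delta>}. 1 / D y \<partial>lborel) < \<infinity>" if c: "0 < c" "\<And>y. t < y \<Longrightarrow> y < \<delta> \<Longrightarrow> ennreal c \<le> D y" for t c
  proof -
    have "(\<integral>\<^sup>+y\<in>{t<..<\<delta>}. 1 / D y \<partial>lborel) \<le> (\<integral>\<^sup>+y. ennreal (1 / c) * indicator {t<..<\<delta>} y \<partial>lborel)"
    proof (rule nn_integral_mono)
      fix y
      have "1 / D y \<le> ennreal (1 / c)" if "t < y" "y < \<delta>"
      proof -
        show ?thesis
        proof (cases "D y")
          case (real r)
          then have "c \<le> r" using c(2)[OF that] by (simp add: ennreal_le_iff)
          then show ?thesis
            using real c(1) divide_ennreal[of 1 r] by (simp add: ennreal_leI frac_le)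
        qed simp
      qed
      then show "1 / D y * indicator {t<..<\<delta>} y \<le> ennreal (1 / c) * indicator {t<..<\<delta>} y"
        by (auto simp: indicator_def)
    qed
    also have "\<dots> = ennreal (1 / c) * emeasure lborel {t<..<\<delta>}"
      by (rule nn_integral_cmult_indicator) auto
    also have "\<dots> < \<infinity>" by (cases "t \<le> \<delta>") (auto simp: ennreal_mult_less_top)
    finally show ?thesis .
  qed
  have "\<exists>\<delta>'. 0 < \<delta>' \<and> \<delta>' < \<delta> \<and> D \<delta>' \<le> ennreal \<eta>"
  proof (rule ccontr)
    assume "\<not> ?thesis"
    then have "\<And>y. 0 < y \<Longrightarrow> y < \<delta> \<Longrightarrow> ennreal \<eta> \<le> D y" by (meson linear)
    then have "(\<integral>\<^sup>+y\<in>{0<..<\<delta>}. 1 / D y \<partial>lborel) < \<infinity>" by (intro fin[OF \<eta>])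
    then show False using inf by simp
  qed
  then obtain \<delta>' where \<delta>': "0 < \<delta>'" "\<delta>' < \<delta>" "D \<delta>' \<le> ennreal \<eta>" by blast
  have "(\<integral>\<^sup>+y\<in>{0<..<\<delta>'}. 1 / D y \<partial>lborel) = \<infinity>"
  proof (cases "D \<delta>' = 0")
    case True
    have "\<infinity> * indicator {0<..<\<delta>'} y \<le> 1 / D y * indicator {0<..<\<delta>'} y" for y
    proof (cases "y \<in> {0<..<\<delta>'}")
      case y: True
      then have "D y = 0" using mono[of y \<delta>'] True by simp
      then show ?thesis by (simp add: divide_ennreal_def)
    qed simp
    then have "(\<integral>\<^sup>+y. \<infinity> * indicator {0<..<\<delta>'} y \<partial>lborel) \<le> (\<integral>\<^sup>+y\<in>{0<..<\<delta>'}. 1 / D y \<partial>lborel)"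
      by (intro nn_integral_mono)
    moreover have "(\<integral>\<^sup>+y. \<infinity> * indicator {0<..<\<delta>'} y \<partial>lborel) = \<infinity> * emeasure lborel {0<..<\<delta>'}"
      by (rule nn_integral_cmult_indicator) auto
    ultimately show ?thesis using \<delta>' by (simp add: ennreal_top_mult top_unique)
  next
    case False
    define c where "c = enn2real (D \<delta>')"
    have "D \<delta>' \<noteq> top" using \<delta>'(3) by (metis ennreal_less_top leD top.not_eq_extremum)
    then have c: "D \<delta>' = ennreal c" by (simp add: c_def less_top)
    have c0: "0 < c" using False c by (metis ennreal_eq_0_iff linorder_not_less)
    have f: "(\<integral>\<^sup>+y\<in>{\<delta>'<..<\<delta>}. 1 / D y \<partial>lborel) < \<infinity>"
      by (rule fin[OF c0]) (use mono c in \<open>metis less_imp_le\<close>)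
    have "(\<integral>\<^sup>+y\<in>{0<..<\<delta>}. 1 / D y \<partial>lborel)
        = (\<integral>\<^sup>+y. 1 / D y * indicator {0<..<\<delta>'} y + 1 / D y * indicator {\<delta>'<..<\<delta>} y \<partial>lborel)"
    proof (rule nn_integral_cong_AE)
      have "AE y in lborel. y \<noteq> \<delta>'" by (rule AE_lborel_singleton)
      then show "AE y in lborel. 1 / D y * indicator {0<..<\<delta>} y = 1 / D y * indicator {0<..<\<delta>'} y + 1 / D y * indicator {\<delta>'<..<\<delta>} y"
        by eventually_elim (use \<delta>' in \<open>auto simp: indicator_def\<close>)
    qed
    also have "\<dots> = (\<integral>\<^sup>+y\<in>{0<..<\<delta>'}. 1 / D y \<partial>lborel) + (\<integral>\<^sup>+y\<in>{\<delta>'<..<\<delta>}. 1 / D y \<partial>lborel)"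
      by (rule nn_integral_add) measurable
    finally show ?thesis using f inf by (metis ennreal_add_eq_top infinity_ennreal_def less_irrefl)
  qed
  then show ?thesis using \<delta>' by blast
qed

text \<open>
  For \<open>d < \<epsilon>\<close> this is \<open>1/d - 1/\<epsilon>\<close>.  Only the bounds \<open>1 / (4 d)\<close> and \<open>1 / d\<close> below and above
  are used, together with its vanishing for \<open>d \<ge> \<epsilon>\<close>.
\<close>

definition truncated_reciprocal :: "real \<Rightarrow> ennreal \<Rightarrow> ennreal" where
  "truncated_reciprocal \<epsilon> d = (\<integral>\<^sup>+x\<in>{0<..<\<epsilon>}. ennreal (1 / x\<^sup>2) * (if d \<le> ennreal x then 1 else 0) \<partial>lborel)"

lemma truncated_reciprocal_le: "truncated_reciprocal \<epsilon> d \<le> 1 / d"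
proof (cases "d = 0 \<or> d = top")
  case True
  then show ?thesis
    by (auto simp: divide_ennreal_def truncated_reciprocal_def top_unique)
next
  case False
  then obtain r where r: "d = ennreal r" "0 < r"
    by (cases d) (auto simp: ennreal_eq_0_iff not_le)
  have "truncated_reciprocal \<epsilon> d \<le> (\<integral>\<^sup>+x\<in>{r..}. ennreal (1 / x\<^sup>2) \<partial>lborel)"
    unfolding truncated_reciprocal_def using r
    by (intro nn_integral_mono) (auto simp: indicator_def)
  also have "\<dots> = 1 / d" unfolding nn_integral_inverse_square_tail[OF r(2)] r(1) using r(2) divide_ennreal[of 1 r] by simp
  finally show ?thesis .
qed

lemma truncated_reciprocal_eq_0: "ennreal \<epsilon> \<le> d \<Longrightarrow> truncated_reciprocal \<epsilon> d = 0"
proof -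
  assume d: "ennreal \<epsilon> \<le> d"
  have "ennreal (1 / x\<^sup>2) * (if d \<le> ennreal x then 1 else 0) * indicator {0<..<\<epsilon>} x = 0" for x
  proof (cases "x \<in> {0<..<\<epsilon>}")
    case True
    then have "ennreal x < ennreal \<epsilon>" by (simp add: ennreal_lessI)
    then have "\<not> d \<le> ennreal x" using d by (meson leD order_trans)
    then show ?thesis by simp
  qed simp
  then show ?thesis unfolding truncated_reciprocal_def by (simp only: nn_integral_const mult_zero_left)
qed

text \<open>
  The interval \<open>(r, 2 r)\<close> alone contributes this much.  The parameter \<open>r\<close> is kept apart
  from \<open>d\<close> for the sake of \<open>d = 0\<close>, where \<open>r\<close> tends to \<open>0\<close>.
\<close>

lemma truncated_reciprocal_ge_aux:
  assumes "0 < r" "r \<le> \<epsilon> / 2" "d \<le> ennreal r"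
  shows "ennreal (1 / (4 * r)) \<le> truncated_reciprocal \<epsilon> d"
proof -
  have "ennreal (1 / (4 * r)) = ennreal (1 / (2 * r)\<^sup>2) * emeasure lborel {r<..<2 * r}"
    using assms by (simp add: ennreal_mult[symmetric] power2_eq_square)
  also have "\<dots> = (\<integral>\<^sup>+x. ennreal (1 / (2 * r)\<^sup>2) * indicator {r<..<2 * r} x \<partial>lborel)"
    by (rule nn_integral_cmult_indicator[symmetric]) auto
  also have "\<dots> \<le> truncated_reciprocal \<epsilon> d"
    unfolding truncated_reciprocal_def
  proof (rule nn_integral_mono)
    fix x
    show "ennreal (1 / (2 * r)\<^sup>2) * indicator {r<..<2 * r} x \<le> ennreal (1 / x\<^sup>2) * (if d \<le> ennreal x then 1 else 0) * indicator {0<..<\<epsilon>} x"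
    proof (cases "x \<in> {r<..<2 * r}")
      case True
      then have "1 / (2 * r)\<^sup>2 \<le> 1 / x\<^sup>2" using assms(1) by (intro frac_le power_mono) auto
      moreover have "d \<le> ennreal x" using assms(3) True by (meson ennreal_leI greaterThanLessThan_iff less_imp_le order_trans)
      moreover have "x \<in> {0<..<\<epsilon>}" using True assms by auto
      ultimately show ?thesis using True by (simp add: ennreal_leI)
    qed simp
  qed
  finally show ?thesis .
qed

lemma truncated_reciprocal_ge:
  assumes d: "d \<le> ennreal (\<epsilon> / 2)" and \<epsilon>: "0 < \<epsilon>"
  shows "ennreal (1 / 4) * (1 / d) \<le> truncated_reciprocal \<epsilon> d"
proof (cases "d = 0")
  case True
  have "ennreal x \<le> truncated_reciprocal \<epsilon> d" for x
  proof -
    define r where "r = min (\<epsilon> / 2) (1 / (4 * (\<bar>x\<bar> + 1)))"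
    have r: "0 < r" "r \<le> \<epsilon> / 2" "r \<le> 1 / (4 * (\<bar>x\<bar> + 1))" using \<epsilon> by (auto simp: r_def)
    have "1 / (4 * (1 / (4 * (\<bar>x\<bar> + 1)))) \<le> 1 / (4 * r)"
      using r by (intro frac_le mult_left_mono mult_pos_pos) auto
    then have "x \<le> 1 / (4 * r)" by (simp only: times_divide_eq_right) simp
    then show ?thesis using truncated_reciprocal_ge_aux[OF r(1,2), of d] True
      by (meson ennreal_leI order_trans zero_le)
  qed
  have "truncated_reciprocal \<epsilon> d = top"
  proof (cases "truncated_reciprocal \<epsilon> d")
    case (real t)
    have "ennreal (t + 1) \<le> ennreal t"
      using \<open>\<And>x. ennreal x \<le> truncated_reciprocal \<epsilon> d\<close>[of "t + 1"] real by simp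
    then show ?thesis using real by (simp add: ennreal_le_iff)
  qed
  then show ?thesis by simp
next
  case False
  have "d \<noteq> top" using d by (metis ennreal_less_top leD top.not_eq_extremum)
  then obtain r where r: "d = ennreal r" "0 < r"
    using False by (cases d) (auto simp: ennreal_eq_0_iff not_le)
  have "r \<le> \<epsilon> / 2" using d r \<epsilon> by (simp add: ennreal_le_iff)
  then have "ennreal (1 / (4 * r)) \<le> truncated_reciprocal \<epsilon> d"
    using truncated_reciprocal_ge_aux[OF r(2)] r(1) by blast
  moreover have "ennreal (1 / 4) * (1 / d) = ennreal (1 / (4 * r))"
    using r divide_ennreal[of 1 r] by (simp add: ennreal_mult[symmetric])
  ultimately show ?thesis by simp
qed

text \<open>
  The sets \<open>{t \<in> I. w t < n}\<close> exhaust \<open>I\<close> up to a null set.  So the infimum defining the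
  rearrangement is over a nonempty set.
\<close>

lemma distr_fun_exceeds:
  assumes w[measurable]: "w \<in> borel_measurable borel" and I[measurable]: "I \<in> sets borel"
    and fin: "AE x in lborel. x \<in> I \<longrightarrow> w x < \<infinity>" and x: "ennreal x < emeasure lborel I"
  shows "\<exists>y\<ge>0. ennreal x < distr_fun w I y"
proof -
  have "(SUP n. distr_fun w I (real n)) = emeasure lborel (\<Union>n. {t \<in> I. w t < ennreal (real n)})"
    unfolding distr_fun_def
  proof (rule SUP_emeasure_incseq)
    show "incseq (\<lambda>n. {t \<in> I. w t < ennreal (real n)})"
    proof (intro monoI subsetI)
      fix m n :: nat and t assume "m \<le> n" "t \<in> {t \<in> I. w t < ennreal (real m)}"
      moreover have "ennreal (real m) \<le> ennreal (real n)" using \<open>m \<le> n\<close> by (intro ennreal_leI) simp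
      ultimately show "t \<in> {t \<in> I. w t < ennreal (real n)}" using order_less_le_trans by blast
    qed
  qed auto
  also have "(\<Union>n. {t \<in> I. w t < ennreal (real n)}) = {t \<in> I. w t < \<infinity>}"
  proof (intro set_eqI iffI)
    fix t assume "t \<in> {t \<in> I. w t < \<infinity>}"
    then have t: "t \<in> I" "w t < \<infinity>" by auto
    obtain n where "enn2real (w t) < real n" using reals_Archimedean2 by blast
    then have "w t < ennreal (real n)" using t(2)
      by (metis ennreal_enn2real ennreal_lessI enn2real_nonneg infinity_ennreal_def order_le_less_trans)
    then show "t \<in> (\<Union>n. {t \<in> I. w t < ennreal (real n)})" using t by auto
  qed (auto dest: order_less_trans[OF _ ennreal_less_top])
  also have "emeasure lborel {t \<in> I. w t < \<infinity>} = emeasure lborel I"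
    by (rule emeasure_eq_AE) (use fin in auto)
  finally have "ennreal x < (SUP n. distr_fun w I (real n))" using x by simp
  then show ?thesis unfolding less_SUP_iff by (metis of_nat_0_le_iff)
qed

text \<open>
  As a generalized inverse of the monotone function \<open>D\<^sub>w\<close>, \<open>w*(x)\<close> separates the levels \<open>y\<close> with
  \<open>D\<^sub>w(y) \<le> x\<close> from the others.
\<close>

lemma incr_rearr_layer_cake:
  assumes w: "w \<in> borel_measurable borel" and I: "I \<in> sets borel"
    and ne: "\<exists>y\<ge>0. ennreal x < distr_fun w I y"
  shows "0 \<le> incr_rearr w I x"
    and "ennreal (incr_rearr w I x) = (\<integral>\<^sup>+y\<in>{0<..}. (if distr_fun w I y \<le> ennreal x then 1 else 0) \<partial>lborel)"
proof -
  let ?S = "{y. 0 \<le> y \<and> distr_fun w I y > ennreal x}"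
  let ?W = "incr_rearr w I x"
  have ne': "?S \<noteq> {}" using ne by auto
  have bdd: "bdd_below ?S" by (rule bdd_belowI[of _ 0]) auto
  show W0: "0 \<le> ?W" unfolding incr_rearr_def by (rule cInf_greatest[OF ne']) auto
  have below: "distr_fun w I y \<le> ennreal x" if "0 \<le> y" "y < ?W" for y
  proof (rule ccontr)
    assume "\<not> ?thesis"
    then have "y \<in> ?S" using that by auto
    then have "?W \<le> y" unfolding incr_rearr_def by (rule cInf_lower[OF _ bdd])
    then show False using that by simp
  qed
  have above: "y \<le> ?W" if "distr_fun w I y \<le> ennreal x" for y
    unfolding incr_rearr_def
  proof (rule cInf_greatest[OF ne'])
    fix y' assume "y' \<in> ?S"
    then have "distr_fun w I y < distr_fun w I y'" using that by auto
    then show "y \<le> y'" using distr_fun_mono[OF w I, of y' y] by (meson leD linear)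
  qed
  show "ennreal ?W = (\<integral>\<^sup>+y\<in>{0<..}. (if distr_fun w I y \<le> ennreal x then 1 else 0) \<partial>lborel)"
  proof (rule antisym)
    have "ennreal ?W = (\<integral>\<^sup>+y. indicator {0<..<?W} y \<partial>lborel)" using W0 by simp
    also have "\<dots> \<le> (\<integral>\<^sup>+y\<in>{0<..}. (if distr_fun w I y \<le> ennreal x then 1 else 0) \<partial>lborel)"
      using below by (intro nn_integral_mono) (auto simp: indicator_def)
    finally show "ennreal ?W \<le> (\<integral>\<^sup>+y\<in>{0<..}. (if distr_fun w I y \<le> ennreal x then 1 else 0) \<partial>lborel)" .
    have "(\<integral>\<^sup>+y\<in>{0<..}. (if distr_fun w I y \<le> ennreal x then 1 else 0) \<partial>lborel) \<le> (\<integral>\<^sup>+y. indicator {0<..?W} y \<partial>lborel)"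
      using above by (intro nn_integral_mono) (auto simp: indicator_def)
    also have "\<dots> = ennreal ?W" using W0 by simp
    finally show "(\<integral>\<^sup>+y\<in>{0<..}. (if distr_fun w I y \<le> ennreal x then 1 else 0) \<partial>lborel) \<le> ennreal ?W" .
  qed
qed

text \<open>
  Integrate the layer cake formula for \<open>w*(x)\<close> against \<open>1 / x\<^sup>2\<close> and exchange the order of integration.
\<close>

lemma incr_rearr_integral:
  assumes w: "w \<in> borel_measurable borel" and I: "I \<in> sets borel"
    and fin: "AE x in lborel. x \<in> I \<longrightarrow> w x < \<infinity>" and \<epsilon>: "ennreal \<epsilon> \<le> emeasure lborel I"
  shows "(\<integral>\<^sup>+x\<in>{0<..<\<epsilon>}. ennreal (incr_rearr w I x / x\<^sup>2) \<partial>lborel)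
       = (\<integral>\<^sup>+y\<in>{0<..}. truncated_reciprocal \<epsilon> (distr_fun w I y) \<partial>lborel)"
proof -
  note D[measurable] = distr_fun_measurable[OF w I]
  let ?c = "\<lambda>x y. (if distr_fun w I y \<le> ennreal x then 1 else 0) :: ennreal"
  have "(\<integral>\<^sup>+x\<in>{0<..<\<epsilon>}. ennreal (incr_rearr w I x / x\<^sup>2) \<partial>lborel)
      = (\<integral>\<^sup>+x. \<integral>\<^sup>+y. ennreal (1 / x\<^sup>2) * ?c x y * indicator {0<..<\<epsilon>} x * indicator {0<..} y \<partial>lborel \<partial>lborel)"
  proof (rule nn_integral_cong)
    fix x
    show "ennreal (incr_rearr w I x / x\<^sup>2) * indicator {0<..<\<epsilon>} x
        = (\<integral>\<^sup>+y. ennreal (1 / x\<^sup>2) * ?c x y * indicator {0<..<\<epsilon>} x * indicator {0<..} y \<partial>lborel)"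
    proof (cases "x \<in> {0<..<\<epsilon>}")
      case True
      then have "ennreal x < emeasure lborel I" using \<epsilon> by (metis ennreal_lessI greaterThanLessThan_iff order_less_le_trans order_less_trans)
      note ne = distr_fun_exceeds[OF w I fin this]
      have "ennreal (incr_rearr w I x / x\<^sup>2) = ennreal (1 / x\<^sup>2) * ennreal (incr_rearr w I x)"
        using incr_rearr_layer_cake(1)[OF w I ne] by (simp add: ennreal_mult[symmetric])
      also have "\<dots> = (\<integral>\<^sup>+y. ennreal (1 / x\<^sup>2) * (?c x y * indicator {0<..} y) \<partial>lborel)"
        unfolding incr_rearr_layer_cake(2)[OF w I ne] by (rule nn_integral_cmult[symmetric]) measurable
      finally show ?thesis using True by (simp add: mult.assoc)
    qed simp
  qed
  also have "\<dots> = (\<integral>\<^sup>+y. \<integral>\<^sup>+x. ennreal (1 / x\<^sup>2) * ?c x y * indicator {0<..<\<epsilon>} x * indicator {0<..} y \<partial>lborel \<partial>lborel)"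
    by (rule lborel_pair.Fubini'[symmetric]) measurable
  also have "\<dots> = (\<integral>\<^sup>+y\<in>{0<..}. truncated_reciprocal \<epsilon> (distr_fun w I y) \<partial>lborel)"
    unfolding truncated_reciprocal_def
    by (intro nn_integral_cong nn_integral_multc) measurable
  finally show ?thesis .
qed

text \<open>
  By \<open>incr_rearr_integral\<close> both conditions concern integrals in \<open>y\<close>, of \<open>1 / D\<^sub>w\<close> and of its
  truncation.  These are comparable as long as \<open>D\<^sub>w\<close> is below \<open>\<epsilon> / 2\<close>, that is near \<open>0\<close>, and
  the truncation vanishes for large \<open>y\<close>, where \<open>D\<^sub>w\<close> exceeds \<open>\<epsilon>\<close>.
\<close>

lemma divergence_iff:
  assumes w: "w \<in> borel_measurable borel" and ab: "a < b"
    and fin: "AE x in lborel. x \<in> {a..b} \<longrightarrow> w x < \<infinity>"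
  shows "(\<exists>\<delta>>0. (\<integral>\<^sup>+ y\<in>{0<..<\<delta>}. 1 / distr_fun w {a..b} y \<partial>lborel) = \<infinity>)
            \<longleftrightarrow> (\<exists>\<epsilon>>0. \<epsilon> < b - a \<and>
                  (\<integral>\<^sup>+ x\<in>{0<..<\<epsilon>}. ennreal (incr_rearr w {a..b} x / x\<^sup>2) \<partial>lborel) = \<infinity>)"
proof -
  let ?D = "distr_fun w {a..b}"
  have I: "{a..b} \<in> sets borel" by simp
  note D[measurable] = distr_fun_measurable[OF w I]
  have len: "emeasure lborel {a..b} = ennreal (b - a)" using ab by simp
  show ?thesis
  proof
    assume "\<exists>\<delta>>0. (\<integral>\<^sup>+ y\<in>{0<..<\<delta>}. 1 / ?D y \<partial>lborel) = \<infinity>"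
    then obtain \<delta> where \<delta>: "(\<integral>\<^sup>+ y\<in>{0<..<\<delta>}. 1 / ?D y \<partial>lborel) = \<infinity>" by blast
    \<comment> \<open>Every \<open>\<epsilon>\<close> below the length of the interval would do.\<close>
    define \<epsilon> where "\<epsilon> = (b - a) / 2"
    have \<epsilon>: "0 < \<epsilon>" "\<epsilon> < b - a" using ab by (auto simp: \<epsilon>_def)
    have "0 < \<epsilon> / 2" using \<epsilon> by simp
    from reciprocal_integral_shrink[OF distr_fun_mono[OF w I] D \<delta> this]
    obtain \<delta>' where \<delta>': "?D \<delta>' \<le> ennreal (\<epsilon> / 2)" "(\<integral>\<^sup>+ y\<in>{0<..<\<delta>'}. 1 / ?D y \<partial>lborel) = \<infinity>" by blast
    have "ennreal (1 / 4) * (\<integral>\<^sup>+ y\<in>{0<..<\<delta>'}. 1 / ?D y \<partial>lborel) = (\<integral>\<^sup>+ y. ennreal (1 / 4) * (1 / ?D y * indicator {0<..<\<delta>'} y) \<partial>lborel)"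
      by (rule nn_integral_cmult[symmetric]) measurable
    also have "\<dots> \<le> (\<integral>\<^sup>+y\<in>{0<..}. truncated_reciprocal \<epsilon> (?D y) \<partial>lborel)"
    proof (rule nn_integral_mono)
      fix y
      show "ennreal (1 / 4) * (1 / ?D y * indicator {0<..<\<delta>'} y) \<le> truncated_reciprocal \<epsilon> (?D y) * indicator {0<..} y"
      proof (cases "y \<in> {0<..<\<delta>'}")
        case True
        then have "?D y \<le> ennreal (\<epsilon> / 2)" using distr_fun_mono[OF w I, of y \<delta>'] \<delta>'(1) by auto
        then show ?thesis using truncated_reciprocal_ge[OF _ \<epsilon>(1)] True by simp
      qed simp
    qed
    also have "\<dots> = (\<integral>\<^sup>+ x\<in>{0<..<\<epsilon>}. ennreal (incr_rearr w {a..b} x / x\<^sup>2) \<partial>lborel)"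
      using incr_rearr_integral[OF w I fin] \<epsilon> len by (simp add: ennreal_leI)
    finally have "(\<integral>\<^sup>+ x\<in>{0<..<\<epsilon>}. ennreal (incr_rearr w {a..b} x / x\<^sup>2) \<partial>lborel) = \<infinity>"
      unfolding \<delta>'(2) by (simp add: ennreal_mult_top top_unique)
    then show "\<exists>\<epsilon>>0. \<epsilon> < b - a \<and> (\<integral>\<^sup>+ x\<in>{0<..<\<epsilon>}. ennreal (incr_rearr w {a..b} x / x\<^sup>2) \<partial>lborel) = \<infinity>"
      using \<epsilon> by blast
  next
    assume "\<exists>\<epsilon>>0. \<epsilon> < b - a \<and> (\<integral>\<^sup>+ x\<in>{0<..<\<epsilon>}. ennreal (incr_rearr w {a..b} x / x\<^sup>2) \<partial>lborel) = \<infinity>"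
    then obtain \<epsilon> where \<epsilon>: "0 < \<epsilon>" "\<epsilon> < b - a"
      and inf: "(\<integral>\<^sup>+ x\<in>{0<..<\<epsilon>}. ennreal (incr_rearr w {a..b} x / x\<^sup>2) \<partial>lborel) = \<infinity>" by blast
    have "ennreal \<epsilon> < emeasure lborel {a..b}" unfolding len using \<epsilon> by (intro ennreal_lessI) auto
    from distr_fun_exceeds[OF w I fin this] obtain Y where Y: "0 \<le> Y" "ennreal \<epsilon> < ?D Y" by blast
    have "\<infinity> = (\<integral>\<^sup>+y\<in>{0<..}. truncated_reciprocal \<epsilon> (?D y) \<partial>lborel)"
      using incr_rearr_integral[OF w I fin] \<epsilon> len inf by (simp add: ennreal_leI)
    also have "\<dots> \<le> (\<integral>\<^sup>+ y\<in>{0<..<Y + 1}. 1 / ?D y \<partial>lborel)"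
    proof (rule nn_integral_mono)
      fix y
      show "truncated_reciprocal \<epsilon> (?D y) * indicator {0<..} y \<le> 1 / ?D y * indicator {0<..<Y + 1} y"
      proof (cases "y < Y + 1")
        case True
        then show ?thesis using truncated_reciprocal_le by (simp add: indicator_def)
      next
        case False
        then have "ennreal \<epsilon> \<le> ?D y" using distr_fun_mono[OF w I, of Y y] Y(2) by (meson add_increasing2 less_imp_le linorder_not_less order_trans zero_le_one not_less)
        then show ?thesis by (simp add: truncated_reciprocal_eq_0)
      qed
    qed
    finally have "(\<integral>\<^sup>+ y\<in>{0<..<Y + 1}. 1 / ?D y \<partial>lborel) = \<infinity>" by (simp add: top_unique)
    then show "\<exists>\<delta>>0. (\<integral>\<^sup>+ y\<in>{0<..<\<delta>}. 1 / ?D y \<partial>lborel) = \<infinity>"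
      using Y(1) by (intro exI[of _ "Y + 1"]) auto
  qed
qed

section \<open>Divergence against a weight\<close>

context compactly_carried_measure
begin

text \<open>
  Integrate the lower bound for the set \<open>{w < v}\<close>, whose measure is \<open>D\<^sub>w(v)\<close>, over small levels \<open>v\<close>.
\<close>

lemma weighted_G_square_infinite:
  assumes w[measurable]: "w \<in> borel_measurable borel"
    and ab: "a < b" and KI: "K \<subseteq> {a..b}" and half: "K \<subseteq> {..(a + b) / 2} \<or> K \<subseteq> {(a + b) / 2..}"
    and null: "emeasure lborel K = 0" and M: "0 < M"
    and inf: "(\<integral>\<^sup>+y\<in>{0<..<\<delta>}. 1 / distr_fun w {a..b} y \<partial>lborel) = \<infinity>"
  shows "(\<integral>\<^sup>+x\<in>{a..b} - K. ennreal ((G x)\<^sup>2) * w x \<partial>lborel) = \<infinity>"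
proof -
  let ?D = "distr_fun w {a..b}"
  let ?I = "{a..b} - K"
  have I: "{a..b} \<in> sets borel" by simp
  note [measurable] = G_measurable K_borel distr_fun_measurable[OF w I]
  define \<eta> where "\<eta> = (b - a) * pi\<^sup>2 / 64"
  have \<eta>: "0 < \<eta>" using ab by (simp add: \<eta>_def)
  define c where "c = pi\<^sup>2 * M\<^sup>2 / 32"
  have c: "0 < c" using M by (simp add: c_def)
  from reciprocal_integral_shrink[OF distr_fun_mono[OF w I] distr_fun_measurable[OF w I] inf \<eta>]
  obtain \<delta>' where \<delta>': "?D \<delta>' \<le> ennreal \<eta>" "(\<integral>\<^sup>+y\<in>{0<..<\<delta>'}. 1 / ?D y \<partial>lborel) = \<infinity>" by blast
  define J where "J = (\<lambda>v. \<integral>\<^sup>+x\<in>?I. ennreal ((G x)\<^sup>2) * (if ennreal v \<le> w x then 1 else 0) \<partial>lborel)"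
  have J: "ennreal c * (1 / ?D v) \<le> J v" if v: "v \<in> {0<..<\<delta>'}" for v
  proof -
    define E where "E = {x \<in> {a..b}. w x < ennreal v}"
    have E: "E \<in> sets borel" unfolding E_def by measurable
    have DE: "?D v = emeasure lborel E" by (simp add: distr_fun_def E_def)
    have D\<eta>: "?D v \<le> ennreal \<eta>"
      using distr_fun_mono[OF w I, of v \<delta>'] \<delta>'(1) v by auto
    have JE: "J v = (\<integral>\<^sup>+x\<in>{a..b} - K - E. ennreal ((G x)\<^sup>2) \<partial>lborel)"
      unfolding J_def E_def by (intro nn_integral_cong) (auto simp: indicator_def not_less)
    have low: "ennreal (c / e) \<le> J v" if "0 < e" "e \<le> \<eta>" "?D v \<le> ennreal e" for e
      using G_square_lower_bound[OF ab KI half null M E, of e] that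
      unfolding JE DE \<eta>_def c_def by (simp add: mult.commute)
    show ?thesis
    proof (cases "?D v = 0")
      case True
      have "J v = top"
      proof (cases "J v")
        case (real j)
        define e where "e = min \<eta> (c / (j + 1))"
        have j: "0 < j + 1" using real by simp
        have e: "0 < e" "e \<le> \<eta>" "e \<le> c / (j + 1)" using \<eta> c j by (auto simp: e_def)
        have "e * (j + 1) \<le> c" using e(3) j by (simp add: pos_le_divide_eq)
        then have "j + 1 \<le> c / e" using e(1) by (simp add: pos_le_divide_eq mult.commute)
        then have "ennreal (j + 1) \<le> ennreal j" using low[OF e(1,2)] True real
          by (metis ennreal_leI order_trans zero_le)
        then show ?thesis using real by (simp add: ennreal_le_iff)
      qed
      then show ?thesis by simp
    next
      case False
      have "?D v \<noteq> top" using D\<eta> by (metis ennreal_less_top leD top.not_eq_extremum)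
      then obtain r where r: "?D v = ennreal r" "0 < r"
        using False by (cases "?D v") (auto simp: ennreal_eq_0_iff not_le)
      have "r \<le> \<eta>" using D\<eta> r \<eta> by (simp add: ennreal_le_iff)
      then have "ennreal (c / r) \<le> J v" using low[OF r(2)] r(1) by simp
      moreover have "ennreal c * (1 / ?D v) = ennreal (c / r)"
        using r c divide_ennreal[of 1 r] by (simp add: ennreal_mult[symmetric])
      ultimately show ?thesis by simp
    qed
  qed
  have "ennreal c * (\<integral>\<^sup>+y\<in>{0<..<\<delta>'}. 1 / ?D y \<partial>lborel) = (\<integral>\<^sup>+y. ennreal c * (1 / ?D y * indicator {0<..<\<delta>'} y) \<partial>lborel)"
    by (rule nn_integral_cmult[symmetric]) measurable
  also have "\<dots> \<le> (\<integral>\<^sup>+v. J v * indicator {0<..<\<delta>'} v \<partial>lborel)"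
    using J by (intro nn_integral_mono) (simp add: indicator_def)
  also have "\<dots> = (\<integral>\<^sup>+v. \<integral>\<^sup>+x. ennreal ((G x)\<^sup>2) * (if ennreal v \<le> w x then 1 else 0) * indicator ?I x * indicator {0<..<\<delta>'} v \<partial>lborel \<partial>lborel)"
    unfolding J_def by (intro nn_integral_cong nn_integral_multc[symmetric]) measurable
  also have "\<dots> = (\<integral>\<^sup>+x. \<integral>\<^sup>+v. ennreal ((G x)\<^sup>2) * (if ennreal v \<le> w x then 1 else 0) * indicator ?I x * indicator {0<..<\<delta>'} v \<partial>lborel \<partial>lborel)"
    by (rule lborel_pair.Fubini') measurable
  also have "\<dots> \<le> (\<integral>\<^sup>+x\<in>?I. ennreal ((G x)\<^sup>2) * w x \<partial>lborel)"
  proof (rule nn_integral_mono)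
    fix x
    have "(\<integral>\<^sup>+v. ennreal ((G x)\<^sup>2) * (if ennreal v \<le> w x then 1 else 0) * indicator ?I x * indicator {0<..<\<delta>'} v \<partial>lborel)
        = (\<integral>\<^sup>+v. (ennreal ((G x)\<^sup>2) * indicator ?I x) * ((if ennreal v \<le> w x then 1 else 0) * indicator {0<..<\<delta>'} v) \<partial>lborel)"
      by (intro nn_integral_cong) (simp add: mult_ac)
    also have "\<dots> = (ennreal ((G x)\<^sup>2) * indicator ?I x) * (\<integral>\<^sup>+v. (if ennreal v \<le> w x then 1 else 0) * indicator {0<..<\<delta>'} v \<partial>lborel)"
      by (rule nn_integral_cmult) measurable
    also have "\<dots> \<le> (ennreal ((G x)\<^sup>2) * indicator ?I x) * w x"
    proof (rule mult_left_mono)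
      show "(\<integral>\<^sup>+v. (if ennreal v \<le> w x then 1 else 0) * indicator {0<..<\<delta>'} v \<partial>lborel) \<le> w x"
    proof (cases "w x")
      case (real r)
      have "(\<integral>\<^sup>+v. (if ennreal v \<le> w x then 1 else 0) * indicator {0<..<\<delta>'} v \<partial>lborel) \<le> (\<integral>\<^sup>+v. indicator {0<..r} v \<partial>lborel)"
        using real by (intro nn_integral_mono) (auto simp: indicator_def ennreal_le_iff)
      also have "\<dots> = w x" using real by simp
      finally show ?thesis .
    qed simp
    qed simp
    finally show "(\<integral>\<^sup>+v. ennreal ((G x)\<^sup>2) * (if ennreal v \<le> w x then 1 else 0) * indicator ?I x * indicator {0<..<\<delta>'} v \<partial>lborel)
        \<le> ennreal ((G x)\<^sup>2) * w x * indicator ?I x"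
      by (simp only: mult_ac)
  qed
  finally show ?thesis
    unfolding \<delta>'(2) using c by (simp add: ennreal_mult_top top_unique)
qed

end

section \<open>Spectral measures of rank one perturbations\<close>

lemma transformable_restriction:
  assumes \<nu>: "transformable \<nu>" and S: "S \<in> sets borel"
  shows "transformable (density \<nu> (\<lambda>s. ennreal (indicator S s)))"
    and "0 < Im z \<Longrightarrow> borel_transform (density \<nu> (\<lambda>s. ennreal (indicator S s))) z
      = (\<integral>s. indicator S s *\<^sub>R (1 / (complex_of_real s - z)) \<partial>\<nu>)"
proof -
  have [measurable]: "(indicator S :: real \<Rightarrow> real) \<in> borel_measurable \<nu>"
    by (rule transformable_measurable[OF \<nu>]) (use S in simp)
  show "transformable (density \<nu> (\<lambda>s. ennreal (indicator S s)))"
    unfolding transformable_def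
  proof
    show "sets (density \<nu> (\<lambda>s. ennreal (indicator S s))) = sets borel"
      using transformable_sets[OF \<nu>] by simp
    have g: "(\<lambda>t::real. 1 / (1 + \<bar>t\<bar>)) \<in> borel_measurable \<nu>"
      by (rule transformable_measurable[OF \<nu>]) measurable
    have "integrable \<nu> (\<lambda>t. indicator S t *\<^sub>R (1 / (1 + \<bar>t\<bar>)) :: real)"
      using \<nu> S transformable_sets[OF \<nu>] by (intro integrable_mult_indicator) (auto simp: transformable_def)
    then show "integrable (density \<nu> (\<lambda>s. ennreal (indicator S s))) (\<lambda>t. 1 / (1 + \<bar>t\<bar>))"
      by (subst integrable_density[OF g]) auto
  qed
  show "borel_transform (density \<nu> (\<lambda>s. ennreal (indicator S s))) z
      = (\<integral>s. indicator S s *\<^sub>R (1 / (complex_of_real s - z)) \<partial>\<nu>)"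
    unfolding borel_transform_def
    by (rule integral_density) (auto intro: transformable_measurable[OF \<nu> resolvent_kernel_measurable])
qed

lemma borel_transform_split:
  assumes \<nu>: "transformable \<nu>" and S: "S \<in> sets borel" and z: "0 < Im z"
  shows "borel_transform (density \<nu> (\<lambda>s. ennreal (indicator S s))) z
      + borel_transform (density \<nu> (\<lambda>s. ennreal (indicator (- S) s))) z = borel_transform \<nu> z"
proof -
  have S': "- S \<in> sets borel" using S by auto
  have I: "integrable \<nu> (\<lambda>s. indicator T s *\<^sub>R (1 / (complex_of_real s - z)))" if "T \<in> sets borel" for T
    using that transformable_sets[OF \<nu>] by (intro integrable_mult_indicator integrable_resolvent_kernel[OF \<nu> z]) auto
  show ?thesis
    unfolding transformable_restriction(2)[OF \<nu> S z] transformable_restriction(2)[OF \<nu> S' z]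
      Bochner_Integration.integral_add[OF I[OF S] I[OF S'], symmetric]
    unfolding borel_transform_def
    by (intro Bochner_Integration.integral_cong) (auto simp: indicator_def)
qed

text \<open>
  The resolvent formula for \<open>f = 1\<close> gives \<open>(1 + \<alpha> F)\<^sup>-\<^sup>1 / (t - z)\<close>, whose inner product with
  \<open>1\<close> is \<open>F / (1 + \<alpha> F)\<close>.
\<close>

lemma spectral_measure_transform:
  assumes \<mu>: "transformable \<mu>" and T: "rank_one_perturbation \<mu> \<alpha> T"
    and \<nu>: "is_spectral_measure \<mu> T (\<lambda>t. 1) \<nu>" and z: "0 < Im z"
  shows "borel_transform \<nu> z * (1 + of_real \<alpha> * borel_transform \<mu> z) = borel_transform \<mu> z"
proof -
  let ?F = "borel_transform \<mu> z"
  let ?N = "1 + of_real \<alpha> * ?F"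
  have zR: "z \<notin> \<real>" by (rule Im_pos_imp_nonreal[OF z])
  have \<mu>': "sets \<mu> = sets borel" "integrable \<mu> (\<lambda>t. 1 / (1 + \<bar>t\<bar>))"
    using \<mu> by (auto simp: transformable_def)
  obtain u where u: "resolvent_at \<mu> T z (\<lambda>t. 1) u" "borel_transform \<nu> z = l2_inner \<mu> u (\<lambda>t. 1)"
    using \<nu> zR unfolding is_spectral_measure_def borel_transform_def by blast
  have "\<exists>a. resolvent_at \<mu> (mult_op \<mu>) z (\<lambda>t. 1) a \<and>
          (AE t in \<mu>. u t = a t - of_real \<alpha> * ?F / ?N * (1 / (of_real t - z)))"
    using T zR u(1) unfolding rank_one_perturbation_def borel_transform_def by blast
  then obtain a where a: "resolvent_at \<mu> (mult_op \<mu>) z (\<lambda>t. 1) a"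
    and ua: "AE t in \<mu>. u t = a t - of_real \<alpha> * ?F / ?N * (1 / (of_real t - z))" by blast
  have "AE t in \<mu>. a t = 1 / (of_real t - z)"
    using a resolvent_at_mult_op[OF \<mu>' zR, of "\<lambda>t. 1" a] by simp
  with ua have ae: "AE t in \<mu>. u t * cnj 1 = (1 - of_real \<alpha> * ?F / ?N) * (1 / (of_real t - z))"
    by eventually_elim (simp add: algebra_simps)
  have um: "u \<in> borel_measurable \<mu>" using u(1) by (simp add: resolvent_at_def L2_def)
  note km[measurable] = transformable_measurable[OF \<mu> resolvent_kernel_measurable[of z]]
  have "l2_inner \<mu> u (\<lambda>t. 1) = (\<integral>t. (1 - of_real \<alpha> * ?F / ?N) * (1 / (of_real t - z)) \<partial>\<mu>)"
    unfolding l2_inner_def using um by (intro integral_cong_AE[OF _ _ ae]) (simp, measurable)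
  also have "\<dots> = (1 - of_real \<alpha> * ?F / ?N) * ?F"
    by (simp only: Bochner_Integration.integral_mult_right_zero borel_transform_def)
  finally have "borel_transform \<nu> z = (1 - of_real \<alpha> * ?F / ?N) * ?F" using u(2) by simp
  moreover have "?N \<noteq> 0" by (rule one_plus_borel_transform_nonzero[OF \<mu> z])
  ultimately show ?thesis by (simp add: field_simps)
qed

text \<open>
  Inner regularity of the finite restriction of \<open>\<nu>\<close> to \<open>S\<close>, applied to the part of \<open>S\<close> in a null
  set that carries the singular part.
\<close>

lemma compact_null_set_of_positive_measure:
  assumes \<nu>: "transformable \<nu>" and dec: "lebesgue_decomposition \<nu> v \<nu>s"
    and S: "S \<in> sets borel" "bounded S" and pos: "emeasure \<nu>s S \<noteq> 0"
  shows "\<exists>K. compact K \<and> K \<subseteq> S \<and> emeasure lborel K = 0 \<and> emeasure \<nu> K \<noteq> 0"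
proof -
  obtain N where N: "N \<in> sets borel" "emeasure lborel N = 0" "emeasure \<nu>s (- N) = 0"
    using dec by (auto simp: lebesgue_decomposition_def)
  have sets_s: "sets \<nu>s = sets borel" using dec by (simp add: lebesgue_decomposition_def)
  have sum: "emeasure \<nu> B = emeasure (density lborel v) B + emeasure \<nu>s B" if "B \<in> sets borel" for B
    using dec that by (simp add: lebesgue_decomposition_def)
  have "emeasure \<nu>s S \<le> emeasure \<nu>s (S \<inter> N) + emeasure \<nu>s (- N)"
  proof -
    have "emeasure \<nu>s S \<le> emeasure \<nu>s ((S \<inter> N) \<union> (- N))"
      using S N sets_s by (intro emeasure_mono) auto
    also have "\<dots> \<le> emeasure \<nu>s (S \<inter> N) + emeasure \<nu>s (- N)"
      using S N sets_s by (intro emeasure_subadditive) auto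
    finally show ?thesis .
  qed
  then have "emeasure \<nu>s (S \<inter> N) \<noteq> 0" using pos N(3) by auto
  then have SN: "emeasure \<nu> (S \<inter> N) \<noteq> 0" using sum[of "S \<inter> N"] S N by simp
  define \<rho> where "\<rho> = density \<nu> (indicator S)"
  have sets_\<rho>: "sets \<rho> = sets borel" using transformable_sets[OF \<nu>] by (simp add: \<rho>_def)
  have \<rho>: "emeasure \<rho> B = emeasure \<nu> (S \<inter> B)" if "B \<in> sets borel" for B
    unfolding \<rho>_def using S(1) that transformable_sets[OF \<nu>] by (intro emeasure_restricted) auto
  have "emeasure \<rho> (space \<rho>) \<noteq> \<infinity>"
    using \<rho>[of UNIV] transformable_emeasure_bounded[OF \<nu> S] sets_eq_imp_space_eq[OF sets_\<rho>] by auto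
  from inner_regular[OF sets_\<rho> this, of "S \<inter> N"] S N
  have "(SUP K\<in>{K. K \<subseteq> S \<inter> N \<and> compact K}. emeasure \<rho> K) = emeasure \<nu> (S \<inter> N)"
    using \<rho>[of "S \<inter> N"] by (simp add: Int_absorb1 flip: Int_assoc)
  then have "0 < (SUP K\<in>{K. K \<subseteq> S \<inter> N \<and> compact K}. emeasure \<rho> K)"
    using SN by (simp add: zero_less_iff_neq_zero)
  then obtain K where K: "K \<subseteq> S \<inter> N" "compact K" "0 < emeasure \<rho> K"
    unfolding less_SUP_iff by auto
  have Kb: "K \<in> sets borel" using K(2) by (simp add: borel_compact)
  have "emeasure lborel K \<le> emeasure lborel N" using K N by (intro emeasure_mono) auto
  moreover have "emeasure \<nu> K \<noteq> 0" using K \<rho>[OF Kb] by (simp add: Int_absorb1)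
  ultimately show ?thesis using K N by (intro exI[of _ K]) auto
qed

lemma empty_singular_spectrum_if_diverges:
  assumes \<mu>: "transformable \<mu>" and dec: "lebesgue_decomposition \<mu> w \<mu>s" and ab: "a < b"
    and inf: "(\<integral>\<^sup>+y\<in>{0<..<\<delta>}. 1 / distr_fun w {a..b} y \<partial>lborel) = \<infinity>"
    and \<alpha>: "\<alpha> \<noteq> 0" and T: "rank_one_perturbation \<mu> \<alpha> T"
  shows "empty_singular_spectrum \<mu> T (\<lambda>t. 1) {a..b}"
  unfolding empty_singular_spectrum_def
proof (intro allI impI)
  fix \<nu> v \<nu>s
  assume sm: "is_spectral_measure \<mu> T (\<lambda>t. 1) \<nu>" and dec\<nu>: "lebesgue_decomposition \<nu> v \<nu>s"
  have w: "w \<in> borel_measurable borel" using dec by (simp add: lebesgue_decomposition_def)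
  have "\<i> \<notin> \<real>" by (simp add: complex_is_Real_iff)
  then have \<nu>: "transformable \<nu>"
    using sm by (intro transformable_if_integrable_resolvent_kernel) (auto simp: is_spectral_measure_def)
  show "emeasure \<nu>s {a..b} = 0"
  proof (rule ccontr)
    assume pos: "emeasure \<nu>s {a..b} \<noteq> 0"
    let ?m = "(a + b) / 2"
    have sets_s: "sets \<nu>s = sets borel" using dec\<nu> by (simp add: lebesgue_decomposition_def)
    \<comment> \<open>One of the two halves of the interval carries singular mass, as \<open>G_square_lower_bound\<close> requires.\<close>
    have "emeasure \<nu>s {a..b} \<le> emeasure \<nu>s ({a..?m} \<union> {?m..b})"
      using sets_s by (intro emeasure_mono) auto
    also have "\<dots> \<le> emeasure \<nu>s {a..?m} + emeasure \<nu>s {?m..b}"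
      using sets_s by (intro emeasure_subadditive) auto
    finally have "emeasure \<nu>s {a..?m} \<noteq> 0 \<or> emeasure \<nu>s {?m..b} \<noteq> 0" using pos by auto
    then obtain S where S: "S = {a..?m} \<or> S = {?m..b}" "emeasure \<nu>s S \<noteq> 0" by blast
    then have "S \<in> sets borel" "bounded S" by auto
    from compact_null_set_of_positive_measure[OF \<nu> dec\<nu> this S(2)]
    obtain K where K: "compact K" "K \<subseteq> S" "emeasure lborel K = 0" "emeasure \<nu> K \<noteq> 0" by blast
    have Kb: "K \<in> sets borel" using K(1) by (simp add: borel_compact)
    have KI: "K \<subseteq> {a..b}" and half: "K \<subseteq> {..?m} \<or> K \<subseteq> {?m..}"
      using S(1) K(2) ab by auto
    define \<kappa> where "\<kappa> = density \<nu> (\<lambda>s. ennreal (indicator K s))"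
    define \<kappa>' where "\<kappa>' = density \<nu> (\<lambda>s. ennreal (indicator (- K) s))"
    have im: "(\<lambda>s. ennreal (indicator K s)) \<in> borel_measurable \<nu>"
      using Kb by (intro transformable_measurable[OF \<nu>]) simp
    have \<kappa>U: "emeasure \<kappa> UNIV = emeasure \<nu> K"
    proof -
      have "emeasure \<kappa> UNIV = (\<integral>\<^sup>+s. ennreal (indicator K s) * indicator UNIV s \<partial>\<nu>)"
        unfolding \<kappa>_def using im transformable_sets[OF \<nu>] by (intro emeasure_density) auto
      also have "\<dots> = (\<integral>\<^sup>+s. indicator K s \<partial>\<nu>)" by (intro nn_integral_cong) (simp add: ennreal_indicator)
      also have "\<dots> = emeasure \<nu> K" using Kb transformable_sets[OF \<nu>] by (intro nn_integral_indicator) auto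
      finally show ?thesis .
    qed
    have \<nu>K: "emeasure \<nu> K < \<infinity>"
      by (rule transformable_emeasure_bounded[OF \<nu> Kb compact_imp_bounded[OF K(1)]])
    interpret compactly_carried_measure \<kappa> K
    proof
      show "sets \<kappa> = sets borel" using transformable_sets[OF \<nu>] by (simp add: \<kappa>_def)
      show "compact K" by (rule K(1))
      show "AE s in \<kappa>. s \<in> K"
        unfolding \<kappa>_def AE_density[OF im] by (intro AE_I2) (simp add: indicator_def)
      show "emeasure \<kappa> UNIV < \<infinity>" unfolding \<kappa>U by (rule \<nu>K)
    qed
    have M: "0 < M"
      unfolding M_def measure_def \<kappa>U using K(4) \<nu>K by (simp add: enn2real_positive_iff zero_less_iff_neq_zero)
    have \<kappa>': "transformable \<kappa>'"
      unfolding \<kappa>'_def using Kb by (intro transformable_restriction(1)[OF \<nu>]) auto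
    have eq: "(borel_transform \<kappa> z + borel_transform \<kappa>' z) * (1 + of_real \<alpha> * borel_transform \<mu> z) = borel_transform \<mu> z"
      if z: "0 < Im z" for z
      unfolding \<kappa>_def \<kappa>'_def borel_transform_split[OF \<nu> Kb z] by (rule spectral_measure_transform[OF \<mu> T sm z])
    have "(\<integral>\<^sup>+t\<in>-K. ennreal ((G t)\<^sup>2) \<partial>\<mu>) \<le> 2 * ennreal (4 * pi * M / \<alpha>\<^sup>2)"
      by (rule G_square_integrable[OF \<mu> two_weight_estimate[OF \<kappa>' \<mu> \<alpha> _ eq]])
    also have "\<dots> < \<infinity>" by (simp add: ennreal_mult_less_top)
    finally have fin: "(\<integral>\<^sup>+t\<in>-K. ennreal ((G t)\<^sup>2) \<partial>\<mu>) < \<infinity>" .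
    note [measurable] = G_measurable K_borel w
    have "\<infinity> = (\<integral>\<^sup>+x\<in>{a..b} - K. ennreal ((G x)\<^sup>2) * w x \<partial>lborel)"
      by (rule weighted_G_square_infinite[OF w ab KI half K(3) M inf, symmetric])
    also have "\<dots> \<le> (\<integral>\<^sup>+x. w x * (ennreal ((G x)\<^sup>2) * indicator (-K) x) \<partial>lborel)"
      by (intro nn_integral_mono) (auto simp: indicator_def mult.commute)
    also have "\<dots> = (\<integral>\<^sup>+x\<in>-K. ennreal ((G x)\<^sup>2) \<partial>density lborel w)"
      by (rule nn_integral_density[symmetric]) measurable
    also have "\<dots> \<le> (\<integral>\<^sup>+x\<in>-K. ennreal ((G x)\<^sup>2) \<partial>\<mu>)"
    proof (rule nn_integral_mono_measure)
      show s: "sets (density lborel w) = sets \<mu>" using transformable_sets[OF \<mu>] by simp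
      show "density lborel w \<le> \<mu>"
        unfolding le_measure[OF s] using dec s by (auto simp: le_fun_def lebesgue_decomposition_def)
    qed
    finally show False using fin by (simp add: top_unique)
  qed
qed

theorem theorem4p6:
  fixes \<mu> \<mu>s :: "real measure" and w :: "real \<Rightarrow> ennreal" and a b :: real
  assumes "sets \<mu> = sets borel"
    and "integrable \<mu> (\<lambda>t. 1 / (1 + \<bar>t\<bar>))"
    and "lebesgue_decomposition \<mu> w \<mu>s"
    and "a < b"
  shows "((\<exists>\<delta>>0. (\<integral>\<^sup>+ y\<in>{0<..<\<delta>}. 1 / distr_fun w {a..b} y \<partial>lborel) = \<infinity>)
            \<longleftrightarrow> (\<exists>\<epsilon>>0. \<epsilon> < b - a \<and>
                  (\<integral>\<^sup>+ x\<in>{0<..<\<epsilon>}. ennreal (incr_rearr w {a..b} x / x\<^sup>2) \<partial>lborel) = \<infinity>))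
       \<and> ((\<exists>\<delta>>0. (\<integral>\<^sup>+ y\<in>{0<..<\<delta>}. 1 / distr_fun w {a..b} y \<partial>lborel) = \<infinity>)
            \<longrightarrow> (\<forall>\<alpha>::real. \<alpha> \<noteq> 0 \<longrightarrow> (\<forall>A\<^sub>\<alpha>. rank_one_perturbation \<mu> \<alpha> A\<^sub>\<alpha> \<longrightarrow>
                   empty_singular_spectrum \<mu> A\<^sub>\<alpha> (\<lambda>t. 1) {a..b})))"
proof
  have \<mu>: "transformable \<mu>" using assms(1,2) by (simp add: transformable_def)
  have w: "w \<in> borel_measurable borel" using assms(3) by (simp add: lebesgue_decomposition_def)
  have "(\<integral>\<^sup>+x. w x * indicator {a..b} x \<partial>lborel) = emeasure (density lborel w) {a..b}"
    using w by (intro emeasure_density[symmetric]) auto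
  also have "\<dots> \<le> emeasure \<mu> {a..b}"
    using assms(3) by (simp add: lebesgue_decomposition_def)
  also have "\<dots> < \<infinity>" by (rule transformable_emeasure_bounded[OF \<mu>]) auto
  finally have "AE x in lborel. w x * indicator {a..b} x \<noteq> \<infinity>"
    using w by (intro nn_integral_PInf_AE) auto
  then have "AE x in lborel. x \<in> {a..b} \<longrightarrow> w x < \<infinity>"
    by eventually_elim (auto simp: less_top[symmetric])
  then show "(\<exists>\<delta>>0. (\<integral>\<^sup>+ y\<in>{0<..<\<delta>}. 1 / distr_fun w {a..b} y \<partial>lborel) = \<infinity>)
            \<longleftrightarrow> (\<exists>\<epsilon>>0. \<epsilon> < b - a \<and>
                  (\<integral>\<^sup>+ x\<in>{0<..<\<epsilon>}. ennreal (incr_rearr w {a..b} x / x\<^sup>2) \<partial>lborel) = \<infinity>)"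
    by (rule divergence_iff[OF w assms(4)])
  show "(\<exists>\<delta>>0. (\<integral>\<^sup>+ y\<in>{0<..<\<delta>}. 1 / distr_fun w {a..b} y \<partial>lborel) = \<infinity>)
            \<longrightarrow> (\<forall>\<alpha>::real. \<alpha> \<noteq> 0 \<longrightarrow> (\<forall>A\<^sub>\<alpha>. rank_one_perturbation \<mu> \<alpha> A\<^sub>\<alpha> \<longrightarrow>
                   empty_singular_spectrum \<mu> A\<^sub>\<alpha> (\<lambda>t. 1) {a..b}))"
    using empty_singular_spectrum_if_diverges[OF \<mu> assms(3,4)] by blast
qed

end
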